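(* For $F,G\in \mathrm{Dom}(D)$, $$\mathrm{Cov}(F,G)=\mathbb{E}\left[\sum_{k=0}^{\infty}\big\langle\mathbb{E}[D_kF\,|\,\mathcal{F}_{k-1}],D_kG\big\rangle\right]$$ and $$\mathrm{Cov}(F,G)=\mathbb{E}\left[\sum_{k=0}^{\infty}\int_0^{\infty}e^{-t}\langle D_kF,P_tD_kG\rangle\, dt\right].$$
   Context: Let $d\ge 1$, $\Omega=\{0,\dots,d\}^{\mathbb{N}}$ ($0\in\mathbb{N}$) with its product $\sigma$-field $\mathcal{F}$, coordinate maps $X_n(w)=w_n$, $\mathcal{F}_n=\sigma(X_0,\dots,X_n)$, $\mathcal{F}_{-1}=\{\varnothing,\Omega\}$, and a probability $\mathbb{P}$ such that $p_n^i=\mathbb{P}(X_n=i\,|\,\mathcal{F}_{n-1})>0$ for all $n,i$. For each $n$ let $v_0(n),\dots,v_d(n)$ be $\mathcal{F}_{n-1}$-measurable $\mathbb{R}^d$-valued random variables and $Y_n=v_{X_n}(n)=(Y_n^1,\dots,Y_n^d)$. Assume (obtuse random walk) $\sigma(Y_0,\dots,Y_n)=\mathcal{F}_n$, $\mathbb{E}[Y_n^i\,|\,\mathcal{F}_{n-1}]=0$ and $\mathbb{E}[Y_n^iY_n^j\,|\,\mathcal{F}_{n-1}]=\delta^{ij}$ for all $n\ge0$, $1\le i,j\le d$. $\langle\cdot,\cdot\rangle$ and $\|\cdot\|$ are Euclidean in $\mathbb{R}^d$ and $L^2(\Omega)=L^2(\Omega,\mathcal{F},\mathbb{P})$. Multiple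 integrals: $\Delta_r=\{(i_1,\dots,i_r)\in\mathbb{N}^r: i_l\ne i_k \text{ for } l\neq k\}$. A function $f_r=(f_r^{k_1,\dots,k_r})_{1\le k_1,\dots,k_r\le d}:\Delta_r\to\mathbb{R}^{d^r}$ is symmetric if $f_r^{k_{\sigma(1)},\dots,k_{\sigma(r)}}(i_{\sigma(1)},\dots,i_{\sigma(r)})=f_r^{k_1,\dots,k_r}(i_1,\dots,i_r)$ for every permutation $\sigma$. For symmetric square-summable $f_r\in L^2(\Delta_r,\mathbb{R}^{d^r})$, $r\ge1$, $$\mathcal{I}^r(f_r)=\sum_{k_1,\dots,k_r=1}^d\ \sum_{(i_1,\dots,i_r)\in\Delta_r}f_r^{k_1,\dots,k_r}(i_1,\dots,i_r)Y_{i_1}^{k_1}\cdots Y_{i_r}^{k_r}$$ (convergence in $L^2(\Omega)$), and $\mathcal{I}^0(f_0)=f_0$ for $f_0\in\mathbb{R}$. Every $F\in L^2(\Omega)$ has a unique orthogonal expansion $F=\sum_{n\ge0}\mathcal{I}^n(f_n)$ with symmetric $f_n$ (chaos representation property). $\mathcal{S}$ is the dense subspace of finite sums $\sum_{r=0}^n\mathcal{I}^r(f_r)$. Gradient: $D_k=(D_k^1,\dots,D_k^d)$, $k\in\mathbb{N}$, is the linear operator on $\mathcal{S}$ with $D_k^j\mathcal{I}^0(f_0)=0$ and $D_k^j\mathcal{I}^r(f_r)=r\,\mathcal{I}^{r-1}\big(f_r^j( *,k)1_{\Delta_r}( *,k)\big)$ for $r\ge1$, where $f_r^j( *,k)1_{\Delta_r}(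 *,k)$ is the function on $\Delta_{r-1}$ with components $(i_1,\dots,i_{r-1})\mapsto f_r^{k_1,\dots,k_{r-1},j}(i_1,\dots,i_{r-1},k)$ if $k\notin\{i_1,\dots,i_{r-1}\}$ and $0$ otherwise. Each $D_k^j$ is extended to $L^2(\Omega)$ by $L^2$-continuity. $F\in\mathrm{Dom}(D)$ iff $F\in L^2(\Omega)$ and $\mathbb{E}\big[\sum_{k\ge0}\|D_kF\|^2\big]<\infty$. $\mathrm{Cov}(F,G)=\mathbb{E}[FG]-\mathbb{E}[F]\mathbb{E}[G]$. The Ornstein–Uhlenbeck semigroup is $P_tF=\sum_{n\ge0}e^{-nt}\mathcal{I}^n(f_n)$ for $F=\sum_{n\ge0}\mathcal{I}^n(f_n)\in L^2(\Omega)$, $t\ge0$; on $\mathbb{R}^d$-valued variables $P_t$ and conditional expectation act componentwise. *)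

theory Defs
  imports "HOL-Probability.Probability" "HOL-Combinatorics.Combinatorics"
begin

section \<open>Obtuse random walks\<close>

text \<open>The dimension is \<open>d = CARD('d)\<close>; the state space is \<open>{0..d}\<close>, and the coordinate map
  \<open>X\<^sub>n\<close> is \<open>\<lambda>w. w n\<close>. The \<open>\<sigma>\<close>-algebra \<open>past M n\<close> is generated by \<open>X\<^sub>i\<close> for \<open>i < n\<close>, so it is
  \<open>\<F>\<^bsub>n-1\<^esub>\<close> (trivial for \<open>n = 0\<close>), and \<open>\<F>\<^sub>n\<close> is \<open>past M (Suc n)\<close>.\<close>

definition past :: "(nat \<Rightarrow> nat) measure \<Rightarrow> nat \<Rightarrow> (nat \<Rightarrow> nat) measure" where
  "past M n = sigma (space M) {{w \<in> space M. w i \<in> A} | i A. i < n}"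

definition walk ::
  "(nat \<Rightarrow> nat \<Rightarrow> (nat \<Rightarrow> nat) \<Rightarrow> real ^ 'd) \<Rightarrow> nat \<Rightarrow> (nat \<Rightarrow> nat) \<Rightarrow> real ^ ('d::finite)" where
  "walk v n w = v (w n) n w"

locale obtuse_random_walk = prob_space M
  for M :: "(nat \<Rightarrow> nat) measure" +
  fixes v :: "nat \<Rightarrow> nat \<Rightarrow> (nat \<Rightarrow> nat) \<Rightarrow> real ^ ('d::finite)"
  assumes sets_M: "sets M = sets (PiM UNIV (\<lambda>_. count_space {0..CARD('d)}))"
    and transition_pos: "\<And>n i. i \<le> CARD('d) \<Longrightarrow>
          AE w in M. real_cond_exp M (past M n) (indicator {w \<in> space M. w n = i}) w > 0"
    and v_measurable: "\<And>n i. i \<le> CARD('d) \<Longrightarrow> v i n \<in> borel_measurable (past M n)"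
    and sigma_walk: "\<And>n. sigma_sets (space M)
          {walk v i -` B \<inter> space M | i B. i \<le> n \<and> B \<in> sets borel} = sets (past M (Suc n))"
    and walk_centered: "\<And>n i. AE w in M. real_cond_exp M (past M n) (\<lambda>w. walk v n w $ i) w = 0"
    and walk_covariance: "\<And>n i j. AE w in M.
          real_cond_exp M (past M n) (\<lambda>w. walk v n w $ i * walk v n w $ j) w = (if i = j then 1 else 0)"


section \<open>Square-integrable random variables\<close>

definition L2 :: "'a measure \<Rightarrow> ('a \<Rightarrow> real) set" where
  "L2 M = {F \<in> borel_measurable M. integrable M (\<lambda>w. (F w)\<^sup>2)}"

definition L2_tendsto ::
  "'a measure \<Rightarrow> ('b \<Rightarrow> 'a \<Rightarrow> real) \<Rightarrow> ('a \<Rightarrow> real) \<Rightarrow> 'b filter \<Rightarrow> bool" where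
  "L2_tendsto M u F net \<longleftrightarrow> ((\<lambda>b. \<integral>\<^sup>+w. ennreal ((u b w - F w)\<^sup>2) \<partial>M) \<longlongrightarrow> 0) net"

definition cov :: "'a measure \<Rightarrow> ('a \<Rightarrow> real) \<Rightarrow> ('a \<Rightarrow> real) \<Rightarrow> real" where
  "cov M F G = (\<integral>w. F w * G w \<partial>M) - (\<integral>w. F w \<partial>M) * (\<integral>w. G w \<partial>M)"

definition vec_cond_exp ::
  "'a measure \<Rightarrow> 'a measure \<Rightarrow> ('a \<Rightarrow> real ^ 'd) \<Rightarrow> 'a \<Rightarrow> real ^ ('d::finite)" where
  "vec_cond_exp M N Z w = (\<chi> j. real_cond_exp M N (\<lambda>w. Z w $ j) w)"


section \<open>Multiple integrals\<close>

text \<open>Tuples are lists: a kernel \<open>f :: 'd list \<Rightarrow> nat list \<Rightarrow> real\<close> has the components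
  \<open>f [k\<^sub>1, \<dots>, k\<^sub>r] [i\<^sub>1, \<dots>, i\<^sub>r]\<close>. Only its values for colour lists of length \<open>r\<close> and index lists
  in \<open>offdiag r\<close> (written \<open>\<Delta>\<^sub>r\<close> in the literature) matter.\<close>

definition offdiag :: "nat \<Rightarrow> nat list set" where
  "offdiag r = {is. length is = r \<and> distinct is}"

definition sym_kernels :: "nat \<Rightarrow> ('d::finite list \<Rightarrow> nat list \<Rightarrow> real) set" where
  "sym_kernels r = {f.
     (\<forall>ks is p. length ks = r \<and> is \<in> offdiag r \<and> p permutes {..<r} \<longrightarrow>
        f (permute_list p ks) (permute_list p is) = f ks is) \<and>
     (\<forall>ks. length ks = r \<longrightarrow> (\<lambda>is. (f ks is)\<^sup>2) summable_on offdiag r)}"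

text \<open>Elements of \<open>L\<^sup>2\<close> are represented by functions, determined up to null sets; operators with
  values in \<open>L\<^sup>2\<close> choose one representative of their value.\<close>

definition mult_int ::
  "(nat \<Rightarrow> nat) measure \<Rightarrow> (nat \<Rightarrow> nat \<Rightarrow> (nat \<Rightarrow> nat) \<Rightarrow> real ^ ('d::finite)) \<Rightarrow>
    nat \<Rightarrow> ('d list \<Rightarrow> nat list \<Rightarrow> real) \<Rightarrow> (nat \<Rightarrow> nat) \<Rightarrow> real" where
  "mult_int M v r f = (if r = 0 then (\<lambda>_. f [] []) else
     (SOME F. F \<in> L2 M \<and>
        L2_tendsto M
          (\<lambda>A w. \<Sum>ks | length ks = r. \<Sum>is\<in>A. f ks is * (\<Prod>l<r. walk v (is ! l) w $ (ks ! l)))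
          F (finite_subsets_at_top (offdiag r))))"

definition chaos_sum ::
  "(nat \<Rightarrow> nat) measure \<Rightarrow> (nat \<Rightarrow> nat \<Rightarrow> (nat \<Rightarrow> nat) \<Rightarrow> real ^ ('d::finite)) \<Rightarrow>
    nat \<Rightarrow> (nat \<Rightarrow> 'd list \<Rightarrow> nat list \<Rightarrow> real) \<Rightarrow> (nat \<Rightarrow> nat) \<Rightarrow> real" where
  "chaos_sum M v n f w = (\<Sum>r\<le>n. mult_int M v r (f r) w)"

definition chaos_expansion ::
  "(nat \<Rightarrow> nat) measure \<Rightarrow> (nat \<Rightarrow> nat \<Rightarrow> (nat \<Rightarrow> nat) \<Rightarrow> real ^ ('d::finite)) \<Rightarrow>
    (nat \<Rightarrow> 'd list \<Rightarrow> nat list \<Rightarrow> real) \<Rightarrow> ((nat \<Rightarrow> nat) \<Rightarrow> real) \<Rightarrow> bool" where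
  "chaos_expansion M v f F \<longleftrightarrow>
     (\<forall>n. f n \<in> sym_kernels n) \<and> L2_tendsto M (\<lambda>n. chaos_sum M v n f) F sequentially"


section \<open>Gradient\<close>

definition grad_kernel ::
  "nat \<Rightarrow> 'd \<Rightarrow> ('d list \<Rightarrow> nat list \<Rightarrow> real) \<Rightarrow> 'd list \<Rightarrow> nat list \<Rightarrow> real" where
  "grad_kernel k j f ks is = (if k \<in> set is then 0 else f (ks @ [j]) (is @ [k]))"

text \<open>\<open>D\<^sub>k\<^sup>j\<close> applied to the finite chaos sum \<open>chaos_sum M v n f\<close>.\<close>

definition grad_chaos_sum ::
  "(nat \<Rightarrow> nat) measure \<Rightarrow> (nat \<Rightarrow> nat \<Rightarrow> (nat \<Rightarrow> nat) \<Rightarrow> real ^ ('d::finite)) \<Rightarrow>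
    nat \<Rightarrow> 'd \<Rightarrow> nat \<Rightarrow> (nat \<Rightarrow> 'd list \<Rightarrow> nat list \<Rightarrow> real) \<Rightarrow> (nat \<Rightarrow> nat) \<Rightarrow> real" where
  "grad_chaos_sum M v k j n f w =
     (\<Sum>r=1..n. real r * mult_int M v (r - 1) (grad_kernel k j (f r)) w)"

text \<open>Extension by \<open>L\<^sup>2\<close>-continuity: \<open>D\<^sub>k\<^sup>j F\<close> is the \<open>L\<^sup>2\<close>-limit of \<open>D\<^sub>k\<^sup>j F\<^sub>m\<close> for every sequence \<open>F\<^sub>m\<close> of
  finite chaos sums that converges to \<open>F\<close> in \<open>L\<^sup>2\<close>.\<close>

definition grad_comp ::
  "(nat \<Rightarrow> nat) measure \<Rightarrow> (nat \<Rightarrow> nat \<Rightarrow> (nat \<Rightarrow> nat) \<Rightarrow> real ^ ('d::finite)) \<Rightarrow>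
    nat \<Rightarrow> 'd \<Rightarrow> ((nat \<Rightarrow> nat) \<Rightarrow> real) \<Rightarrow> (nat \<Rightarrow> nat) \<Rightarrow> real" where
  "grad_comp M v k j F = (SOME H. H \<in> L2 M \<and>
     (\<forall>n f. (\<forall>m r. f m r \<in> sym_kernels r) \<and>
        L2_tendsto M (\<lambda>m. chaos_sum M v (n m) (f m)) F sequentially \<longrightarrow>
        L2_tendsto M (\<lambda>m. grad_chaos_sum M v k j (n m) (f m)) H sequentially))"

definition grad ::
  "(nat \<Rightarrow> nat) measure \<Rightarrow> (nat \<Rightarrow> nat \<Rightarrow> (nat \<Rightarrow> nat) \<Rightarrow> real ^ ('d::finite)) \<Rightarrow>
    nat \<Rightarrow> ((nat \<Rightarrow> nat) \<Rightarrow> real) \<Rightarrow> (nat \<Rightarrow> nat) \<Rightarrow> real ^ 'd" where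
  "grad M v k F w = (\<chi> j. grad_comp M v k j F w)"

definition Dom_grad ::
  "(nat \<Rightarrow> nat) measure \<Rightarrow> (nat \<Rightarrow> nat \<Rightarrow> (nat \<Rightarrow> nat) \<Rightarrow> real ^ ('d::finite)) \<Rightarrow>
    ((nat \<Rightarrow> nat) \<Rightarrow> real) set" where
  "Dom_grad M v =
     {F \<in> L2 M. (\<integral>\<^sup>+w. (\<Sum>k. ennreal ((norm (grad M v k F w))\<^sup>2)) \<partial>M) < \<infinity>}"


section \<open>Ornstein--Uhlenbeck semigroup\<close>

text \<open>Each \<open>P\<^sub>t F\<close> is determined up to a null set that may depend on \<open>t\<close>. So that integrals over \<open>t\<close>
  at a fixed \<open>w\<close> make sense, the representatives are chosen jointly measurable in \<open>(t, w)\<close>.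
  For negative \<open>t\<close> the value is unspecified.\<close>

definition OU ::
  "(nat \<Rightarrow> nat) measure \<Rightarrow> (nat \<Rightarrow> nat \<Rightarrow> (nat \<Rightarrow> nat) \<Rightarrow> real ^ ('d::finite)) \<Rightarrow>
    real \<Rightarrow> ((nat \<Rightarrow> nat) \<Rightarrow> real) \<Rightarrow> (nat \<Rightarrow> nat) \<Rightarrow> real" where
  "OU M v t F = (SOME u. (\<lambda>(t, w). u t w) \<in> borel_measurable (borel \<Otimes>\<^sub>M M) \<and>
     (\<exists>f. chaos_expansion M v f F \<and>
        (\<forall>t\<ge>0. u t \<in> L2 M \<and>
           L2_tendsto M (\<lambda>N w. \<Sum>n\<le>N. exp (- (real n * t)) * mult_int M v n (f n) w)
             (u t) sequentially))) t"

definition OU_vec ::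
  "(nat \<Rightarrow> nat) measure \<Rightarrow> (nat \<Rightarrow> nat \<Rightarrow> (nat \<Rightarrow> nat) \<Rightarrow> real ^ ('d::finite)) \<Rightarrow>
    real \<Rightarrow> ((nat \<Rightarrow> nat) \<Rightarrow> real ^ 'd) \<Rightarrow> (nat \<Rightarrow> nat) \<Rightarrow> real ^ 'd" where
  "OU_vec M v t Z w = (\<chi> j. OU M v t (\<lambda>w. Z w $ j) w)"

end

theory Submission
  imports Defs
begin

text \<open>
  The covariance is diagonal in an orthonormal basis of \<open>L\<^sup>2\<close> in which the gradient, the conditional
  expectations and the semigroup only delete, move or rescale coordinates. Both identities then amount
  to counting how often each coordinate occurs.

  The basis consists of the monomials \<open>e\<^sub>S = \<Prod>\<^bsub>(i, k) \<in> S\<^esub> Y\<^sub>i\<^sup>k\<close>, where \<open>S\<close> runs over the finite sets of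
  pairs with distinct times. They are orthonormal because the last factor of a product can be integrated
  out given its past (\<open>walk_monomial_orthonormal\<close>). They are total because at each time the \<open>d + 1\<close> functions
  \<open>1, Y\<^sub>n\<^sup>1, \<dots>, Y\<^sub>n\<^sup>d\<close> are conditionally orthonormal on \<open>d + 1\<close> points: scaled by the square roots of the transition
  probabilities they form an orthogonal matrix,
  and orthogonality of the transposed matrix expresses the indicator of \<open>X\<^sub>n = a\<close> as
  \<open>p\<^sub>n\<^sup>a (1 + \<langle>v\<^sub>a(n), Y\<^sub>n\<rangle>)\<close> (\<open>indicator_eq_walk\<close>). So every function of finitely many coordinates is a
  combination of monomials, and a function orthogonal to all monomials vanishes
  (\<open>orthogonal_imp_AE_zero\<close>). With the completeness of \<open>L\<^sup>2\<close> this identifies \<open>L\<^sup>2\<close> with the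
  square-summable families on multi-indices (\<open>riesz_fischer\<close>, \<open>parseval\<close>).

  Write \<open>F\<^sub>S\<close> for the coefficient \<open>E[F e\<^sub>S]\<close>. A multi-index of size \<open>r\<close> has \<open>r!\<close> enumerations, so the multiple
  integral of order \<open>r\<close> has the coefficient \<open>r! f(S)\<close> at \<open>S\<close> if \<open>S\<close> has \<open>r\<close> elements and \<open>0\<close> otherwise
  (\<open>mult_int_coef\<close>). The operators act as follows at a multi-index \<open>T\<close>.
    \<^item> \<open>D\<^sub>k\<^sup>j F\<close> has the coefficient \<open>F\<^bsub>T \<union> {(k, j)}\<^esub>\<close> if the time \<open>k\<close> does not occur in \<open>T\<close>, and \<open>0\<close> otherwise
      (\<open>grad_comp_coef\<close>); this is a contraction, which gives the extension by continuity.
    \<^item> The conditional expectation given \<open>\<F>\<^bsub>k-1\<^esub>\<close> keeps the coefficient if all times in \<open>T\<close> are less than \<open>k\<close>, and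
      replaces it by \<open>0\<close> otherwise (\<open>cond_exp_coef\<close>).
    \<^item> \<open>P\<^sub>t\<close> multiplies the coefficient by \<open>e\<^sup>-\<^sup>t\<^sup>|\<^sup>T\<^sup>|\<close> (\<open>OU_coef\<close>).

  By Parseval's identity, \<open>Cov(F, G)\<close> is the sum of \<open>F\<^sub>S G\<^sub>S\<close> over \<open>S \<noteq> \<emptyset>\<close>. In the first formula the \<open>k\<close>-th
  term is the sum of \<open>F\<^sub>S G\<^sub>S\<close> over those \<open>S = T \<union> {(k, j)}\<close> in which \<open>k\<close> is the last time, and each
  nonempty \<open>S\<close> has exactly one last time (\<open>sums_last_pair\<close>). In the second formula \<open>(k, j)\<close> may be any pair of
  \<open>S\<close>, so that \<open>F\<^sub>S G\<^sub>S\<close> occurs \<open>|S|\<close> times, but each time with the weight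
  \<open>\<integral>\<^sub>0\<^sup>\<infinity> e\<^sup>-\<^sup>t e\<^sup>-\<^sup>t\<^sup>|\<^sup>T\<^sup>| dt = 1 / (|T| + 1) = 1 / |S|\<close> (\<open>OU_time_integral\<close>, \<open>sums_any_pair\<close>).

  All exchanges of sums and integrals rest on one bound: conditional expectation and semigroup are
  contractions, so the \<open>k\<close>-th terms have \<open>L\<^sup>1\<close>-norm at most
  \<open>(E \<parallel>D\<^sub>k F\<parallel>\<^sup>2 + E \<parallel>D\<^sub>k G\<parallel>\<^sup>2) / 2\<close>, which is summable in \<open>k\<close> on the domain of the gradient.
\<close>

section \<open>Square-integrable functions\<close>

text \<open>The sum of the \<open>L\<^sup>1\<close>-norms is the integral of \<open>\<Sum>i. \<bar>f i\<bar>\<close>, which is therefore finite almost everywhere.\<close>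

lemma integral_suminf_AE_summable:
  fixes f :: "nat \<Rightarrow> 'a \<Rightarrow> real"
  assumes f: "\<And>i. integrable M (f i)" and s: "summable (\<lambda>i. \<integral>w. \<bar>f i w\<bar> \<partial>M)"
  shows "AE w in M. summable (\<lambda>i. \<bar>f i w\<bar>)"
proof -
  have [measurable]: "f i \<in> borel_measurable M" for i using f by auto
  have "(\<integral>\<^sup>+w. (\<Sum>i. ennreal \<bar>f i w\<bar>) \<partial>M) = (\<Sum>i. ennreal (\<integral>w. \<bar>f i w\<bar> \<partial>M))"
    by (subst nn_integral_suminf) (auto intro!: suminf_cong nn_integral_eq_integral f)
  also have "\<dots> < \<infinity>"
    by (subst suminf_ennreal_eq[OF _ summable_sums[OF s]]) (auto simp: ennreal_less_top)
  finally have "AE w in M. (\<Sum>i. ennreal \<bar>f i w\<bar>) \<noteq> \<infinity>"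
    by (intro nn_integral_noteq_infinite) auto
  then show ?thesis
    by eventually_elim (auto intro: summable_suminf_not_top simp: infinity_ennreal_def)
qed

lemma L2_measurable [measurable_dest]: "F \<in> L2 M \<Longrightarrow> F \<in> borel_measurable M"
  by (simp add: L2_def)

lemma L2_integrable_square: "F \<in> L2 M \<Longrightarrow> integrable M (\<lambda>w. (F w)\<^sup>2)"
  by (simp add: L2_def)

lemma abs_mult_le_squares: "\<bar>a * b\<bar> \<le> (a\<^sup>2 + b\<^sup>2) / 2" for a b :: real
  using sum_squares_bound[of "\<bar>a\<bar>" "\<bar>b\<bar>"] by (simp add: abs_mult)

lemma L2_integrable_mult:
  assumes "F \<in> L2 M" "G \<in> L2 M"
  shows "integrable M (\<lambda>w. F w * G w)"
proof (rule Bochner_Integration.integrable_bound)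
  show "integrable M (\<lambda>w. ((F w)\<^sup>2 + (G w)\<^sup>2) / 2)"
    using assms by (auto simp: L2_def)
  show "(\<lambda>w. F w * G w) \<in> borel_measurable M"
    using assms by (auto simp: L2_def)
  show "AE w in M. norm (F w * G w) \<le> norm (((F w)\<^sup>2 + (G w)\<^sup>2) / 2)"
    using abs_mult_le_squares by (auto intro!: AE_I2)
qed

lemma integral_abs_mult_le:
  assumes "F \<in> L2 M" "G \<in> L2 M"
  shows "(\<integral>w. \<bar>F w * G w\<bar> \<partial>M) \<le> ((\<integral>w. (F w)\<^sup>2 \<partial>M) + (\<integral>w. (G w)\<^sup>2 \<partial>M)) / 2"
proof -
  have "(\<integral>w. \<bar>F w * G w\<bar> \<partial>M) \<le> (\<integral>w. ((F w)\<^sup>2 + (G w)\<^sup>2) / 2 \<partial>M)"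
    using assms by (intro integral_mono abs_mult_le_squares)
      (use assms in \<open>auto intro!: L2_integrable_mult simp: L2_def\<close>)
  also have "\<dots> = ((\<integral>w. (F w)\<^sup>2 \<partial>M) + (\<integral>w. (G w)\<^sup>2 \<partial>M)) / 2"
    using assms by (simp add: L2_def)
  finally show ?thesis .
qed

lemma L2_cmult: "F \<in> L2 M \<Longrightarrow> (\<lambda>w. c * F w) \<in> L2 M"
  by (auto simp: L2_def power_mult_distrib)

lemma L2_add:
  assumes "F \<in> L2 M" "G \<in> L2 M"
  shows "(\<lambda>w. F w + G w) \<in> L2 M"
  using assms L2_integrable_mult[OF assms] by (auto simp: L2_def power2_sum mult.assoc)

lemma L2_diff:
  assumes "F \<in> L2 M" "G \<in> L2 M"
  shows "(\<lambda>w. F w - G w) \<in> L2 M"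
  using L2_add[OF assms(1) L2_cmult[OF assms(2), of "-1"]] by simp

lemma L2_sum: "(\<And>a. a \<in> A \<Longrightarrow> F a \<in> L2 M) \<Longrightarrow> (\<lambda>w. \<Sum>a\<in>A. F a w) \<in> L2 M"
  by (induction A rule: infinite_finite_induct) (auto intro: L2_add, simp_all add: L2_def)

lemma integral_square_add_le:
  assumes "F \<in> L2 M" "G \<in> L2 M"
  shows "(\<integral>w. (F w + G w)\<^sup>2 \<partial>M) \<le> 2 * (\<integral>w. (F w)\<^sup>2 \<partial>M) + 2 * (\<integral>w. (G w)\<^sup>2 \<partial>M)"
proof -
  have "(\<integral>w. (F w + G w)\<^sup>2 \<partial>M) \<le> (\<integral>w. 2 * (F w)\<^sup>2 + 2 * (G w)\<^sup>2 \<partial>M)"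
  proof (rule integral_mono)
    show "(F w + G w)\<^sup>2 \<le> 2 * (F w)\<^sup>2 + 2 * (G w)\<^sup>2" for w
      using sum_squares_bound[of "F w" "G w"] by (simp add: power2_sum)
  qed (use assms L2_add[OF assms] in \<open>auto simp: L2_def\<close>)
  also have "\<dots> = 2 * (\<integral>w. (F w)\<^sup>2 \<partial>M) + 2 * (\<integral>w. (G w)\<^sup>2 \<partial>M)"
    using assms by (simp add: L2_def)
  finally show ?thesis .
qed

lemma nn_integral_square_L2:
  "F \<in> L2 M \<Longrightarrow> (\<integral>\<^sup>+w. ennreal ((F w)\<^sup>2) \<partial>M) = ennreal (\<integral>w. (F w)\<^sup>2 \<partial>M)"
  by (intro nn_integral_eq_integral) (auto simp: L2_def)

lemma L2_tendsto_iff: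
  assumes "\<forall>\<^sub>F b in net. u b \<in> L2 M" "F \<in> L2 M"
  shows "L2_tendsto M u F net \<longleftrightarrow> ((\<lambda>b. \<integral>w. (u b w - F w)\<^sup>2 \<partial>M) \<longlongrightarrow> 0) net"
proof -
  have "L2_tendsto M u F net \<longleftrightarrow> ((\<lambda>b. ennreal (\<integral>w. (u b w - F w)\<^sup>2 \<partial>M)) \<longlongrightarrow> ennreal 0) net"
    unfolding L2_tendsto_def ennreal_0
    by (intro tendsto_cong eventually_mono[OF assms(1)] nn_integral_square_L2 L2_diff assms(2))
  also have "\<dots> \<longleftrightarrow> ((\<lambda>b. \<integral>w. (u b w - F w)\<^sup>2 \<partial>M) \<longlongrightarrow> 0) net"
    by (rule tendsto_ennreal_iff) auto
  finally show ?thesis .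
qed

context prob_space begin

lemma L2_const: "(\<lambda>_. c) \<in> L2 M"
  by (simp add: L2_def)

lemma L2_integrable: "F \<in> L2 M \<Longrightarrow> integrable M F"
  using L2_integrable_mult[OF _ L2_const[of 1]] by simp

lemma L2_bounded:
  assumes "F \<in> borel_measurable M" "\<And>w. w \<in> space M \<Longrightarrow> \<bar>F w\<bar> \<le> B"
  shows "F \<in> L2 M"
proof -
  have "integrable M (\<lambda>w. (F w)\<^sup>2)"
  proof (rule integrable_const_bound[where B="B\<^sup>2"])
    have "(F w)\<^sup>2 \<le> B\<^sup>2" if "w \<in> space M" for w
      using power_mono[OF assms(2)[OF that], of 2] by simp
    then show "AE w in M. norm ((F w)\<^sup>2) \<le> B\<^sup>2" by simp
  qed (use assms in auto)
  then show ?thesis using assms by (simp add: L2_def)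
qed

text \<open>Fatou's lemma turns an almost sure limit of an \<open>L\<^sup>2\<close>-Cauchy sequence into an \<open>L\<^sup>2\<close>-limit.\<close>

lemma L2_Cauchy_AE_limit:
  assumes u: "\<And>n. u n \<in> L2 M" and H: "H \<in> borel_measurable M"
    and AE: "AE w in M. (\<lambda>n. u n w) \<longlonglongrightarrow> H w"
    and Cauchy: "\<And>e. e > 0 \<Longrightarrow> \<exists>N. \<forall>m\<ge>N. \<forall>n\<ge>N. (\<integral>w. (u m w - u n w)\<^sup>2 \<partial>M) < e"
  shows "H \<in> L2 M" "(\<lambda>n. \<integral>w. (u n w - H w)\<^sup>2 \<partial>M) \<longlonglongrightarrow> 0"
proof -
  have [measurable]: "u n \<in> borel_measurable M" for n using u by (auto simp: L2_def)
  note H [measurable]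
  have fatou: "(\<integral>\<^sup>+w. ennreal ((u n w - H w)\<^sup>2) \<partial>M) \<le> ennreal e"
    if N: "\<forall>m\<ge>N. \<forall>n\<ge>N. (\<integral>w. (u m w - u n w)\<^sup>2 \<partial>M) < e" "n \<ge> N" for N n e
  proof -
    have "(\<integral>\<^sup>+w. ennreal ((u n w - H w)\<^sup>2) \<partial>M) \<le> (\<integral>\<^sup>+w. liminf (\<lambda>m. ennreal ((u n w - u m w)\<^sup>2)) \<partial>M)"
    proof (rule nn_integral_mono_AE, use AE in eventually_elim)
      case (elim w)
      have "(\<lambda>m. ennreal ((u n w - u m w)\<^sup>2)) \<longlonglongrightarrow> ennreal ((u n w - H w)\<^sup>2)"
        by (intro tendsto_ennrealI tendsto_intros elim)
      from lim_imp_Liminf[OF _ this] show ?case by simp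
    qed
    also have "\<dots> \<le> liminf (\<lambda>m. \<integral>\<^sup>+w. ennreal ((u n w - u m w)\<^sup>2) \<partial>M)"
      by (rule nn_integral_liminf) auto
    also have "\<dots> \<le> ennreal e"
    proof (rule Liminf_le)
      show "\<forall>\<^sub>F m in sequentially. (\<integral>\<^sup>+w. ennreal ((u n w - u m w)\<^sup>2) \<partial>M) \<le> ennreal e"
        using eventually_ge_at_top[of N]
      proof eventually_elim
        case (elim m)
        have "(\<integral>w. (u n w - u m w)\<^sup>2 \<partial>M) \<le> e" using N elim by (simp add: less_imp_le)
        then show ?case by (subst nn_integral_square_L2) (auto intro!: L2_diff u ennreal_leI)
      qed
    qed simp
    finally show ?thesis .
  qed
  obtain N where "\<forall>m\<ge>N. \<forall>n\<ge>N. (\<integral>w. (u m w - u n w)\<^sup>2 \<partial>M) < 1" using Cauchy[of 1] by auto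
  from fatou[OF this, of N] have "(\<integral>\<^sup>+w. ennreal ((u N w - H w)\<^sup>2) \<partial>M) < \<infinity>"
    by (auto simp: ennreal_1 intro: le_less_trans)
  then have "(\<lambda>w. u N w - H w) \<in> L2 M"
    unfolding L2_def by (auto intro!: integrableI_bounded)
  from L2_diff[OF u[of N] this] show HL: "H \<in> L2 M" by simp
  show "(\<lambda>n. \<integral>w. (u n w - H w)\<^sup>2 \<partial>M) \<longlonglongrightarrow> 0"
  proof (rule LIMSEQ_I)
    fix r :: real assume "r > 0"
    then obtain N where N: "\<forall>m\<ge>N. \<forall>n\<ge>N. (\<integral>w. (u m w - u n w)\<^sup>2 \<partial>M) < r / 2"
      using Cauchy[of "r/2"] by auto
    have "(\<integral>w. (u n w - H w)\<^sup>2 \<partial>M) \<le> r / 2" if "n \<ge> N" for n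
      using fatou[OF N that] \<open>r > 0\<close> by (subst (asm) nn_integral_square_L2) (auto intro!: L2_diff u HL)
    then show "\<exists>no. \<forall>n\<ge>no. norm ((\<integral>w. (u n w - H w)\<^sup>2 \<partial>M) - 0) < r"
      using \<open>r > 0\<close> by (intro exI[of _ N]) fastforce
  qed
qed

text \<open>A subsequence with increments of \<open>L\<^sup>2\<close>-norm at most \<open>2\<^sup>-\<^sup>k\<close> has increments of \<open>L\<^sup>1\<close>-norm
  at most \<open>2\<^sup>-\<^sup>k\<close> and hence converges almost surely.\<close>

lemma L2_complete:
  assumes u: "\<And>n. u n \<in> L2 M"
    and Cauchy: "\<And>e. e > 0 \<Longrightarrow> \<exists>N. \<forall>m\<ge>N. \<forall>n\<ge>N. (\<integral>w. (u m w - u n w)\<^sup>2 \<partial>M) < e"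
  shows "\<exists>H\<in>L2 M. (\<lambda>n. \<integral>w. (u n w - H w)\<^sup>2 \<partial>M) \<longlonglongrightarrow> 0"
proof -
  have [measurable]: "u n \<in> borel_measurable M" for n using u by (auto simp: L2_def)
  have "\<forall>k. \<exists>N. \<forall>m\<ge>N. \<forall>n\<ge>N. (\<integral>w. (u m w - u n w)\<^sup>2 \<partial>M) < (1/4)^k"
    using Cauchy by simp
  then obtain N where N: "\<And>k m n. m \<ge> N k \<Longrightarrow> n \<ge> N k \<Longrightarrow> (\<integral>w. (u m w - u n w)\<^sup>2 \<partial>M) < (1/4)^k"
    by metis
  define r where "r k = (\<Sum>i\<le>k. Suc (N i))" for k
  have rN: "N k \<le> r k" for k
    unfolding r_def using member_le_sum[of k "{..k}" "\<lambda>i. Suc (N i)"] by simp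
  have r_mono: "strict_mono r"
    by (rule strict_monoI_Suc) (simp add: r_def)
  define d where "d k w = u (r (Suc k)) w - u (r k) w" for k w
  have d: "d k \<in> L2 M" for k unfolding d_def by (intro L2_diff u)
  have d2: "(\<integral>w. (d k w)\<^sup>2 \<partial>M) \<le> (1/4)^k" for k
    unfolding d_def using N[of k "r (Suc k)" "r k"] rN[of k] strict_monoD[OF r_mono, of k "Suc k"] by simp
  have d1: "(\<integral>w. \<bar>d k w\<bar> \<partial>M) \<le> (1/2)^k" for k
  proof -
    \<comment> \<open>The weights \<open>2\<^sup>-\<^sup>k\<close> and \<open>2\<^sup>k\<close> make both terms of the arithmetic mean at most \<open>2\<^sup>-\<^sup>k\<close> in expectation.\<close>
    have "(\<integral>w. \<bar>d k w\<bar> \<partial>M) \<le> (\<integral>w. ((1/2)^k + 2^k * (d k w)\<^sup>2) / 2 \<partial>M)"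
    proof (rule integral_mono)
      fix w
      have "\<bar>d k w\<bar> = \<bar>(1/2)^k * (2^k * d k w)\<bar>" by (simp add: abs_mult power_one_over)
      also have "\<dots> = 2^k * \<bar>(1/2)^k * d k w\<bar>" by (simp add: abs_mult)
      also have "\<dots> \<le> 2^k * ((((1/2)^k)\<^sup>2 + (d k w)\<^sup>2) / 2)"
        by (intro mult_left_mono abs_mult_le_squares) simp
      also have "\<dots> = ((1/2)^k + 2^k * (d k w)\<^sup>2) / 2"
        by (simp add: power2_eq_square field_simps power_one_over)
      finally show "\<bar>d k w\<bar> \<le> ((1/2)^k + 2^k * (d k w)\<^sup>2) / 2" .
    qed (use L2_integrable[OF d] d[unfolded L2_def] in auto)
    also have "\<dots> = ((1/2)^k + 2^k * (\<integral>w. (d k w)\<^sup>2 \<partial>M)) / 2"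
      using d[of k, unfolded L2_def] by (simp add: prob_space)
    also have "\<dots> \<le> ((1/2)^k + 2^k * (1/4)^k) / 2"
      using d2[of k] by simp
    also have "2^k * (1/4)^k = ((1/2)^k :: real)"
      by (simp add: power_mult_distrib[symmetric])
    finally show ?thesis by simp
  qed
  have "summable (\<lambda>k. \<integral>w. \<bar>d k w\<bar> \<partial>M)"
    by (rule summable_comparison_test'[where g="\<lambda>k. (1/2)^k" and N=0]) (use d1 in auto)
  from integral_suminf_AE_summable[OF L2_integrable[OF d] this]
  have AE: "AE w in M. summable (\<lambda>k. \<bar>d k w\<bar>)" .
  define H where "H w = u (r 0) w + (\<Sum>k. d k w)" for w
  have [measurable]: "d k \<in> borel_measurable M" for k unfolding d_def by simp
  have H: "H \<in> borel_measurable M" unfolding H_def by measurable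
  have lim: "AE w in M. (\<lambda>k. u (r k) w) \<longlonglongrightarrow> H w"
    using AE
  proof eventually_elim
    case (elim w)
    then have "(\<lambda>k. d k w) sums (\<Sum>k. d k w)" by (rule summable_sums[OF summable_rabs_cancel])
    then have "(\<lambda>n. u (r 0) w + (\<Sum>k<n. d k w)) \<longlonglongrightarrow> H w"
      unfolding sums_def H_def by (rule tendsto_add[OF tendsto_const])
    moreover have "u (r 0) w + (\<Sum>k<n. d k w) = u (r n) w" for n
      unfolding d_def by (subst sum_lessThan_telescope) simp
    ultimately show ?case by simp
  qed
  have C: "\<exists>N. \<forall>m\<ge>N. \<forall>n\<ge>N. (\<integral>w. (u (r m) w - u (r n) w)\<^sup>2 \<partial>M) < e" if "e > 0" for e
  proof -
    obtain N where "\<forall>m\<ge>N. \<forall>n\<ge>N. (\<integral>w. (u m w - u n w)\<^sup>2 \<partial>M) < e" using Cauchy[OF \<open>e > 0\<close>] by auto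
    moreover have "r m \<ge> N" if "m \<ge> N" for m using seq_suble[OF r_mono, of m] that by simp
    ultimately show ?thesis by blast
  qed
  note L = L2_Cauchy_AE_limit[OF u H lim C]
  have "(\<lambda>n. \<integral>w. (u n w - H w)\<^sup>2 \<partial>M) \<longlonglongrightarrow> 0"
  proof (rule LIMSEQ_I)
    fix e :: real assume "e > 0"
    then obtain N where N: "\<forall>m\<ge>N. \<forall>n\<ge>N. (\<integral>w. (u m w - u n w)\<^sup>2 \<partial>M) < e/4"
      using Cauchy[of "e/4"] by auto
    obtain K where K: "\<forall>k\<ge>K. norm ((\<integral>w. (u (r k) w - H w)\<^sup>2 \<partial>M) - 0) < e/4"
      using LIMSEQ_D[OF L(2), of "e/4"] \<open>e > 0\<close> by auto
    define k where "k = max K N"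
    have k: "(\<integral>w. (u (r k) w - H w)\<^sup>2 \<partial>M) < e/4" "r k \<ge> N"
      using K[rule_format, of k] seq_suble[OF r_mono, of k] by (auto simp: k_def)
    show "\<exists>no. \<forall>n\<ge>no. norm ((\<integral>w. (u n w - H w)\<^sup>2 \<partial>M) - 0) < e"
    proof (intro exI allI impI)
      fix n assume "n \<ge> N"
      have "(\<integral>w. (u n w - H w)\<^sup>2 \<partial>M) = (\<integral>w. ((u n w - u (r k) w) + (u (r k) w - H w))\<^sup>2 \<partial>M)" by simp
      also have "\<dots> \<le> 2 * (\<integral>w. (u n w - u (r k) w)\<^sup>2 \<partial>M) + 2 * (\<integral>w. (u (r k) w - H w)\<^sup>2 \<partial>M)"
        by (intro integral_square_add_le L2_diff u L(1))
      also have "\<dots> < 2 * (e/4) + 2 * (e/4)"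
        by (intro add_strict_mono mult_strict_left_mono N[rule_format] k \<open>n \<ge> N\<close>) simp_all
      also have "\<dots> = e" by simp
      finally show "norm ((\<integral>w. (u n w - H w)\<^sup>2 \<partial>M) - 0) < e" by simp
    qed
  qed
  with L(1) show ?thesis by blast
qed

end

section \<open>The filtration of the walk\<close>

context obtuse_random_walk begin

lemma space_M: "space M = {w. \<forall>i. w i \<le> CARD('d)}"
  using sets_eq_imp_space_eq[OF sets_M] by (auto simp: space_PiM PiE_def)

lemma
  shows space_past [simp]: "space (past M n) = space M"
    and sets_past: "sets (past M n) = sigma_sets (space M) {{w \<in> space M. w i \<in> A} | i A. i < n}"
  by (auto simp: past_def space_measure_of_conv sets_measure_of_conv)

lemma coordinate_past [measurable]: "i < n \<Longrightarrow> (\<lambda>w. w i) \<in> measurable (past M n) (count_space UNIV)"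
  by (rule measurableI) (auto simp: sets_past vimage_def Int_def conj_commute intro!: sigma_sets.Basic exI)

lemma coordinate_measurable [measurable]: "(\<lambda>w. w i) \<in> measurable M (count_space UNIV)"
proof -
  have "(\<lambda>w. w i) \<in> measurable M (count_space {0..CARD('d)})"
    by (subst measurable_cong_sets[OF sets_M refl]) (rule measurable_component_singleton, simp)
  from measurable_compose[OF this, of id "count_space UNIV"] show ?thesis by simp
qed

lemma past_subalgebra: "subalgebra M (past M n)"
proof -
  have "{w \<in> space M. w i \<in> A} \<in> sets M" for i A by measurable
  then have "sigma_sets (space M) {{w \<in> space M. w i \<in> A} | i A. i < n} \<subseteq> sets M"
    by (intro sets.sigma_sets_subset) auto
  then show ?thesis unfolding subalgebra_def by (simp add: sets_past)
qed

lemma past_finite_subalgebra: "sigma_finite_subalgebra M (past M n)"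
  by (intro finite_measure_subalgebra_is_sigma_finite finite_measure_subalgebra.intro
      finite_measure_subalgebra_axioms.intro past_subalgebra finite_measure_axioms)

text \<open>A set in the \<open>\<sigma>\<close>-algebra of the first \<open>n\<close> coordinates cannot separate points that agree in them,
  since the generators cannot and complements and unions inherit this.\<close>

lemma past_sets_dependence:
  assumes "A \<in> sets (past M n)" "w \<in> space M" "w' \<in> space M" "\<And>i. i < n \<Longrightarrow> w i = w' i"
  shows "w \<in> A \<longleftrightarrow> w' \<in> A"
  using assms(1) unfolding sets_past
  by (induction rule: sigma_sets.induct) (use assms(2-) in auto)

text \<open>The preimages under a function of the first \<open>n\<close> coordinates are countable unions of cylinders.\<close>

lemma past_measurable_iff:
  fixes g :: "(nat \<Rightarrow> nat) \<Rightarrow> 'b :: t1_space"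
  shows "g \<in> borel_measurable (past M n) \<longleftrightarrow>
    (\<forall>w\<in>space M. \<forall>w'\<in>space M. (\<forall>i<n. w i = w' i) \<longrightarrow> g w = g w')"
proof safe
  fix w w' assume g: "g \<in> borel_measurable (past M n)" and w: "w \<in> space M" "w' \<in> space M" "\<forall>i<n. w i = w' i"
  have "g -` {g w} \<inter> space M \<in> sets (past M n)"
    using measurable_sets[OF g, of "{g w}"] by simp
  from past_sets_dependence[OF this, of w w'] show "g w = g w'" using w by auto
next
  assume *: "\<forall>w\<in>space M. \<forall>w'\<in>space M. (\<forall>i<n. w i = w' i) \<longrightarrow> g w = g w'"
  show "g \<in> borel_measurable (past M n)"
  proof (rule measurableI)
    fix B :: "'b set" assume "B \<in> sets borel"
    let ?cyl = "\<lambda>xs. {w \<in> space (past M n). \<forall>i<n. w i = xs ! i}"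
    have "g -` B \<inter> space M = (\<Union>xs \<in> {xs. ?cyl xs \<subseteq> g -` B}. ?cyl xs)" (is "?l = ?r")
    proof
      show "?l \<subseteq> ?r"
      proof
        fix w assume w: "w \<in> ?l"
        have "w \<in> ?cyl (map w [0..<n])" using w by auto
        moreover have "?cyl (map w [0..<n]) \<subseteq> g -` B"
        proof
          fix w' assume "w' \<in> ?cyl (map w [0..<n])"
          then have "w' \<in> space M" "\<forall>i<n. w i = w' i" by auto
          with * w have "g w = g w'" by blast
          with w show "w' \<in> g -` B" by auto
        qed
        ultimately show "w \<in> ?r" by blast
      qed
    qed auto
    moreover have cyl: "?cyl xs \<in> sets (past M n)" for xs by measurable
    have "?r \<in> sets (past M n)" by (intro sets.countable_UN' countableI_type image_subsetI cyl)
    ultimately show "g -` B \<inter> space (past M n) \<in> sets (past M n)" by (simp only: space_past)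
  qed auto
qed

lemma past_measurableD:
  fixes g :: "(nat \<Rightarrow> nat) \<Rightarrow> 'b :: t1_space"
  assumes "g \<in> borel_measurable (past M n)" "w \<in> space M" "w' \<in> space M" "\<And>i. i < n \<Longrightarrow> w i = w' i"
  shows "g w = g w'"
  using assms(2-) by (intro assms(1)[unfolded past_measurable_iff, rule_format])

lemma past_measurableI:
  fixes g :: "(nat \<Rightarrow> nat) \<Rightarrow> 'b :: t1_space"
  assumes "\<And>w w'. w \<in> space M \<Longrightarrow> w' \<in> space M \<Longrightarrow> (\<And>i. i < n \<Longrightarrow> w i = w' i) \<Longrightarrow> g w = g w'"
  shows "g \<in> borel_measurable (past M n)"
  unfolding past_measurable_iff by (intro ballI impI assms) simp_all

lemma past_bounded:
  fixes g :: "(nat \<Rightarrow> nat) \<Rightarrow> real"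
  assumes "g \<in> borel_measurable (past M n)"
  obtains B where "\<And>w. w \<in> space M \<Longrightarrow> \<bar>g w\<bar> \<le> B"
proof -
  let ?ext = "\<lambda>xs i. if i < n then xs ! i else 0"
  have "g ` space M \<subseteq> (\<lambda>xs. g (?ext xs)) ` {xs. set xs \<subseteq> {..CARD('d)} \<and> length xs = n}"
  proof
    fix y assume "y \<in> g ` space M"
    then obtain w where w: "w \<in> space M" "y = g w" by auto
    have ext: "?ext (map w [0..<n]) \<in> space M" using w by (auto simp: space_M)
    have "g w = g (?ext (map w [0..<n]))"
      by (rule past_measurableD[OF assms w(1) ext]) simp
    then have "y = g (?ext (map w [0..<n]))" using w by simp
    then show "y \<in> (\<lambda>xs. g (?ext xs)) ` {xs. set xs \<subseteq> {..CARD('d)} \<and> length xs = n}"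
      using w by (intro image_eqI) (auto simp: space_M)
  qed
  then have "finite (g ` space M)"
    by (rule finite_subset) (intro finite_imageI finite_lists_length_eq, simp)
  then have "bounded (g ` space M)" by (rule finite_imp_bounded)
  then show ?thesis using that by (auto simp: bounded_real)
qed

lemma past_measurable_M: "g \<in> borel_measurable (past M n) \<Longrightarrow> g \<in> borel_measurable M"
  for g :: "_ \<Rightarrow> real"
  by (rule measurable_from_subalg[OF past_subalgebra])

lemma past_L2:
  fixes g :: "(nat \<Rightarrow> nat) \<Rightarrow> real"
  assumes "g \<in> borel_measurable (past M n)" shows "g \<in> L2 M"
  using past_bounded[OF assms] L2_bounded[OF past_measurable_M[OF assms]] by metis

lemma past_mono:
  fixes g :: "(nat \<Rightarrow> nat) \<Rightarrow> 'b :: t1_space"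
  assumes "g \<in> borel_measurable (past M m)" "m \<le> n"
  shows "g \<in> borel_measurable (past M n)"
  using assms(2) by (intro past_measurableI past_measurableD[OF assms(1)]) simp_all

lemma past_L2_mult:
  assumes "g \<in> borel_measurable (past M n)" "F \<in> L2 M"
  shows "(\<lambda>w. g w * F w) \<in> L2 M"
proof -
  obtain B where B: "\<And>w. w \<in> space M \<Longrightarrow> \<bar>g w\<bar> \<le> B" using past_bounded[OF assms(1)] by auto
  have [measurable]: "g \<in> borel_measurable M" by (rule past_measurable_M[OF assms(1)])
  have [measurable]: "F \<in> borel_measurable M" by (rule L2_measurable[OF assms(2)])
  have "integrable M (\<lambda>w. (g w * F w)\<^sup>2)"
  proof (rule Bochner_Integration.integrable_bound)
    show "integrable M (\<lambda>w. B\<^sup>2 * (F w)\<^sup>2)"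
      by (intro integrable_mult_right L2_integrable_square assms(2))
    have "(g w)\<^sup>2 * (F w)\<^sup>2 \<le> B\<^sup>2 * (F w)\<^sup>2" if "w \<in> space M" for w
      using power_mono[OF B[OF that], of 2] by (intro mult_right_mono) auto
    then show "AE w in M. norm ((g w * F w)\<^sup>2) \<le> norm (B\<^sup>2 * (F w)\<^sup>2)"
      by (simp add: power_mult_distrib)
  qed simp
  then show ?thesis by (simp add: L2_def)
qed

lemma step_past: "a \<le> CARD('d) \<Longrightarrow> (\<lambda>w. v a n w $ k) \<in> borel_measurable (past M n)"
  by (intro past_measurableI arg_cong[where f="\<lambda>x. x $ k"] past_measurableD[OF v_measurable])

lemma walk_past: "(\<lambda>w. walk v n w $ k) \<in> borel_measurable (past M (Suc n))"
proof (rule past_measurableI)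
  fix w w' assume w: "w \<in> space M" "w' \<in> space M" "\<And>i. i < Suc n \<Longrightarrow> w i = w' i"
  then have n: "w n \<le> CARD('d)" "w n = w' n" by (auto simp: space_M)
  have "v (w n) n w = v (w n) n w'"
    by (rule past_measurableD[OF v_measurable[OF n(1)] w(1,2)]) (use w(3) in simp)
  then show "walk v n w $ k = walk v n w' $ k" using n(2) by (simp add: walk_def)
qed

text \<open>The moment conditions on \<open>Y\<^sub>n\<close> are conditional; tested against \<open>\<F>\<^bsub>n-1\<^esub>\<close>-measurable functions they become
  identities between integrals.\<close>

lemma integral_past_mult_walk:
  assumes g: "g \<in> borel_measurable (past M n)"
  shows "(\<integral>w. g w * walk v n w $ k \<partial>M) = 0"
proof -
  interpret P: sigma_finite_subalgebra M "past M n" by (rule past_finite_subalgebra)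
  have "(\<integral>w. g w * walk v n w $ k \<partial>M) = (\<integral>w. g w * real_cond_exp M (past M n) (\<lambda>w. walk v n w $ k) w \<partial>M)"
    by (intro P.real_cond_exp_intg(2)[symmetric] g past_measurable_M[OF walk_past]
        L2_integrable past_L2_mult[OF g] past_L2[OF walk_past])
  also have "\<dots> = (\<integral>w. 0 \<partial>M)"
    proof (rule integral_cong_AE)
    show "AE w in M. g w * real_cond_exp M (past M n) (\<lambda>w. walk v n w $ k) w = 0"
      using walk_centered[of n k] by eventually_elim simp
  qed (use past_measurable_M[OF g] in measurable)
  finally show ?thesis by simp
qed

lemma walk_mult_past: "(\<lambda>w. walk v n w $ i * walk v n w $ j) \<in> borel_measurable (past M (Suc n))"
  by (intro borel_measurable_times walk_past)

lemma integral_past_mult_walk_walk: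
  assumes g: "g \<in> borel_measurable (past M n)"
  shows "(\<integral>w. g w * (walk v n w $ i * walk v n w $ j) \<partial>M) = (if i = j then \<integral>w. g w \<partial>M else 0)"
proof -
  interpret P: sigma_finite_subalgebra M "past M n" by (rule past_finite_subalgebra)
  have "(\<integral>w. g w * (walk v n w $ i * walk v n w $ j) \<partial>M) =
      (\<integral>w. g w * real_cond_exp M (past M n) (\<lambda>w. walk v n w $ i * walk v n w $ j) w \<partial>M)"
    by (intro P.real_cond_exp_intg(2)[symmetric] g past_measurable_M[OF walk_mult_past]
        L2_integrable past_L2_mult[OF g] past_L2[OF walk_mult_past])
  also have "\<dots> = (\<integral>w. g w * (if i = j then 1 else 0) \<partial>M)"
    proof (rule integral_cong_AE)
    show "AE w in M. g w * real_cond_exp M (past M n) (\<lambda>w. walk v n w $ i * walk v n w $ j) w =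
        g w * (if i = j then 1 else 0)"
      using walk_covariance[of n i j] by eventually_elim simp
  qed (use past_measurable_M[OF g] in measurable)
  finally show ?thesis by simp
qed

end

section \<open>The orthonormal system of walk monomials\<close>

text \<open>A finite set of pairs with distinct first components is a choice of finitely many times
  and of one component of the walk at each of them.\<close>

definition chaos_index :: "(nat \<times> 'd) set set" where
  "chaos_index = {S. finite S \<and> inj_on fst S}"

lemma chaos_index_subset: "S \<in> chaos_index \<Longrightarrow> T \<subseteq> S \<Longrightarrow> T \<in> chaos_index"
  unfolding chaos_index_def by (auto intro: finite_subset inj_on_subset)

lemma chaos_index_empty [simp]: "{} \<in> chaos_index"
  by (simp add: chaos_index_def)

lemma chaos_index_finite: "S \<in> chaos_index \<Longrightarrow> finite S"
  by (simp add: chaos_index_def)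

lemma chaos_index_insert: "k \<notin> fst ` T \<Longrightarrow> insert (k, j) T \<in> chaos_index \<longleftrightarrow> T \<in> chaos_index"
  unfolding chaos_index_def by (auto simp: inj_on_def image_iff)

lemma chaos_index_remove:
  assumes "S \<in> chaos_index" "(k, j) \<in> S"
  shows "S - {(k, j)} \<in> chaos_index" "k \<notin> fst ` (S - {(k, j)})" "insert (k, j) (S - {(k, j)}) = S"
proof -
  show "S - {(k, j)} \<in> chaos_index" using chaos_index_subset[OF assms(1)] by blast
  show "insert (k, j) (S - {(k, j)}) = S" using assms(2) by blast
  show "k \<notin> fst ` (S - {(k, j)})"
    using assms inj_onD[of fst S] unfolding chaos_index_def by fastforce
qed

lemma chaos_index_insert_eq:
  assumes "n \<notin> fst ` S" "n \<notin> fst ` T"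
  shows "insert (n, k) S = insert (n, l) T \<longleftrightarrow> k = l \<and> S = T"
proof
  assume eq: "insert (n, k) S = insert (n, l) T"
  have "(n, x) \<notin> S" "(n, x) \<notin> T" for x using assms by force+
  with eq have "k = l" by (metis Pair_inject insert_iff)
  with eq \<open>\<And>x. (n, x) \<notin> S\<close> \<open>\<And>x. (n, x) \<notin> T\<close> show "k = l \<and> S = T" by (metis insert_ident)
qed auto

lemma countable_chaos_index: "countable (chaos_index :: (nat \<times> 'd :: finite) set set)"
  by (rule countable_subset[OF _ countable_Collect_finite]) (auto simp: chaos_index_def)

text \<open>The dichotomy behind inductions on the last time of a multi-index.\<close>

lemma chaos_index_cases:
  assumes "S \<in> chaos_index" "fst ` S \<subseteq> {..<Suc n}"
  obtains "fst ` S \<subseteq> {..<n}"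
  | k T where "S = insert (n, k) T" "T \<in> chaos_index" "fst ` T \<subseteq> {..<n}" "n \<notin> fst ` T"
proof (cases "n \<in> fst ` S")
  case False
  then have "fst ` S \<subseteq> {..<n}" using assms(2) unfolding lessThan_Suc by blast
  then show ?thesis using that(1) by simp
next
  case True
  then obtain k where k: "(n, k) \<in> S" by auto
  note R = chaos_index_remove[OF assms(1) k]
  have "fst ` (S - {(n, k)}) \<subseteq> {..<Suc n}" using assms(2) by auto
  with R(2) have "fst ` (S - {(n, k)}) \<subseteq> {..<n}" unfolding lessThan_Suc by blast
  then show ?thesis using that(2)[of k "S - {(n, k)}"] R by auto
qed

definition walk_monomial ::
  "(nat \<Rightarrow> nat \<Rightarrow> (nat \<Rightarrow> nat) \<Rightarrow> real ^ 'd) \<Rightarrow> (nat \<times> 'd) set \<Rightarrow> (nat \<Rightarrow> nat) \<Rightarrow> real" where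
  "walk_monomial v S w = (\<Prod>(i, k)\<in>S. walk v i w $ k)"

lemma walk_monomial_empty [simp]: "walk_monomial v {} = (\<lambda>w. 1)"
  by (simp add: walk_monomial_def fun_eq_iff)

lemma walk_monomial_insert:
  "T \<in> chaos_index \<Longrightarrow> k \<notin> fst ` T \<Longrightarrow>
    walk_monomial v (insert (k, j) T) w = walk v k w $ j * walk_monomial v T w"
  unfolding walk_monomial_def by (subst prod.insert) (auto simp: chaos_index_def image_iff)

context obtuse_random_walk begin

lemma walk_monomial_past:
  assumes "fst ` S \<subseteq> {..<n}"
  shows "walk_monomial v S \<in> borel_measurable (past M n)"
  unfolding walk_monomial_def
proof (rule borel_measurable_prod)
  fix p assume p: "p \<in> S"
  obtain i k where ik: "p = (i, k)" by (cases p)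
  with p assms have "Suc i \<le> n" by force
  from past_mono[OF walk_past this] show "(\<lambda>w. case p of (i, k) \<Rightarrow> walk v i w $ k) \<in> borel_measurable (past M n)"
    by (simp add: ik)
qed

lemma chaos_index_bounded_times: "S \<in> chaos_index \<Longrightarrow> \<exists>n. fst ` S \<subseteq> {..<n}"
  by (meson chaos_index_finite finite_imageI finite_nat_iff_bounded)

lemma walk_monomial_L2: "S \<in> chaos_index \<Longrightarrow> walk_monomial v S \<in> L2 M"
  using chaos_index_bounded_times[of S] by (auto intro: past_L2[OF walk_monomial_past])

text \<open>Conditioning on the past of the last time involved removes the last factor of both
  monomials or shows that the integral vanishes.\<close>

lemma walk_monomial_orthonormal_past:
  assumes "S \<in> chaos_index" "T \<in> chaos_index" "fst ` S \<subseteq> {..<n}" "fst ` T \<subseteq> {..<n}"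
  shows "(\<integral>w. walk_monomial v S w * walk_monomial v T w \<partial>M) = (if S = T then 1 else 0)"
  using assms
proof (induction n arbitrary: S T)
  case 0
  then show ?case by (simp add: prob_space)
next
  case (Suc n)
  have mixed: "(\<integral>w. walk_monomial v S w * walk_monomial v (insert (n, k) T) w \<partial>M) = 0"
    if "S \<in> chaos_index" "fst ` S \<subseteq> {..<n}" "T \<in> chaos_index" "fst ` T \<subseteq> {..<n}" "n \<notin> fst ` T" for S T k
  proof -
    have "(\<lambda>w. walk_monomial v S w * walk_monomial v T w) \<in> borel_measurable (past M n)"
      by (intro borel_measurable_times walk_monomial_past that)
    from integral_past_mult_walk[OF this, of k] show ?thesis
      by (simp add: walk_monomial_insert that mult_ac)
  qed
  show ?case
  proof (cases rule: chaos_index_cases[OF Suc.prems(1,3)])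
    case 1
    note S = this
    show ?thesis
    proof (cases rule: chaos_index_cases[OF Suc.prems(2,4)])
      case 1
      then show ?thesis using Suc.IH[OF Suc.prems(1,2) S] by simp
    next
      case (2 k T')
      then have "S \<noteq> T" using S by auto
      then show ?thesis using mixed[of S T' k] 2 S Suc.prems by simp
    qed
  next
    case (2 k S')
    note S = this
    show ?thesis
    proof (cases rule: chaos_index_cases[OF Suc.prems(2,4)])
      case 1
      then have "S \<noteq> T" using S by auto
      then show ?thesis using mixed[of T S' k] 1 S Suc.prems by (simp add: mult.commute)
    next
      case (2 l T')
      have m: "(\<lambda>w. walk_monomial v S' w * walk_monomial v T' w) \<in> borel_measurable (past M n)"
        by (intro borel_measurable_times walk_monomial_past 2 S)
      have "(\<integral>w. walk_monomial v S w * walk_monomial v T w \<partial>M) =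
          (if k = l then if S' = T' then 1 else 0 else 0)"
        using integral_past_mult_walk_walk[OF m, of k l] Suc.IH[OF S(2) 2(2) S(3) 2(3)]
        by (simp add: S 2 walk_monomial_insert mult_ac)
      also have "\<dots> = (if S = T then 1 else 0)"
        using chaos_index_insert_eq[OF S(4) 2(4), of k l] S(1) 2(1) by auto
      finally show ?thesis .
    qed
  qed
qed

lemma walk_monomial_orthonormal:
  assumes "S \<in> chaos_index" "T \<in> chaos_index"
  shows "(\<integral>w. walk_monomial v S w * walk_monomial v T w \<partial>M) = (if S = T then 1 else 0)"
proof -
  obtain n where "fst ` (S \<union> T) \<subseteq> {..<n}"
    using assms finite_nat_iff_bounded[of "fst ` (S \<union> T)"] by (auto simp: chaos_index_def)
  then show ?thesis using walk_monomial_orthonormal_past[OF assms, of n] by (simp add: image_Un)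
qed

end

section \<open>Totality of the walk monomials\<close>

text \<open>The \<open>d + 1\<close> functions \<open>1, x\<^sup>1, \<dots>, x\<^sup>d\<close> on the \<open>(d + 1)\<close>-point probability space with weights \<open>p\<close>
  are orthonormal; scaling the columns by the square roots of the weights makes them an orthogonal matrix,
  whose columns are therefore orthonormal as well.\<close>

lemma dual_orthonormality:
  fixes p :: "nat \<Rightarrow> real" and x :: "nat \<Rightarrow> real ^ ('d::finite)"
  assumes pos: "\<And>i. i \<le> CARD('d) \<Longrightarrow> p i > 0"
    and one: "(\<Sum>i\<le>CARD('d). p i) = 1"
    and mean: "\<And>k. (\<Sum>i\<le>CARD('d). x i $ k * p i) = 0"
    and covar: "\<And>k l. (\<Sum>i\<le>CARD('d). (x i $ k * x i $ l) * p i) = (if k = l then 1 else 0)"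
    and ab: "a \<le> CARD('d)" "b \<le> CARD('d)"
  shows "p a * (1 + (\<Sum>k\<in>UNIV. x a $ k * x b $ k)) = (if a = b then 1 else 0)"
proof -
  have "card (UNIV :: 'd option set) = card {..CARD('d)}"
    by (simp add: card_UNIV_option)
  then obtain f :: "'d option \<Rightarrow> nat" where f: "bij_betw f UNIV {..CARD('d)}"
    using finite_same_card_bij[of "UNIV :: 'd option set" "{..CARD('d)}"] by auto
  have fle: "f c \<le> CARD('d)" for c using bij_betwE[OF f] by auto
  define y where "y r i = (case r of None \<Rightarrow> 1 | Some k \<Rightarrow> x i $ k)" for r :: "'d option" and i
  define A :: "real ^ 'd option ^ 'd option" where "A = (\<chi> r c. sqrt (p (f c)) * y r (f c))"
  have "(\<Sum>c\<in>UNIV. A $ r $ c * A $ s $ c) = (if r = s then 1 else 0)" for r s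
  proof -
    have "(\<Sum>c\<in>UNIV. A $ r $ c * A $ s $ c) = (\<Sum>c\<in>UNIV. y r (f c) * y s (f c) * p (f c))"
    proof (rule sum.cong[OF refl])
      fix c
      have "sqrt (p (f c)) * sqrt (p (f c)) = p (f c)" using pos[OF fle[of c]] by simp
      then show "A $ r $ c * A $ s $ c = y r (f c) * y s (f c) * p (f c)"
        by (simp add: A_def mult_ac)
    qed
    also have "\<dots> = (\<Sum>i\<le>CARD('d). y r i * y s i * p i)"
      by (rule sum.reindex_bij_betw[OF f])
    also have "\<dots> = (if r = s then 1 else 0)"
      using one mean covar by (cases r; cases s) (auto simp: y_def)
    finally show ?thesis .
  qed
  then have "A ** transpose A = mat 1"
    by (simp add: matrix_matrix_mult_def transpose_def mat_def vec_eq_iff)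
  then have "transpose A ** A = mat 1" by (simp add: matrix_left_right_inverse)
  then have "(\<Sum>r\<in>UNIV. A $ r $ c * A $ r $ e) = (if c = e then 1 else 0)" for c e
    by (simp add: matrix_matrix_mult_def transpose_def mat_def vec_eq_iff)
  moreover obtain c e where ce: "a = f c" "b = f e"
    using bij_betw_imp_surj_on[OF f] ab by (metis atMost_iff image_iff)
  ultimately have "(\<Sum>r\<in>UNIV. sqrt (p a) * sqrt (p b) * (y r a * y r b)) = (if c = e then 1 else 0)"
    by (simp add: A_def mult_ac)
  also have "c = e \<longleftrightarrow> a = b"
    using f ce by (auto simp: bij_betw_def inj_on_def)
  also have "(\<Sum>r\<in>UNIV. sqrt (p a) * sqrt (p b) * (y r a * y r b)) =
      sqrt (p a) * sqrt (p b) * (1 + (\<Sum>k\<in>UNIV. x a $ k * x b $ k))"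
    by (simp add: sum_distrib_left[symmetric] UNIV_option_conv sum.reindex y_def)
  finally have *: "sqrt (p a) * sqrt (p b) * (1 + (\<Sum>k\<in>UNIV. x a $ k * x b $ k)) = (if a = b then 1 else 0)" .
  show ?thesis
  proof (cases "a = b")
    case True
    then show ?thesis using * pos[OF ab(1)] by simp
  next
    case False
    then show ?thesis using * pos[OF ab(1)] pos[OF ab(2)] by simp
  qed
qed

context obtuse_random_walk begin

text \<open>This is the conditional probability \<open>p\<^sub>n\<^sup>i\<close> of a step to \<open>i\<close>.\<close>

definition transition :: "nat \<Rightarrow> nat \<Rightarrow> (nat \<Rightarrow> nat) \<Rightarrow> real" where
  "transition n i = real_cond_exp M (past M n) (indicator {w \<in> space M. w n = i})"

lemma transition_past: "transition n i \<in> borel_measurable (past M n)"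
  unfolding transition_def by (rule borel_measurable_cond_exp)

lemma coordinate_indicator_past: "(indicator {w \<in> space M. w n = i} :: _ \<Rightarrow> real) \<in> borel_measurable (past M (Suc n))"
  by (rule past_measurableI) (auto simp: indicator_def)

lemma sum_coordinate_indicator:
  fixes c :: "nat \<Rightarrow> real"
  assumes "w \<in> space M"
  shows "(\<Sum>i\<le>CARD('d). c i * indicator {w \<in> space M. w n = i} w) = c (w n)"
proof -
  have "(\<Sum>i\<le>CARD('d). c i * indicator {w \<in> space M. w n = i} w) = (\<Sum>i\<le>CARD('d). if i = w n then c i else 0)"
    using assms by (intro sum.cong refl) (auto simp: indicator_def)
  also have "\<dots> = c (w n)" using assms by (subst sum.delta) (auto simp: space_M)
  finally show ?thesis .
qed

text \<open>A function of \<open>X\<^sub>n\<close> and the past is a sum over the values of \<open>X\<^sub>n\<close> of indicators with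
  \<open>\<F>\<^bsub>n-1\<^esub>\<close>-measurable coefficients, which can be pulled out of the conditional expectation.\<close>

lemma cond_exp_transition:
  fixes c :: "nat \<Rightarrow> (nat \<Rightarrow> nat) \<Rightarrow> real"
  assumes c: "\<And>i. i \<le> CARD('d) \<Longrightarrow> c i \<in> borel_measurable (past M n)"
    and m: "(\<lambda>w. c (w n) w) \<in> borel_measurable M"
  shows "AE w in M. real_cond_exp M (past M n) (\<lambda>w. c (w n) w) w = (\<Sum>i\<le>CARD('d). c i w * transition n i w)"
proof -
  interpret P: sigma_finite_subalgebra M "past M n" by (rule past_finite_subalgebra)
  define h where "h i w = (if i \<le> CARD('d) then c i w else 0) * indicator {w \<in> space M. w n = i} w" for i w
  have c': "(\<lambda>w. if i \<le> CARD('d) then c i w else 0) \<in> borel_measurable (past M n)" for i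
    using c by (cases "i \<le> CARD('d)") auto
  have ind: "(indicator {w \<in> space M. w n = i} :: _ \<Rightarrow> real) \<in> L2 M" for i
    by (rule past_L2[OF coordinate_indicator_past])
  have h: "integrable M (h i)" for i
    unfolding h_def by (rule L2_integrable[OF past_L2_mult[OF c' ind]])
  have sum_h: "(\<Sum>i\<le>CARD('d). h i w) = c (w n) w" if "w \<in> space M" for w
    using sum_coordinate_indicator[OF that, of "\<lambda>i. c i w" n] by (simp add: h_def)
  have "AE w in M. real_cond_exp M (past M n) (\<lambda>w. c (w n) w) w =
      real_cond_exp M (past M n) (\<lambda>w. \<Sum>i\<le>CARD('d). h i w) w"
    by (rule P.real_cond_exp_cong) (use sum_h m h in \<open>auto intro!: borel_measurable_sum\<close>)
  moreover have "AE w in M. real_cond_exp M (past M n) (\<lambda>w. \<Sum>i\<le>CARD('d). h i w) w =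
      (\<Sum>i\<le>CARD('d). real_cond_exp M (past M n) (h i) w)"
    by (rule P.real_cond_exp_sum[OF h])
  moreover have "AE w in M. \<forall>i. real_cond_exp M (past M n) (h i) w =
      (if i \<le> CARD('d) then c i w else 0) * transition n i w"
    unfolding AE_all_countable
  proof
    fix i
    show "AE w in M. real_cond_exp M (past M n) (h i) w = (if i \<le> CARD('d) then c i w else 0) * transition n i w"
      unfolding transition_def h_def
      by (rule P.real_cond_exp_mult[OF c' L2_measurable[OF ind] h[unfolded h_def]])
  qed
  ultimately show ?thesis by eventually_elim simp
qed

text \<open>The explicit representation \<open>1\<^bsub>{X\<^sub>n = a}\<^esub> = p\<^sub>n\<^sup>a (1 + \<langle>v\<^sub>a(n), Y\<^sub>n\<rangle>)\<close> is what makes the walk rich enough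
  to generate all square-integrable functions.\<close>

lemma indicator_eq_walk:
  "AE w in M. \<forall>a\<le>CARD('d). indicator {w \<in> space M. w n = a} w =
    transition n a w * (1 + (\<Sum>k\<in>UNIV. v a n w $ k * walk v n w $ k))"
proof -
  interpret P: sigma_finite_subalgebra M "past M n" by (rule past_finite_subalgebra)
  have pos: "AE w in M. \<forall>i. i \<le> CARD('d) \<longrightarrow> transition n i w > 0"
    unfolding AE_all_countable transition_def using transition_pos by (auto simp: AE_conj_iff)
  have one: "AE w in M. (\<Sum>i\<le>CARD('d). transition n i w) = 1"
  proof -
    have "AE w in M. real_cond_exp M (past M n) (\<lambda>w. 1) w = 1"
      by (rule P.real_cond_exp_F_meas) simp_all
    with cond_exp_transition[of "\<lambda>_ _. 1" n] show ?thesis by fastforce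
  qed
  have mean: "AE w in M. \<forall>k. (\<Sum>i\<le>CARD('d). v i n w $ k * transition n i w) = 0"
    unfolding AE_all_countable
  proof
    fix k
    have "AE w in M. real_cond_exp M (past M n) (\<lambda>w. walk v n w $ k) w =
        (\<Sum>i\<le>CARD('d). v i n w $ k * transition n i w)"
      using cond_exp_transition[of "\<lambda>i w. v i n w $ k" n] step_past
        past_measurable_M[OF walk_past[of n k]] by (simp add: walk_def)
    with walk_centered[of n k] show "AE w in M. (\<Sum>i\<le>CARD('d). v i n w $ k * transition n i w) = 0"
      by eventually_elim simp
  qed
  have covar: "AE w in M. \<forall>k l. (\<Sum>i\<le>CARD('d). (v i n w $ k * v i n w $ l) * transition n i w) = (if k = l then 1 else 0)"
    unfolding AE_all_countable
  proof (intro allI)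
    fix k l
    have "AE w in M. real_cond_exp M (past M n) (\<lambda>w. walk v n w $ k * walk v n w $ l) w =
        (\<Sum>i\<le>CARD('d). (v i n w $ k * v i n w $ l) * transition n i w)"
      using cond_exp_transition[of "\<lambda>i w. v i n w $ k * v i n w $ l" n]
        borel_measurable_times[OF step_past step_past]
        past_measurable_M[OF walk_mult_past[of n k l]] by (simp add: walk_def)
    with walk_covariance[of n k l]
    show "AE w in M. (\<Sum>i\<le>CARD('d). (v i n w $ k * v i n w $ l) * transition n i w) = (if k = l then 1 else 0)"
      by eventually_elim simp
  qed
  show ?thesis
    using pos one mean covar AE_space
  proof eventually_elim
    case (elim w)
    have "w n \<le> CARD('d)" using elim by (simp add: space_M)
    then have "transition n a w * (1 + (\<Sum>k\<in>UNIV. v a n w $ k * v (w n) n w $ k)) = (if a = w n then 1 else 0)"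
      if "a \<le> CARD('d)" for a
      using dual_orthonormality[of "\<lambda>i. transition n i w" "\<lambda>i. v i n w" a "w n"] elim that by blast
    then show ?case using elim(5) by (auto simp: walk_def indicator_def)
  qed
qed

text \<open>A function orthogonal to all monomials is, one time step after the other, orthogonal to all products of a
  function of the first \<open>n\<close> coordinates and a monomial in later times.\<close>

lemma orthogonal_past_mult:
  assumes F: "F \<in> L2 M" and orth: "\<And>S. S \<in> chaos_index \<Longrightarrow> (\<integral>w. F w * walk_monomial v S w \<partial>M) = 0"
    and "S \<in> chaos_index" "fst ` S \<subseteq> {n..}" "g \<in> borel_measurable (past M n)"
  shows "(\<integral>w. g w * walk_monomial v S w * F w \<partial>M) = 0"
  using assms(3-)
proof (induction n arbitrary: S g)
  case 0
  obtain w0 where w0: "w0 \<in> space M" using not_empty by blast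
  have "g w = g w0" if "w \<in> space M" for w
    by (rule past_measurableD[OF 0(3) that w0]) simp
  then have "(\<integral>w. g w * walk_monomial v S w * F w \<partial>M) = (\<integral>w. g w0 * (F w * walk_monomial v S w) \<partial>M)"
    by (intro Bochner_Integration.integral_cong) simp_all
  then show ?case using orth[OF 0(1)] by simp
next
  case (Suc n)
  have S: "S \<in> chaos_index" "n \<notin> fst ` S" "fst ` S \<subseteq> {n..}"
    using Suc.prems by auto
  have S': "insert (n, k) S \<in> chaos_index" "fst ` insert (n, k) S \<subseteq> {n..}" for k
    using S by (auto simp: chaos_index_insert)
  \<comment> \<open>On \<open>X\<^sub>n = a\<close> the function \<open>g\<close> agrees with \<open>g (w(n := a))\<close>, which depends on the first \<open>n\<close> coordinates only.\<close>
  define h where "h a w = g (w(n := a)) * transition n a w" for a w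
  have h: "h a \<in> borel_measurable (past M n)" if a: "a \<le> CARD('d)" for a
    unfolding h_def
  proof (intro borel_measurable_times transition_past past_measurableI)
    fix w w' assume w: "w \<in> space M" "w' \<in> space M" "\<And>i. i < n \<Longrightarrow> w i = w' i"
    show "g (w(n := a)) = g (w'(n := a))"
      by (rule past_measurableD[OF Suc.prems(3)]) (use w a in \<open>auto simp: space_M\<close>)
  qed
  have hv: "(\<lambda>w. h a w * v a n w $ k) \<in> borel_measurable (past M n)" if "a \<le> CARD('d)" for a k
    by (intro borel_measurable_times h step_past that)
  obtain m where "insert n (fst ` S) \<subseteq> {..<m}"
    using chaos_index_finite[OF S(1)] finite_nat_iff_bounded[of "insert n (fst ` S)"] by auto
  then have m: "n < m" "fst ` S \<subseteq> {..<m}" by auto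
  have meas: "walk_monomial v S \<in> borel_measurable (past M m)" "walk_monomial v (insert (n, k) S) \<in> borel_measurable (past M m)" for k
    using m by (auto intro!: walk_monomial_past)
  have int: "integrable M (\<lambda>w. f w * walk_monomial v T w * F w)"
    if f: "f \<in> borel_measurable (past M n)" and T: "walk_monomial v T \<in> borel_measurable (past M m)" for f T
    using m by (intro L2_integrable past_L2_mult[OF borel_measurable_times[OF past_mono[OF f] T] F]) simp
  have "(\<integral>w. g w * walk_monomial v S w * F w \<partial>M) =
      (\<integral>w. (\<Sum>a\<le>CARD('d). h a w * walk_monomial v S w * F w +
        (\<Sum>k\<in>UNIV. h a w * v a n w $ k * walk_monomial v (insert (n, k) S) w * F w)) \<partial>M)"
  proof (rule integral_cong_AE)
    show "(\<lambda>w. g w * walk_monomial v S w * F w) \<in> borel_measurable M"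
      using past_measurable_M[OF Suc.prems(3)] past_measurable_M[OF meas(1)] L2_measurable[OF F] by measurable
    show "(\<lambda>w. \<Sum>a\<le>CARD('d). h a w * walk_monomial v S w * F w +
        (\<Sum>k\<in>UNIV. h a w * v a n w $ k * walk_monomial v (insert (n, k) S) w * F w)) \<in> borel_measurable M"
      using int[OF h meas(1)] int[OF hv meas(2)]
      by (intro borel_measurable_sum borel_measurable_add borel_measurable_integrable) auto
    show "AE w in M. g w * walk_monomial v S w * F w =
        (\<Sum>a\<le>CARD('d). h a w * walk_monomial v S w * F w +
        (\<Sum>k\<in>UNIV. h a w * v a n w $ k * walk_monomial v (insert (n, k) S) w * F w))"
      using indicator_eq_walk[of n] AE_space
    proof eventually_elim
      case (elim w)
      have "g w = g (w(n := w n))" by simp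
      also have "\<dots> = (\<Sum>a\<le>CARD('d). g (w(n := a)) * indicator {w \<in> space M. w n = a} w)"
        by (rule sum_coordinate_indicator[symmetric]) (rule elim)
      also have "\<dots> = (\<Sum>a\<le>CARD('d). h a w * (1 + (\<Sum>k\<in>UNIV. v a n w $ k * walk v n w $ k)))"
        using elim by (intro sum.cong refl) (simp add: h_def)
      finally show ?case
        by (simp add: walk_monomial_insert S sum_distrib_left sum_distrib_right algebra_simps sum.distrib)
    qed
  qed
  also have "\<dots> = (\<Sum>a\<le>CARD('d). (\<integral>w. h a w * walk_monomial v S w * F w \<partial>M) +
        (\<Sum>k\<in>UNIV. \<integral>w. h a w * v a n w $ k * walk_monomial v (insert (n, k) S) w * F w \<partial>M))"
    using int[OF h meas(1)] int[OF hv meas(2)]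
    by (subst Bochner_Integration.integral_sum Bochner_Integration.integral_add; (intro Bochner_Integration.integrable_add Bochner_Integration.integrable_sum)?; simp)+
  also have "\<dots> = 0"
    using Suc.IH[OF S(1,3) h] Suc.IH[OF S' hv] by simp
  finally show ?case .
qed

text \<open>Indicators of past events are orthogonal to \<open>F\<close>, and these events generate the whole \<open>\<sigma>\<close>-algebra, so the
  integral of \<open>F\<close> over every measurable set vanishes by Dynkin's argument.\<close>

lemma orthogonal_imp_AE_zero:
  assumes F: "F \<in> L2 M" and orth: "\<And>S. S \<in> chaos_index \<Longrightarrow> (\<integral>w. F w * walk_monomial v S w \<partial>M) = 0"
  shows "AE w in M. F w = 0"
proof (rule density_zero[OF L2_integrable[OF F]])
  let ?G = "\<Union>n. sets (past M n)"
  have int: "set_integrable M A F" if "A \<in> sets M" for A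
    unfolding set_integrable_def by (rule integrable_mult_indicator[OF that L2_integrable[OF F]])
  have G0: "set_lebesgue_integral M A F = 0" if "A \<in> sets (past M n)" for A n
  proof -
    have "(indicator A :: _ \<Rightarrow> real) \<in> borel_measurable (past M n)" using that by simp
    then have "(\<integral>w. indicator A w * walk_monomial v {} w * F w \<partial>M) = 0"
      by (intro orthogonal_past_mult[OF F orth]) simp_all
    then show ?thesis by (simp add: set_lebesgue_integral_def)
  qed
  have G_sets: "?G \<subseteq> sets M" using past_subalgebra by (auto simp: subalgebra_def)
  have past_le: "sets (past M m) \<subseteq> sets (past M n)" if "m \<le> n" for m n
    unfolding sets_past using that by (intro sigma_sets_mono') fastforce
  have stable: "Int_stable ?G"
  proof (rule Int_stableI)
    fix A B assume "A \<in> ?G" "B \<in> ?G"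
    then obtain m n where "A \<in> sets (past M m)" "B \<in> sets (past M n)" by auto
    then have "A \<in> sets (past M (max m n))" "B \<in> sets (past M (max m n))"
      using past_le[of m "max m n"] past_le[of n "max m n"] by auto
    then show "A \<inter> B \<in> ?G" by blast
  qed
  have "sets M = sigma_sets (space M) ?G"
  proof
    have sp: "(\<Pi>\<^sub>E i\<in>(UNIV::nat set). space (count_space {0..CARD('d)})) = space M"
      by (auto simp: space_M PiE_def)
    have "{w \<in> space M. w i \<in> A} \<in> ?G" for i A
      by (rule UN_I[of "Suc i"]) (auto simp: sets_past intro!: sigma_sets.Basic exI)
    then show "sets M \<subseteq> sigma_sets (space M) ?G"
      unfolding sets_M sets_PiM_single sp by (intro sigma_sets_mono) (auto intro: sigma_sets.Basic)
    show "sigma_sets (space M) ?G \<subseteq> sets M" by (rule sets.sigma_sets_subset[OF G_sets])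
  qed
  fix A assume "A \<in> sets M"
  with \<open>sets M = _\<close> have "A \<in> sigma_sets (space M) ?G" by simp
  then show "set_lebesgue_integral M A F = 0"
  proof (induction rule: sigma_sets_induct_disjoint[OF stable order_trans[OF G_sets sets.space_closed],
        consumes 1, case_names basic empty compl union])
    case (basic A)
    then show ?case using G0 by auto
  next
    case empty
    show ?case by (simp add: set_lebesgue_integral_def)
  next
    case (compl A)
    then have A: "A \<in> sets M" using \<open>sets M = _\<close> by simp
    have sp: "space M \<in> sets (past M 0)" using sets.top[of "past M 0"] by simp
    have "set_lebesgue_integral M (A \<union> (space M - A)) F = set_lebesgue_integral M A F + set_lebesgue_integral M (space M - A) F"
      using A by (intro set_integral_Un int) auto
    moreover have "A \<union> (space M - A) = space M" using sets.sets_into_space[OF A] by auto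
    ultimately show ?case using compl G0[OF sp] by simp
  next
    case (union A)
    then have A: "range A \<subseteq> sets M" using \<open>sets M = _\<close> by simp
    have "set_lebesgue_integral M (\<Union>i. A i) F = (\<Sum>i. set_lebesgue_integral M (A i) F)"
      using A union by (intro lebesgue_integral_countable_add int) (auto simp: disjoint_family_on_def)
    then show ?case using union by simp
  qed
qed

end

section \<open>Chaos coefficients and Parseval's identity\<close>

definition chaos_coef ::
  "(nat \<Rightarrow> nat) measure \<Rightarrow> (nat \<Rightarrow> nat \<Rightarrow> (nat \<Rightarrow> nat) \<Rightarrow> real ^ 'd) \<Rightarrow>
    ((nat \<Rightarrow> nat) \<Rightarrow> real) \<Rightarrow> (nat \<times> 'd) set \<Rightarrow> real" where
  "chaos_coef M v F S = (\<integral>w. F w * walk_monomial v S w \<partial>M)"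

context obtuse_random_walk begin

lemma chaos_coef_integrable: "F \<in> L2 M \<Longrightarrow> S \<in> chaos_index \<Longrightarrow> integrable M (\<lambda>w. F w * walk_monomial v S w)"
  by (intro L2_integrable_mult walk_monomial_L2)

lemma chaos_coef_cmult: "chaos_coef M v (\<lambda>w. c * F w) S = c * chaos_coef M v F S"
  by (simp add: chaos_coef_def mult.assoc)

lemma chaos_coef_diff:
  assumes "F \<in> L2 M" "G \<in> L2 M" "S \<in> chaos_index"
  shows "chaos_coef M v (\<lambda>w. F w - G w) S = chaos_coef M v F S - chaos_coef M v G S"
  using assms by (simp add: chaos_coef_def left_diff_distrib chaos_coef_integrable)

lemma chaos_coef_add:
  assumes "F \<in> L2 M" "G \<in> L2 M" "S \<in> chaos_index"
  shows "chaos_coef M v (\<lambda>w. F w + G w) S = chaos_coef M v F S + chaos_coef M v G S"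
  using assms by (simp add: chaos_coef_def distrib_right chaos_coef_integrable)

lemma chaos_coef_sum:
  assumes "\<And>a. a \<in> A \<Longrightarrow> F a \<in> L2 M" "S \<in> chaos_index"
  shows "chaos_coef M v (\<lambda>w. \<Sum>a\<in>A. F a w) S = (\<Sum>a\<in>A. chaos_coef M v (F a) S)"
  using assms by (simp add: chaos_coef_def sum_distrib_right chaos_coef_integrable)

lemma chaos_coef_monomial:
  "S \<in> chaos_index \<Longrightarrow> T \<in> chaos_index \<Longrightarrow> chaos_coef M v (walk_monomial v T) S = (if T = S then 1 else 0)"
  unfolding chaos_coef_def by (rule walk_monomial_orthonormal)

definition chaos_poly :: "((nat \<times> 'd) set \<Rightarrow> real) \<Rightarrow> (nat \<times> 'd) set set \<Rightarrow> (nat \<Rightarrow> nat) \<Rightarrow> real" where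
  "chaos_poly a J w = (\<Sum>S\<in>J. a S * walk_monomial v S w)"

lemma chaos_poly_L2: "J \<subseteq> chaos_index \<Longrightarrow> chaos_poly a J \<in> L2 M"
  unfolding chaos_poly_def by (intro L2_sum L2_cmult walk_monomial_L2) auto

lemma chaos_coef_poly:
  assumes "finite J" "J \<subseteq> chaos_index" "S \<in> chaos_index"
  shows "chaos_coef M v (chaos_poly a J) S = (if S \<in> J then a S else 0)"
proof -
  have "chaos_coef M v (chaos_poly a J) S = (\<Sum>T\<in>J. chaos_coef M v (\<lambda>w. a T * walk_monomial v T w) S)"
    unfolding chaos_poly_def using assms by (intro chaos_coef_sum L2_cmult walk_monomial_L2) auto
  also have "\<dots> = (\<Sum>T\<in>J. if T = S then a T else 0)"
    using assms by (intro sum.cong refl) (auto simp: chaos_coef_cmult chaos_coef_monomial subset_iff)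
  also have "\<dots> = (if S \<in> J then a S else 0)" using assms by (simp add: sum.delta)
  finally show ?thesis .
qed

lemma integral_mult_chaos_poly:
  assumes "F \<in> L2 M" "J \<subseteq> chaos_index"
  shows "(\<integral>w. F w * chaos_poly a J w \<partial>M) = (\<Sum>S\<in>J. a S * chaos_coef M v F S)"
proof -
  have "(\<integral>w. F w * chaos_poly a J w \<partial>M) = (\<integral>w. (\<Sum>S\<in>J. a S * (F w * walk_monomial v S w)) \<partial>M)"
    by (simp add: chaos_poly_def sum_distrib_left mult_ac)
  also have "\<dots> = (\<Sum>S\<in>J. \<integral>w. a S * (F w * walk_monomial v S w) \<partial>M)"
    using assms by (intro Bochner_Integration.integral_sum integrable_mult_right chaos_coef_integrable) auto
  also have "\<dots> = (\<Sum>S\<in>J. a S * chaos_coef M v F S)" by (simp add: chaos_coef_def)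
  finally show ?thesis .
qed

lemma integral_chaos_poly_square:
  assumes "finite J" "J \<subseteq> chaos_index"
  shows "(\<integral>w. (chaos_poly a J w)\<^sup>2 \<partial>M) = (\<Sum>S\<in>J. (a S)\<^sup>2)"
proof -
  have "(\<integral>w. (chaos_poly a J w)\<^sup>2 \<partial>M) = (\<Sum>S\<in>J. a S * chaos_coef M v (chaos_poly a J) S)"
    unfolding power2_eq_square by (rule integral_mult_chaos_poly[OF chaos_poly_L2]) (use assms in auto)
  also have "\<dots> = (\<Sum>S\<in>J. (a S)\<^sup>2)"
    using assms by (intro sum.cong refl) (auto simp: chaos_coef_poly subset_iff power2_eq_square)
  finally show ?thesis .
qed

lemma integral_diff_chaos_poly:
  assumes F: "F \<in> L2 M" and J: "finite J" "J \<subseteq> chaos_index"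
  shows "(\<integral>w. (chaos_poly (chaos_coef M v F) J w - F w)\<^sup>2 \<partial>M) = (\<integral>w. (F w)\<^sup>2 \<partial>M) - (\<Sum>S\<in>J. (chaos_coef M v F S)\<^sup>2)"
proof -
  let ?p = "chaos_poly (chaos_coef M v F) J"
  note p = chaos_poly_L2[OF J(2), of "chaos_coef M v F"]
  have "(\<integral>w. (?p w - F w)\<^sup>2 \<partial>M) = (\<integral>w. (?p w)\<^sup>2 + (F w)\<^sup>2 - 2 * (F w * ?p w) \<partial>M)"
    by (simp add: power2_diff mult_ac)
  also have "\<dots> = (\<integral>w. (?p w)\<^sup>2 \<partial>M) + (\<integral>w. (F w)\<^sup>2 \<partial>M) - 2 * (\<integral>w. F w * ?p w \<partial>M)"
    using L2_integrable_square[OF p] L2_integrable_square[OF F] L2_integrable_mult[OF F p] by simp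
  also have "\<dots> = (\<integral>w. (F w)\<^sup>2 \<partial>M) - (\<Sum>S\<in>J. (chaos_coef M v F S)\<^sup>2)"
    using integral_chaos_poly_square[OF J, of "chaos_coef M v F"] integral_mult_chaos_poly[OF F J(2), of "chaos_coef M v F"]
    by (simp add: power2_eq_square)
  finally show ?thesis .
qed

lemma bessel:
  assumes "F \<in> L2 M" "finite J" "J \<subseteq> chaos_index"
  shows "(\<Sum>S\<in>J. (chaos_coef M v F S)\<^sup>2) \<le> (\<integral>w. (F w)\<^sup>2 \<partial>M)"
proof -
  have "0 \<le> (\<integral>w. (chaos_poly (chaos_coef M v F) J w - F w)\<^sup>2 \<partial>M)" by simp
  then show ?thesis unfolding integral_diff_chaos_poly[OF assms] by simp
qed

lemma chaos_coef_square_le: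
  "F \<in> L2 M \<Longrightarrow> S \<in> chaos_index \<Longrightarrow> (chaos_coef M v F S)\<^sup>2 \<le> (\<integral>w. (F w)\<^sup>2 \<partial>M)"
  using bessel[of F "{S}"] by simp

lemma chaos_coef_tendsto:
  assumes u: "\<forall>\<^sub>F b in net. u b \<in> L2 M" and F: "F \<in> L2 M" and S: "S \<in> chaos_index"
    and lim: "((\<lambda>b. \<integral>w. (u b w - F w)\<^sup>2 \<partial>M) \<longlongrightarrow> 0) net"
  shows "((\<lambda>b. chaos_coef M v (u b) S) \<longlongrightarrow> chaos_coef M v F S) net"
proof -
  have "((\<lambda>b. (chaos_coef M v (u b) S - chaos_coef M v F S)\<^sup>2) \<longlongrightarrow> 0) net"
  proof (rule tendsto_sandwich[OF _ _ tendsto_const lim])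
    show "\<forall>\<^sub>F b in net. (chaos_coef M v (u b) S - chaos_coef M v F S)\<^sup>2 \<le> (\<integral>w. (u b w - F w)\<^sup>2 \<partial>M)"
      using u
    proof eventually_elim
      case (elim b)
      show ?case
        using chaos_coef_square_le[OF L2_diff[OF elim F] S] by (simp add: chaos_coef_diff[OF elim F S])
    qed
  qed simp
  from tendsto_real_sqrt[OF this] have "((\<lambda>b. \<bar>chaos_coef M v (u b) S - chaos_coef M v F S\<bar>) \<longlongrightarrow> 0) net"
    by simp
  then show ?thesis by (simp add: tendsto_rabs_zero_iff LIM_zero_iff)
qed

text \<open>Completeness of \<open>L\<^sup>2\<close> is a statement about sequences, so sums over multi-indices are approached along one
  fixed exhaustion by finite sets.\<close>

definition index_exhaustion :: "nat \<Rightarrow> (nat \<times> 'd) set set" where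
  "index_exhaustion n = from_nat_into chaos_index ` {..<n}"

lemma index_exhaustion:
  "finite (index_exhaustion n)" "index_exhaustion n \<subseteq> chaos_index" "m \<le> n \<Longrightarrow> index_exhaustion m \<subseteq> index_exhaustion n"
proof -
  have "from_nat_into chaos_index i \<in> (chaos_index :: (nat \<times> 'd) set set)" for i
    by (rule from_nat_into) (use chaos_index_empty in blast)
  then show "finite (index_exhaustion n)" "index_exhaustion n \<subseteq> chaos_index"
    by (auto simp: index_exhaustion_def)
  show "m \<le> n \<Longrightarrow> index_exhaustion m \<subseteq> index_exhaustion n"
    unfolding index_exhaustion_def by (rule image_mono) simp
qed

lemma filterlim_index_exhaustion: "filterlim index_exhaustion (finite_subsets_at_top chaos_index) sequentially"
  unfolding filterlim_finite_subsets_at_top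
proof safe
  fix X :: "(nat \<times> 'd) set set" assume X: "finite X" "X \<subseteq> chaos_index"
  define N where "N = Suc (Max (insert 0 (to_nat_on chaos_index ` X)))"
  have "X \<subseteq> index_exhaustion N"
  proof
    fix S assume S: "S \<in> X"
    then have "S = from_nat_into chaos_index (to_nat_on chaos_index S)"
      using from_nat_into_to_nat_on[OF countable_chaos_index, of S] X by auto
    moreover have "to_nat_on chaos_index S < N"
      unfolding N_def less_Suc_eq_le using X S by (intro Max_ge) auto
    ultimately show "S \<in> index_exhaustion N" unfolding index_exhaustion_def by blast
  qed
  then show "\<forall>\<^sub>F n in sequentially. finite (index_exhaustion n) \<and> X \<subseteq> index_exhaustion n \<and> index_exhaustion n \<subseteq> chaos_index"
    using index_exhaustion(1,2) index_exhaustion(3)[of N] unfolding eventually_sequentially by blast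
qed

text \<open>The squared distance of two partial sums along the exhaustion is the difference of the partial sums
  of the squares, so these are Cauchy; single coefficients pass to the limit by Bessel's inequality.\<close>

theorem riesz_fischer:
  assumes a: "(\<lambda>S. (a S)\<^sup>2) summable_on chaos_index"
  obtains H where "H \<in> L2 M" "\<And>S. S \<in> chaos_index \<Longrightarrow> chaos_coef M v H S = a S"
    "(\<lambda>n. \<integral>w. (chaos_poly a (index_exhaustion n) w - H w)\<^sup>2 \<partial>M) \<longlonglongrightarrow> 0"
proof -
  define u where "u n = chaos_poly a (index_exhaustion n)" for n
  define f where "f n = (\<Sum>S\<in>index_exhaustion n. (a S)\<^sup>2)" for n
  have u: "u n \<in> L2 M" for n unfolding u_def by (intro chaos_poly_L2 index_exhaustion)
  have dist_le: "(\<integral>w. (u m w - u n w)\<^sup>2 \<partial>M) = \<bar>f m - f n\<bar>" if "n \<le> m" for m n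
  proof -
    have sub: "index_exhaustion n \<subseteq> index_exhaustion m" by (rule index_exhaustion(3)[OF that])
    have "u m w - u n w = chaos_poly a (index_exhaustion m - index_exhaustion n) w" for w
      unfolding u_def chaos_poly_def by (subst sum_diff) (use sub index_exhaustion in auto)
    then have "(\<integral>w. (u m w - u n w)\<^sup>2 \<partial>M) = (\<Sum>S\<in>index_exhaustion m - index_exhaustion n. (a S)\<^sup>2)"
      using integral_chaos_poly_square[of "index_exhaustion m - index_exhaustion n" a] index_exhaustion(1,2)[of m]
      by (simp add: subset_iff)
    also have "\<dots> = f m - f n" unfolding f_def by (rule sum_diff) (use sub index_exhaustion in auto)
    finally have "(\<integral>w. (u m w - u n w)\<^sup>2 \<partial>M) = f m - f n" .
    moreover have "0 \<le> (\<integral>w. (u m w - u n w)\<^sup>2 \<partial>M)" by simp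
    ultimately show ?thesis by linarith
  qed
  have dist: "(\<integral>w. (u m w - u n w)\<^sup>2 \<partial>M) = \<bar>f m - f n\<bar>" for m n
  proof (cases "n \<le> m")
    case False
    then show ?thesis using dist_le[of m n] by (simp add: power2_commute abs_minus_commute)
  qed (rule dist_le)
  have "((\<lambda>S. (a S)\<^sup>2) has_sum infsum (\<lambda>S. (a S)\<^sup>2) chaos_index) chaos_index" using a by simp
  then have "f \<longlonglongrightarrow> infsum (\<lambda>S. (a S)\<^sup>2) chaos_index"
    unfolding has_sum_def f_def by (rule filterlim_compose[OF _ filterlim_index_exhaustion])
  then have "Cauchy f" by (rule LIMSEQ_imp_Cauchy)
  then have "\<exists>N. \<forall>m\<ge>N. \<forall>n\<ge>N. (\<integral>w. (u m w - u n w)\<^sup>2 \<partial>M) < e" if "e > 0" for e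
    unfolding dist using that by (auto simp: Cauchy_def dist_real_def)
  from L2_complete[OF u this] obtain H where H: "H \<in> L2 M" "(\<lambda>n. \<integral>w. (u n w - H w)\<^sup>2 \<partial>M) \<longlonglongrightarrow> 0"
    by blast
  have "chaos_coef M v H S = a S" if S: "S \<in> chaos_index" for S
  proof (rule LIMSEQ_unique)
    show "(\<lambda>n. chaos_coef M v (u n) S) \<longlonglongrightarrow> chaos_coef M v H S"
      by (rule chaos_coef_tendsto[OF _ H(1) S H(2)]) (simp add: u)
    have "\<forall>\<^sub>F n in sequentially. {S} \<subseteq> index_exhaustion n"
      using filterlim_index_exhaustion[unfolded filterlim_finite_subsets_at_top] S
      by (auto elim!: allE[of _ "{S}"] eventually_mono)
    then have "\<forall>\<^sub>F n in sequentially. a S = chaos_coef M v (u n) S"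
      by eventually_elim (use index_exhaustion S in \<open>simp add: u_def chaos_coef_poly\<close>)
    then show "(\<lambda>n. chaos_coef M v (u n) S) \<longlonglongrightarrow> a S"
      by (rule Lim_transform_eventually[OF tendsto_const])
  qed
  with H show ?thesis using that unfolding u_def by blast
qed

lemma chaos_coef_square_summable:
  "F \<in> L2 M \<Longrightarrow> (\<lambda>S. (chaos_coef M v F S)\<^sup>2) summable_on chaos_index"
  by (rule nonneg_bdd_above_summable_on) (auto intro!: bdd_aboveI2 bessel)

lemma AE_eq_if_chaos_coef_eq:
  assumes "F \<in> L2 M" "G \<in> L2 M" "\<And>S. S \<in> chaos_index \<Longrightarrow> chaos_coef M v F S = chaos_coef M v G S"
  shows "AE w in M. F w = G w"
proof -
  have "AE w in M. F w - G w = 0"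
    by (rule orthogonal_imp_AE_zero[OF L2_diff[OF assms(1,2)]])
      (use assms chaos_coef_diff[OF assms(1,2)] in \<open>simp add: chaos_coef_def\<close>)
  then show ?thesis by simp
qed

text \<open>The Riesz--Fischer limit with the coefficients of \<open>F\<close> equals \<open>F\<close> by totality, so the gap
  in Bessel's inequality tends to \<open>0\<close>.\<close>

theorem parseval:
  assumes F: "F \<in> L2 M"
  shows "((\<lambda>S. (chaos_coef M v F S)\<^sup>2) has_sum (\<integral>w. (F w)\<^sup>2 \<partial>M)) chaos_index"
proof -
  let ?a = "chaos_coef M v F"
  let ?p = "\<lambda>n. chaos_poly ?a (index_exhaustion n)"
  have sm: "(\<lambda>S. (?a S)\<^sup>2) summable_on chaos_index" by (rule chaos_coef_square_summable[OF F])
  obtain H where H: "H \<in> L2 M" "\<And>S. S \<in> chaos_index \<Longrightarrow> chaos_coef M v H S = ?a S"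
    "(\<lambda>n. \<integral>w. (?p n w - H w)\<^sup>2 \<partial>M) \<longlonglongrightarrow> 0"
    using riesz_fischer[OF sm] by blast
  have HF: "AE w in M. H w = F w" by (rule AE_eq_if_chaos_coef_eq[OF H(1) F H(2)])
  have "(\<integral>w. (?p n w - H w)\<^sup>2 \<partial>M) = (\<integral>w. (F w)\<^sup>2 \<partial>M) - (\<Sum>S\<in>index_exhaustion n. (?a S)\<^sup>2)" for n
  proof -
    have p: "?p n \<in> L2 M" by (intro chaos_poly_L2 index_exhaustion)
    have "(\<integral>w. (?p n w - H w)\<^sup>2 \<partial>M) = (\<integral>w. (?p n w - F w)\<^sup>2 \<partial>M)"
    proof (rule integral_cong_AE)
      show "AE w in M. (?p n w - H w)\<^sup>2 = (?p n w - F w)\<^sup>2" using HF by eventually_elim simp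
    qed (use L2_integrable_square[OF L2_diff[OF p H(1)]] L2_integrable_square[OF L2_diff[OF p F]] in auto)
    then show ?thesis by (simp add: integral_diff_chaos_poly F index_exhaustion)
  qed
  then have "(\<lambda>n. (\<integral>w. (F w)\<^sup>2 \<partial>M) - (\<Sum>S\<in>index_exhaustion n. (?a S)\<^sup>2)) \<longlonglongrightarrow> 0"
    using H(3) by simp
  from tendsto_diff[OF tendsto_const[of "\<integral>w. (F w)\<^sup>2 \<partial>M"] this]
  have "(\<lambda>n. \<Sum>S\<in>index_exhaustion n. (?a S)\<^sup>2) \<longlonglongrightarrow> (\<integral>w. (F w)\<^sup>2 \<partial>M)" by simp
  moreover have "((\<lambda>S. (?a S)\<^sup>2) has_sum infsum (\<lambda>S. (?a S)\<^sup>2) chaos_index) chaos_index" using sm by simp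
  then have "(\<lambda>n. \<Sum>S\<in>index_exhaustion n. (?a S)\<^sup>2) \<longlonglongrightarrow> infsum (\<lambda>S. (?a S)\<^sup>2) chaos_index"
    unfolding has_sum_def by (rule filterlim_compose[OF _ filterlim_index_exhaustion])
  ultimately have "infsum (\<lambda>S. (?a S)\<^sup>2) chaos_index = (\<integral>w. (F w)\<^sup>2 \<partial>M)" using LIMSEQ_unique by blast
  then show ?thesis using has_sum_infsum[OF sm] by simp
qed

corollary parseval_mult:
  assumes F: "F \<in> L2 M" and G: "G \<in> L2 M"
  shows "((\<lambda>S. chaos_coef M v F S * chaos_coef M v G S) has_sum (\<integral>w. F w * G w \<partial>M)) chaos_index"
proof -
  have "((\<lambda>S. ((chaos_coef M v (\<lambda>w. F w + G w) S)\<^sup>2 - (chaos_coef M v F S)\<^sup>2 - (chaos_coef M v G S)\<^sup>2) / 2) has_sum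
     ((\<integral>w. (F w + G w)\<^sup>2 \<partial>M) - (\<integral>w. (F w)\<^sup>2 \<partial>M) - (\<integral>w. (G w)\<^sup>2 \<partial>M)) / 2) chaos_index"
    unfolding diff_conv_add_uminus
    by (intro has_sum_divide_const has_sum_add has_sum_uminusI parseval[OF L2_add[OF F G]] parseval F G)
  moreover have "((\<integral>w. (F w + G w)\<^sup>2 \<partial>M) - (\<integral>w. (F w)\<^sup>2 \<partial>M) - (\<integral>w. (G w)\<^sup>2 \<partial>M)) / 2 = (\<integral>w. F w * G w \<partial>M)"
    using L2_integrable_square[OF F] L2_integrable_square[OF G] L2_integrable_mult[OF F G]
    by (simp add: power2_sum mult.assoc)
  ultimately show ?thesis
    by (subst (asm) has_sum_cong[where g="\<lambda>S. chaos_coef M v F S * chaos_coef M v G S"])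
      (simp_all add: chaos_coef_add F G power2_sum)
qed

corollary parseval_dist:
  assumes F: "F \<in> L2 M" and G: "G \<in> L2 M"
  shows "((\<lambda>S. (chaos_coef M v F S - chaos_coef M v G S)\<^sup>2) has_sum (\<integral>w. (F w - G w)\<^sup>2 \<partial>M)) chaos_index"
  using parseval[OF L2_diff[OF F G]]
  by (subst (asm) has_sum_cong[where g="\<lambda>S. (chaos_coef M v F S - chaos_coef M v G S)\<^sup>2"])
    (simp_all add: chaos_coef_diff F G)

end

section \<open>Multiple integrals in terms of chaos coefficients\<close>

text \<open>A symmetric kernel takes the same value at all enumerations of a multi-index, so it is a function of
  finite sets. This form spares all later arguments the permutations of arguments.\<close>

definition represents ::
  "nat \<Rightarrow> ('d list \<Rightarrow> nat list \<Rightarrow> real) \<Rightarrow> ((nat \<times> 'd) set \<Rightarrow> real) \<Rightarrow> bool" where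
  "represents r f a \<longleftrightarrow>
    (\<forall>xs. length xs = r \<and> distinct (map fst xs) \<longrightarrow> f (map snd xs) (map fst xs) = a (set xs)) \<and>
    (\<lambda>S. (a S)\<^sup>2) summable_on {S \<in> chaos_index. card S = r}"

lemma chaos_index_list:
  "set xs \<in> chaos_index \<and> card (set xs) = length xs" if "distinct (map fst xs)"
  using that by (simp add: chaos_index_def distinct_map distinct_card)

lemma distinct_map_fst_if_index:
  "distinct xs \<Longrightarrow> set xs \<in> chaos_index \<Longrightarrow> distinct (map fst xs)"
  by (simp add: chaos_index_def distinct_map)

lemma zip_map_fst_snd: "zip (map fst xs) (map snd xs) = xs"
  by (induction xs) auto

text \<open>Two enumerations of one set differ by a permutation, so the value at an arbitrarily chosen enumeration is
  the value at each of them. The choice is injective, which gives the square-summability.\<close>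

lemma sym_kernels_represents:
  fixes f :: "'d::finite list \<Rightarrow> nat list \<Rightarrow> real"
  assumes f: "f \<in> sym_kernels r"
  shows "\<exists>a. represents r f a"
proof -
  define en :: "(nat \<times> 'd) set \<Rightarrow> (nat \<times> 'd) list" where "en S = (SOME xs. set xs = S \<and> distinct xs)" for S
  have en: "set (en S) = S \<and> distinct (en S)" if "finite S" for S
    unfolding en_def by (rule someI_ex) (use finite_distinct_list[OF that] in blast)
  define a where "a S = f (map snd (en S)) (map fst (en S))" for S
  have "f (map snd xs) (map fst xs) = a (set xs)" if xs: "length xs = r" "distinct (map fst xs)" for xs
  proof -
    let ?ys = "en (set xs)"
    have d: "distinct xs" using xs by (simp add: distinct_map)
    have ys: "set ?ys = set xs" "distinct ?ys" using en[of "set xs"] by auto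
    then have mset: "mset xs = mset ?ys" using d set_eq_iff_mset_eq_distinct by metis
    then obtain p where p: "p permutes {..<length ?ys}" "permute_list p ?ys = xs"
      by (rule mset_eq_permutation)
    have len: "length ?ys = r" using mset xs(1) by (metis size_mset)
    have "distinct (map fst ?ys)"
      using chaos_index_list[OF xs(2)] ys by (intro distinct_map_fst_if_index) auto
    then have "map fst ?ys \<in> offdiag r" using len by (simp add: offdiag_def)
    moreover have "map snd xs = permute_list p (map snd ?ys)" "map fst xs = permute_list p (map fst ?ys)"
      by (rule permute_list_map[OF p(1), unfolded p(2), symmetric])+
    ultimately show ?thesis
      using f p(1) len unfolding sym_kernels_def a_def by simp
  qed
  moreover have "(\<lambda>S. (a S)\<^sup>2) summable_on {S \<in> chaos_index. card S = r}"
  proof -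
    let ?B = "{ks :: 'd list. length ks = r} \<times> offdiag r"
    let ?h = "\<lambda>S. (map snd (en S), map fst (en S))"
    have "finite {ks :: 'd list. length ks = r}"
      using finite_lists_length_eq[of "UNIV :: 'd set" r] by simp
    then have "(\<lambda>(ks, is). (f ks is)\<^sup>2) summable_on ?B"
      using f by (intro summable_on_SigmaI[where g="\<lambda>ks. infsum (\<lambda>is. (f ks is)\<^sup>2) (offdiag r)"])
        (auto simp: sym_kernels_def)
    moreover have "?h ` {S \<in> chaos_index. card S = r} \<subseteq> ?B"
    proof (safe, goal_cases)
      case (1 S)
      then show ?case using en[OF chaos_index_finite[OF 1(1)]] by (simp flip: distinct_card)
    next
      case (2 S)
      then show ?case using en[OF chaos_index_finite[OF 2(1)]]
        by (auto simp: offdiag_def distinct_card[symmetric] intro!: distinct_map_fst_if_index)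
    qed
    ultimately have "(\<lambda>(ks, is). (f ks is)\<^sup>2) summable_on ?h ` {S \<in> chaos_index. card S = r}"
      by (rule summable_on_subset)
    moreover have "inj_on ?h {S \<in> chaos_index. card S = r}"
    proof (rule inj_onI)
      fix S T assume S: "S \<in> {S \<in> chaos_index. card S = r}" and T: "T \<in> {S \<in> chaos_index. card S = r}" and eq: "?h S = ?h T"
      then have "en S = en T" by (metis Pair_inject zip_map_fst_snd)
      then show "S = T" using en[OF chaos_index_finite] S T by (metis (mono_tags, lifting) mem_Collect_eq)
    qed
    ultimately have "((\<lambda>(ks, is). (f ks is)\<^sup>2) \<circ> ?h) summable_on {S \<in> chaos_index. card S = r}"
      by (simp only: summable_on_reindex)
    then show ?thesis by (simp add: o_def a_def)
  qed
  ultimately show ?thesis unfolding represents_def by blast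
qed

text \<open>Freezing the last argument acts on multi-indices by adjoining a pair.\<close>

lemma represents_grad_kernel:
  assumes f: "represents (Suc r) f a"
  shows "represents r (grad_kernel k j f) (\<lambda>T. if k \<in> fst ` T then 0 else a (insert (k, j) T))"
  unfolding represents_def
proof (intro conjI allI impI)
  fix xs :: "(nat \<times> 'a) list" assume xs: "length xs = r \<and> distinct (map fst xs)"
  show "grad_kernel k j f (map snd xs) (map fst xs) = (if k \<in> fst ` set xs then 0 else a (insert (k, j) (set xs)))"
  proof (cases "k \<in> fst ` set xs")
    case False
    then have "f (map snd (xs @ [(k, j)])) (map fst (xs @ [(k, j)])) = a (set (xs @ [(k, j)]))"
      using xs by (intro f[unfolded represents_def, THEN conjunct1, rule_format]) auto
    then show ?thesis using False by (simp add: grad_kernel_def)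
  qed (simp add: grad_kernel_def)
next
  let ?A = "{T \<in> chaos_index. card T = r \<and> k \<notin> fst ` T}"
  have inj: "inj_on (insert (k, j)) ?A"
    by (rule inj_onI) (simp add: chaos_index_insert_eq)
  have "insert (k, j) ` ?A \<subseteq> {S \<in> chaos_index. card S = Suc r}"
  proof (safe, goal_cases)
    case (1 _ T) then show ?case by (simp add: chaos_index_insert)
  next
    case (2 _ T)
    have "(k, j) \<notin> T"
    proof
      assume "(k, j) \<in> T"
      then have "fst (k, j) \<in> fst ` T" by (rule imageI)
      with 2 show False by simp
    qed
    with 2 show ?case by (simp add: chaos_index_finite)
  qed
  with f have "(\<lambda>S. (a S)\<^sup>2) summable_on insert (k, j) ` ?A"
    unfolding represents_def by (blast intro: summable_on_subset)
  then have "(\<lambda>T. (a (insert (k, j) T))\<^sup>2) summable_on ?A"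
    using summable_on_reindex[OF inj, of "\<lambda>S. (a S)\<^sup>2"] by (simp add: o_def)
  then show "(\<lambda>T. (if k \<in> fst ` T then 0 else a (insert (k, j) T))\<^sup>2) summable_on {T \<in> chaos_index. card T = r}"
    by (subst summable_on_cong_neutral[where T="?A" and g="\<lambda>T. (a (insert (k, j) T))\<^sup>2"]) auto
qed

definition kernel_of :: "((nat \<times> 'd) set \<Rightarrow> real) \<Rightarrow> 'd list \<Rightarrow> nat list \<Rightarrow> real" where
  "kernel_of a ks is = a (set (zip is ks))"

lemma represents_kernel_of:
  assumes "(\<lambda>S. (a S)\<^sup>2) summable_on chaos_index"
  shows "represents r (kernel_of a) a"
  unfolding represents_def kernel_of_def zip_map_fst_snd
  by (intro conjI allI impI refl summable_on_subset[OF assms]) auto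

text \<open>Each value \<open>g y\<close> is counted at most \<open>N\<close> times.\<close>

lemma summable_on_finite_fibres:
  fixes g :: "'b \<Rightarrow> real"
  assumes g: "g summable_on B" and pos: "\<And>y. y \<in> B \<Longrightarrow> g y \<ge> 0" and h: "\<And>x. x \<in> A \<Longrightarrow> h x \<in> B"
    and fib: "\<And>y. y \<in> B \<Longrightarrow> finite {x \<in> A. h x = y} \<and> card {x \<in> A. h x = y} \<le> N"
  shows "(\<lambda>x. g (h x)) summable_on A"
proof (rule nonneg_bdd_above_summable_on)
  show "bdd_above (sum (\<lambda>x. g (h x)) ` {F. F \<subseteq> A \<and> finite F})"
  proof (rule bdd_aboveI2)
    fix F assume F: "F \<in> {F. F \<subseteq> A \<and> finite F}"
    have "sum (\<lambda>x. g (h x)) F = (\<Sum>y\<in>h ` F. sum (\<lambda>x. g (h x)) {x \<in> F. h x = y})"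
      by (rule sum.image_gen) (use F in auto)
    also have "\<dots> = (\<Sum>y\<in>h ` F. real (card {x \<in> F. h x = y}) * g y)"
      by (intro sum.cong refl) simp
    also have "\<dots> \<le> (\<Sum>y\<in>h ` F. real N * g y)"
    proof (intro sum_mono mult_right_mono)
      fix y assume "y \<in> h ` F"
      then have y: "y \<in> B" using h F by auto
      then show "g y \<ge> 0" by (rule pos)
      have "card {x \<in> F. h x = y} \<le> card {x \<in> A. h x = y}"
        by (rule card_mono) (use fib[OF y] F in auto)
      then show "real (card {x \<in> F. h x = y}) \<le> real N" using fib[OF y] by simp
    qed
    also have "\<dots> = real N * (\<Sum>y\<in>h ` F. g y)" by (simp add: sum_distrib_left)
    also have "\<dots> \<le> real N * infsum g B"
      by (intro mult_left_mono finite_sum_le_infsum g) (use F h pos in auto)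
    finally show "sum (\<lambda>x. g (h x)) F \<le> real N * infsum g B" .
  qed
qed (use pos h in auto)

lemma kernel_of_sym_kernels:
  assumes a: "(\<lambda>S. (a S)\<^sup>2) summable_on chaos_index"
  shows "kernel_of a \<in> sym_kernels r"
  unfolding sym_kernels_def
proof (intro CollectI conjI allI impI)
  fix ks :: "'a list" and "is" p assume *: "length ks = r \<and> is \<in> offdiag r \<and> p permutes {..<r}"
  then have p: "p permutes {..<length is}" and len: "length is = length ks" by (auto simp: offdiag_def)
  have "set (zip (permute_list p is) (permute_list p ks)) = set (permute_list p (zip is ks))"
    using permute_list_zip[OF p refl len] by simp
  also have "\<dots> = set (zip is ks)" using p len by (intro set_permute_list) simp
  finally show "kernel_of a (permute_list p ks) (permute_list p is) = kernel_of a ks is"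
    by (simp add: kernel_of_def)
next
  fix ks :: "'a list" assume ks: "length ks = r"
  show "(\<lambda>is. (kernel_of a ks is)\<^sup>2) summable_on offdiag r"
    unfolding kernel_of_def
  proof (rule summable_on_finite_fibres[where g="\<lambda>S. (a S)\<^sup>2" and h="\<lambda>is. set (zip is ks)" and N="r ^ r"])
    show "(\<lambda>S. (a S)\<^sup>2) summable_on {S \<in> chaos_index. card S = r}"
      by (rule summable_on_subset[OF a]) auto
    fix "is" assume "is \<in> offdiag r"
    then show "set (zip is ks) \<in> {S \<in> chaos_index. card S = r}"
      using chaos_index_list[of "zip is ks"] ks by (simp add: offdiag_def)
  next
    fix S :: "(nat \<times> 'a) set" assume "S \<in> {S \<in> chaos_index. card S = r}"
    then have S: "finite (fst ` S)" "card (fst ` S) = r"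
      by (auto simp: chaos_index_def card_image)
    have sub: "{is \<in> offdiag r. set (zip is ks) = S} \<subseteq> {is. set is \<subseteq> fst ` S \<and> length is = r}"
    proof safe
      fix "is" i assume "is \<in> offdiag r" "i \<in> set is"
      then show "i \<in> fst ` set (zip is ks)"
        using ks map_fst_zip[of "is" ks] by (metis (mono_tags) list.set_map offdiag_def mem_Collect_eq)
    qed (auto simp: offdiag_def)
    \<comment> \<open>The enumerations of \<open>S\<close> with prescribed components are lists of length \<open>r\<close> over its \<open>r\<close> times.\<close>
    have "card {is \<in> offdiag r. set (zip is ks) = S} \<le> r ^ r"
      using card_mono[OF finite_lists_length_eq[OF S(1)] sub] by (simp add: card_lists_length_eq S)
    then show "finite {is \<in> offdiag r. set (zip is ks) = S} \<and> card {is \<in> offdiag r. set (zip is ks) = S} \<le> r ^ r"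
      using finite_subset[OF sub finite_lists_length_eq[OF S(1)]] by blast
  qed auto
qed

lemma walk_monomial_list:
  assumes "length xs = r" "distinct (map fst xs)"
  shows "(\<Prod>l<r. walk v (map fst xs ! l) w $ (map snd xs ! l)) = walk_monomial v (set xs) w"
proof -
  have "distinct xs" using assms by (simp add: distinct_map)
  have "walk_monomial v (set xs) w = (\<Prod>l<r. case xs ! l of (i, k) \<Rightarrow> walk v i w $ k)"
    unfolding walk_monomial_def
    by (rule prod.reindex_bij_betw[symmetric]) (use bij_betw_nth[OF \<open>distinct xs\<close> refl refl] assms(1) in simp)
  also have "\<dots> = (\<Prod>l<r. walk v (map fst xs ! l) w $ (map snd xs ! l))"
    using assms(1) by (intro prod.cong refl) (simp add: case_prod_beta)
  finally show ?thesis by simp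
qed

context obtuse_random_walk begin

text \<open>Dominated convergence for chaos coefficients: by Parseval's identity the distance is a sum over
  multi-indices. It is bounded by a convergent sum, whose tail is small outside a finite set, and
  on a finite set all terms vanish eventually.\<close>

lemma L2_tendsto_dominated:
  assumes u: "\<forall>\<^sub>F b in net. u b \<in> L2 M" and H: "H \<in> L2 M"
    and dom: "\<forall>\<^sub>F b in net. \<forall>S\<in>chaos_index. \<bar>chaos_coef M v (u b) S - chaos_coef M v H S\<bar> \<le> \<bar>chaos_coef M v H S\<bar>"
    and lim: "\<And>S. S \<in> chaos_index \<Longrightarrow> \<forall>\<^sub>F b in net. chaos_coef M v (u b) S = chaos_coef M v H S"
  shows "((\<lambda>b. \<integral>w. (u b w - H w)\<^sup>2 \<partial>M) \<longlongrightarrow> 0) net"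
proof (rule tendstoI)
  fix e :: real assume "e > 0"
  let ?c = "chaos_coef M v H" and ?T = "\<integral>w. (H w)\<^sup>2 \<partial>M"
  have "\<forall>\<^sub>F J in finite_subsets_at_top chaos_index. dist (\<Sum>S\<in>J. (?c S)\<^sup>2) ?T < e"
    using parseval[OF H] \<open>e > 0\<close> unfolding has_sum_def by (rule tendstoD)
  then have "\<exists>J. finite J \<and> J \<subseteq> chaos_index \<and> dist (\<Sum>S\<in>J. (?c S)\<^sup>2) ?T < e"
    unfolding eventually_finite_subsets_at_top by blast
  then obtain J where J: "finite J" "J \<subseteq> chaos_index" "dist (\<Sum>S\<in>J. (?c S)\<^sup>2) ?T < e" by blast
  have tail: "((\<lambda>S. (?c S)\<^sup>2 - (if S \<in> J then (?c S)\<^sup>2 else 0)) has_sum (?T - (\<Sum>S\<in>J. (?c S)\<^sup>2))) chaos_index"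
    unfolding diff_conv_add_uminus
    by (intro has_sum_add has_sum_uminusI parseval H has_sum_finite_neutralI[OF J(1,2)]) simp_all
  have "\<forall>\<^sub>F b in net. \<forall>S\<in>J. chaos_coef M v (u b) S = ?c S"
    using J lim by (intro eventually_ball_finite) auto
  with u dom show "\<forall>\<^sub>F b in net. dist (\<integral>w. (u b w - H w)\<^sup>2 \<partial>M) 0 < e"
  proof eventually_elim
    case (elim b)
    have "(\<integral>w. (u b w - H w)\<^sup>2 \<partial>M) \<le> ?T - (\<Sum>S\<in>J. (?c S)\<^sup>2)"
    proof (rule has_sum_mono[OF parseval_dist[OF elim(1) H] tail])
      fix S :: "(nat \<times> 'd) set" assume "S \<in> chaos_index"
      with elim(2) have "(chaos_coef M v (u b) S - ?c S)\<^sup>2 \<le> (?c S)\<^sup>2" by (simp add: abs_le_square_iff)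
      with elim(3) show "(chaos_coef M v (u b) S - ?c S)\<^sup>2 \<le> (?c S)\<^sup>2 - (if S \<in> J then (?c S)\<^sup>2 else 0)"
        by simp
    qed
    with J(3) show ?case by (simp add: dist_real_def)
  qed
qed

text \<open>The terms of a partial sum of the multiple integral are grouped by the underlying multi-index; the
  coefficient counts the enumerations whose times already belong to \<open>A\<close>.\<close>

lemma mult_int_partial:
  assumes f: "represents r f a" and A: "finite A" "A \<subseteq> offdiag r"
  defines "P \<equiv> \<lambda>w. \<Sum>ks | length ks = r. \<Sum>is\<in>A. f ks is * (\<Prod>l<r. walk v (is ! l) w $ (ks ! l))"
  shows "P \<in> L2 M"
    and "S \<in> chaos_index \<Longrightarrow> chaos_coef M v P S =
      real (card {xs \<in> permutations_of_set S. length xs = r \<and> map fst xs \<in> A}) * a S"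
proof -
  define X where "X = {xs :: (nat \<times> 'd) list. length xs = r \<and> map fst xs \<in> A}"
  have X: "length xs = r" "distinct (map fst xs)" "set xs \<in> chaos_index" if "xs \<in> X" for xs
    using that A chaos_index_list[of xs] by (auto simp: X_def offdiag_def)
  have finK: "finite {ks :: 'd list. length ks = r}"
    using finite_lists_length_eq[of "UNIV :: 'd set" r] by simp
  have "X \<subseteq> (\<lambda>(ks, is). zip is ks) ` ({ks. length ks = r} \<times> A)"
  proof
    fix xs assume "xs \<in> X"
    then show "xs \<in> (\<lambda>(ks, is). zip is ks) ` ({ks. length ks = r} \<times> A)"
      by (intro image_eqI[of _ _ "(map snd xs, map fst xs)"]) (auto simp: zip_map_fst_snd X_def)
  qed
  then have finX: "finite X" by (rule finite_subset) (intro finite_imageI finite_cartesian_product finK A(1))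
  have P: "P w = (\<Sum>xs\<in>X. a (set xs) * walk_monomial v (set xs) w)" for w
  proof -
    have "P w = (\<Sum>(ks, is)\<in>{ks. length ks = r} \<times> A. f ks is * (\<Prod>l<r. walk v (is ! l) w $ (ks ! l)))"
      unfolding P_def by (rule sum.cartesian_product)
    also have "\<dots> = (\<Sum>xs\<in>X. a (set xs) * walk_monomial v (set xs) w)"
    proof (rule sum.reindex_bij_witness[where i="\<lambda>xs. (map snd xs, map fst xs)" and j="\<lambda>(ks, is). zip is ks"])
      fix p assume p: "p \<in> {ks :: 'd list. length ks = r} \<times> A"
      obtain ks "is" where ki: "p = (ks, is)" by (cases p)
      with p A have len: "length is = r" "length ks = r" "is \<in> A" by (auto simp: offdiag_def)
      show "(\<lambda>xs. (map snd xs, map fst xs)) (case p of (ks, is) \<Rightarrow> zip is ks) = p"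
        using len by (simp add: ki)
      show zX: "(case p of (ks, is) \<Rightarrow> zip is ks) \<in> X" using len by (simp add: ki X_def)
      have z: "map snd (zip is ks) = ks" "map fst (zip is ks) = is" using len by simp_all
      note zX' = X[OF zX[unfolded ki prod.case]]
      from f zX'(1,2) have "f ks is = a (set (zip is ks))"
        unfolding represents_def using z by metis
      moreover have "(\<Prod>l<r. walk v (is ! l) w $ (ks ! l)) = walk_monomial v (set (zip is ks)) w"
        using walk_monomial_list[OF zX'(1,2), of v w] unfolding z .
      ultimately show "a (set (case p of (ks, is) \<Rightarrow> zip is ks)) * walk_monomial v (set (case p of (ks, is) \<Rightarrow> zip is ks)) w =
         (case p of (ks, is) \<Rightarrow> f ks is * (\<Prod>l<r. walk v (is ! l) w $ (ks ! l)))"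
        by (simp add: ki)
    next
      fix xs assume "xs \<in> X"
      then show "(case (map snd xs, map fst xs) of (ks, is) \<Rightarrow> zip is ks) = xs"
        "(map snd xs, map fst xs) \<in> {ks. length ks = r} \<times> A"
        by (auto simp: X_def zip_map_fst_snd)
    qed
    finally show ?thesis .
  qed
  then have P_eq: "P = (\<lambda>w. \<Sum>xs\<in>X. a (set xs) * walk_monomial v (set xs) w)" by (rule ext)
  have summand: "(\<lambda>w. a (set xs) * walk_monomial v (set xs) w) \<in> L2 M" if "xs \<in> X" for xs
    by (intro L2_cmult walk_monomial_L2 X that)
  then show "P \<in> L2 M" unfolding P_eq by (intro L2_sum)
  assume S: "S \<in> chaos_index"
  have "chaos_coef M v P S = (\<Sum>xs\<in>X. chaos_coef M v (\<lambda>w. a (set xs) * walk_monomial v (set xs) w) S)"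
    unfolding P_eq by (intro chaos_coef_sum summand S)
  also have "\<dots> = (\<Sum>xs\<in>X. if set xs = S then a S else 0)"
    using S X(3) by (intro sum.cong refl) (auto simp: chaos_coef_cmult chaos_coef_monomial)
  also have "\<dots> = real (card {xs \<in> X. set xs = S}) * a S"
    using finX by (simp flip: sum.inter_filter)
  also have "{xs \<in> X. set xs = S} = {xs \<in> permutations_of_set S. length xs = r \<and> map fst xs \<in> A}"
    using X(2) by (auto simp: X_def permutations_of_set_def distinct_map)
  finally show "chaos_coef M v P S = real (card {xs \<in> permutations_of_set S. length xs = r \<and> map fst xs \<in> A}) * a S" .
qed

text \<open>A multi-index of size \<open>r\<close> has \<open>r!\<close> enumerations, and each of them contributes the same
  amount to the multiple integral.\<close>

theorem mult_int_coef:
  assumes f: "represents r f a"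
  shows "mult_int M v r f \<in> L2 M"
    and "S \<in> chaos_index \<Longrightarrow> chaos_coef M v (mult_int M v r f) S = (if card S = r then fact r * a S else 0)"
proof -
  let ?c = "\<lambda>S. if card S = r then fact r * a S else 0"
  have "mult_int M v r f \<in> L2 M \<and> (\<forall>S\<in>chaos_index. chaos_coef M v (mult_int M v r f) S = ?c S)"
  proof (cases "r = 0")
    case True
    have "f [] [] = a {}" using f True unfolding represents_def by force
    then have const: "mult_int M v r f = (\<lambda>w. a {} * walk_monomial v {} w)" using True by (simp add: mult_int_def)
    have "(\<lambda>w. a {} * walk_monomial v {} w) \<in> L2 M" by (intro L2_cmult walk_monomial_L2 chaos_index_empty)
    moreover have "chaos_coef M v (\<lambda>w. a {} * walk_monomial v {} w) S = ?c S" if "S \<in> chaos_index" for S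
      unfolding chaos_coef_cmult
      using True chaos_coef_monomial[OF that chaos_index_empty] chaos_index_finite[OF that] by auto
    ultimately show ?thesis unfolding const by blast
  next
    case False
    let ?net = "finite_subsets_at_top (offdiag r)"
    define P where "P A w = (\<Sum>ks | length ks = r. \<Sum>is\<in>A. f ks is * (\<Prod>l<r. walk v (is ! l) w $ (ks ! l)))" for A w
    note P = mult_int_partial[OF f, folded P_def]
    have "(\<lambda>S. (?c S)\<^sup>2) summable_on chaos_index \<longleftrightarrow>
        (\<lambda>S. (fact r)\<^sup>2 * (a S)\<^sup>2) summable_on {S \<in> chaos_index. card S = r}"
      by (rule summable_on_cong_neutral) (auto simp: power_mult_distrib)
    moreover have "(\<lambda>S. (fact r)\<^sup>2 * (a S)\<^sup>2) summable_on {S \<in> chaos_index. card S = r}"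
      using f unfolding represents_def by (intro summable_on_cmult_right) simp
    ultimately obtain H where H: "H \<in> L2 M" "\<And>S. S \<in> chaos_index \<Longrightarrow> chaos_coef M v H S = ?c S"
      using riesz_fischer[of ?c] by blast
    have PL2: "\<forall>\<^sub>F A in ?net. P A \<in> L2 M"
      by (rule eventually_finite_subsets_at_top_weakI) (rule P(1))
    have "((\<lambda>A. \<integral>w. (P A w - H w)\<^sup>2 \<partial>M) \<longlongrightarrow> 0) ?net"
    proof (rule L2_tendsto_dominated[OF PL2 H(1)])
      have "\<bar>chaos_coef M v (P A) S - ?c S\<bar> \<le> \<bar>?c S\<bar>"
        if A: "finite A" "A \<subseteq> offdiag r" and S: "S \<in> chaos_index" for A S
      proof -
        let ?E = "{xs \<in> permutations_of_set S. length xs = r \<and> map fst xs \<in> A}"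
        have fin: "finite S" by (rule chaos_index_finite[OF S])
        show ?thesis
        proof (cases "card S = r")
          case True
          have "card ?E \<le> card (permutations_of_set S)"
            by (rule card_mono[OF finite_permutations_of_set]) blast
          then have "card ?E \<le> fact r" using fin True by simp
          then have "real (card ?E) \<le> real (fact r)" by (simp only: of_nat_le_iff)
          then have "real (card ?E) \<le> fact r" by (simp only: of_nat_fact)
          then have "\<bar>(real (card ?E) - fact r) * a S\<bar> \<le> fact r * \<bar>a S\<bar>"
            unfolding abs_mult by (intro mult_right_mono) auto
          then show ?thesis using P(2)[OF A S] True by (simp add: left_diff_distrib abs_mult)
        next
          case False
          have "?E = {}"
          proof (rule equals0I)
            fix xs assume "xs \<in> ?E"
            with False show False using length_finite_permutations_of_set[of xs S] by simp
          qed
          then show ?thesis using P(2)[OF A S] False by simp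
        qed
      qed
      then show "\<forall>\<^sub>F A in ?net. \<forall>S\<in>chaos_index. \<bar>chaos_coef M v (P A) S - chaos_coef M v H S\<bar> \<le> \<bar>chaos_coef M v H S\<bar>"
        using H(2) by (intro eventually_finite_subsets_at_top_weakI) simp
      fix S :: "(nat \<times> 'd) set" assume S: "S \<in> chaos_index"
      \<comment> \<open>Once \<open>A\<close> contains the times of all enumerations of \<open>S\<close>, the coefficient at \<open>S\<close> no longer changes.\<close>
      define A0 where "A0 = map fst ` {xs \<in> permutations_of_set S. length xs = r}"
      have A0: "finite A0" unfolding A0_def
        by (intro finite_imageI finite_subset[OF _ finite_permutations_of_set[of S]]) blast
      have A0': "A0 \<subseteq> offdiag r"
        using S distinct_map_fst_if_index by (auto simp: A0_def offdiag_def permutations_of_set_def)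
      have "chaos_coef M v (P A) S = chaos_coef M v H S" if A: "finite A" "A0 \<subseteq> A" "A \<subseteq> offdiag r" for A
      proof -
        have E: "{xs \<in> permutations_of_set S. length xs = r \<and> map fst xs \<in> A} = {xs \<in> permutations_of_set S. length xs = r}"
          using A(2) unfolding A0_def by blast
        also have "\<dots> = (if card S = r then permutations_of_set S else {})"
        proof (cases "card S = r")
          case True
          then show ?thesis using length_finite_permutations_of_set[of _ S] by auto
        next
          case False
          have "{xs \<in> permutations_of_set S. length xs = r} = {}"
          proof (rule equals0I)
            fix xs assume "xs \<in> {xs \<in> permutations_of_set S. length xs = r}"
            with False show False using length_finite_permutations_of_set[of xs S] by simp
          qed
          with False show ?thesis by simp
        qed
        finally show ?thesis
          using P(2)[OF A(1,3) S] H(2)[OF S] chaos_index_finite[OF S] by (simp only: E) simp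
      qed
      then show "\<forall>\<^sub>F A in ?net. chaos_coef M v (P A) S = chaos_coef M v H S"
        unfolding eventually_finite_subsets_at_top using A0 A0' by blast
    qed
    then have "L2_tendsto M P H ?net" using L2_tendsto_iff[OF PL2 H(1)] by simp
    then have ex: "\<exists>F. F \<in> L2 M \<and> L2_tendsto M P F ?net" using H(1) by blast
    have "mult_int M v r f = (SOME F. F \<in> L2 M \<and> L2_tendsto M P F ?net)"
      using False by (simp add: mult_int_def P_def[abs_def])
    then have F: "mult_int M v r f \<in> L2 M" "L2_tendsto M P (mult_int M v r f) ?net"
      using someI_ex[OF ex] by simp_all
    have lim_coef: "((\<lambda>A. chaos_coef M v (P A) S) \<longlongrightarrow> chaos_coef M v G S) ?net"
      if "G \<in> L2 M" "L2_tendsto M P G ?net" "S \<in> chaos_index" for G S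
      by (rule chaos_coef_tendsto[OF PL2 that(1,3) that(2)[unfolded L2_tendsto_iff[OF PL2 that(1)]]])
    have "chaos_coef M v (mult_int M v r f) S = ?c S" if S: "S \<in> chaos_index" for S
      using tendsto_unique[OF finite_subsets_at_top_neq_bot
          lim_coef[OF F S] lim_coef[OF H(1) \<open>L2_tendsto M P H ?net\<close> S]]
        H(2)[OF S] by simp
    then show ?thesis using F(1) by blast
  qed
  then show "mult_int M v r f \<in> L2 M"
    and "S \<in> chaos_index \<Longrightarrow> chaos_coef M v (mult_int M v r f) S = ?c S" by auto
qed

end

section \<open>Gradient, conditional expectation and semigroup on chaos coefficients\<close>

context obtuse_random_walk begin

lemma chaos_sum_coef:
  assumes f: "\<And>r. represents r (f r) (a r)"
  shows "chaos_sum M v n f \<in> L2 M"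
    and "S \<in> chaos_index \<Longrightarrow>
      chaos_coef M v (chaos_sum M v n f) S = (if card S \<le> n then fact (card S) * a (card S) S else 0)"
proof -
  have eq: "chaos_sum M v n f = (\<lambda>w. \<Sum>r\<le>n. mult_int M v r (f r) w)" by (simp add: chaos_sum_def fun_eq_iff)
  show "chaos_sum M v n f \<in> L2 M" unfolding eq by (intro L2_sum mult_int_coef(1)[OF f])
  assume S: "S \<in> chaos_index"
  have "chaos_coef M v (chaos_sum M v n f) S = (\<Sum>r\<le>n. chaos_coef M v (mult_int M v r (f r)) S)"
    unfolding eq by (intro chaos_coef_sum mult_int_coef(1)[OF f] S)
  also have "\<dots> = (\<Sum>r\<le>n. if card S = r then fact r * a r S else 0)"
    by (intro sum.cong refl mult_int_coef(2)[OF f S])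
  also have "\<dots> = (if card S \<le> n then fact (card S) * a (card S) S else 0)" by (simp add: sum.delta')
  finally show "chaos_coef M v (chaos_sum M v n f) S = (if card S \<le> n then fact (card S) * a (card S) S else 0)" .
qed

lemma sum_from_1: "(\<Sum>r=1..n. g r) = (\<Sum>r<n. g (Suc r))" for g :: "nat \<Rightarrow> real"
  by (subst sum.reindex_bij_witness[where i=Suc and j="\<lambda>r. r - 1" and T="{..<n}"]) auto

text \<open>On finite chaos sums, and then by continuity on all of \<open>L\<^sup>2\<close>, the gradient \<open>D\<^sub>k\<^sup>j\<close> annihilates
  the monomials without the factor \<open>Y\<^sub>k\<^sup>j\<close> and removes this factor from all others.
  The factor \<open>r\<close> in its definition turns \<open>(r - 1)!\<close> into the \<open>r!\<close> of the multiple integral of order \<open>r\<close>.\<close>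

lemma grad_chaos_sum_coef:
  assumes f: "\<And>r. represents r (f r) (a r)"
  shows "grad_chaos_sum M v k j n f \<in> L2 M"
    and "T \<in> chaos_index \<Longrightarrow> chaos_coef M v (grad_chaos_sum M v k j n f) T =
      (if k \<in> fst ` T then 0 else chaos_coef M v (chaos_sum M v n f) (insert (k, j) T))"
proof -
  have eq: "grad_chaos_sum M v k j n f = (\<lambda>w. \<Sum>r<n. real (Suc r) * mult_int M v r (grad_kernel k j (f (Suc r))) w)"
    by (simp only: grad_chaos_sum_def fun_eq_iff sum_from_1) simp
  note G = mult_int_coef[OF represents_grad_kernel[OF f]]
  show "grad_chaos_sum M v k j n f \<in> L2 M" unfolding eq by (intro L2_sum L2_cmult G(1))
  assume T: "T \<in> chaos_index"
  have "chaos_coef M v (grad_chaos_sum M v k j n f) T =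
      (\<Sum>r<n. chaos_coef M v (\<lambda>w. real (Suc r) * mult_int M v r (grad_kernel k j (f (Suc r))) w) T)"
    unfolding eq by (intro chaos_coef_sum L2_cmult G(1) T)
  also have "\<dots> = (\<Sum>r<n. if r = card T then (if k \<in> fst ` T then 0 else fact (Suc r) * a (Suc r) (insert (k, j) T)) else 0)"
    by (intro sum.cong refl) (auto simp add: chaos_coef_cmult G(2)[OF T])
  also have "\<dots> = (if card T < n then (if k \<in> fst ` T then 0 else fact (Suc (card T)) * a (Suc (card T)) (insert (k, j) T)) else 0)"
    by (simp add: sum.delta)
  also have "\<dots> = (if k \<in> fst ` T then 0 else chaos_coef M v (chaos_sum M v n f) (insert (k, j) T))"
  proof (cases "k \<in> fst ` T")
    case False
    then have "(k, j) \<notin> T" by force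
    then have "card (insert (k, j) T) = Suc (card T)" by (simp add: chaos_index_finite[OF T])
    then show ?thesis using False T by (simp add: chaos_sum_coef[OF f] chaos_index_insert Suc_le_eq)
  qed simp
  finally show "chaos_coef M v (grad_chaos_sum M v k j n f) T =
      (if k \<in> fst ` T then 0 else chaos_coef M v (chaos_sum M v n f) (insert (k, j) T))" .
qed

lemma sym_kernels_represents_all:
  fixes f :: "nat \<Rightarrow> 'd list \<Rightarrow> nat list \<Rightarrow> real"
  assumes "\<And>r. f r \<in> sym_kernels r"
  shows "\<exists>a. \<forall>r. represents r (f r) (a r)"
  by (rule choice) (use sym_kernels_represents[OF assms] in blast)

text \<open>The division by \<open>r!\<close> makes up for the \<open>r!\<close> enumerations that a multiple integral sums over.\<close>

definition chaos_kernels :: "((nat \<Rightarrow> nat) \<Rightarrow> real) \<Rightarrow> nat \<Rightarrow> 'd list \<Rightarrow> nat list \<Rightarrow> real" where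
  "chaos_kernels F r = kernel_of (\<lambda>S. chaos_coef M v F S / fact r)"

lemma chaos_kernels:
  assumes F: "F \<in> L2 M"
  shows "chaos_kernels F r \<in> sym_kernels r" "represents r (chaos_kernels F r) (\<lambda>S. chaos_coef M v F S / fact r)"
proof -
  have "(\<lambda>S. (chaos_coef M v F S)\<^sup>2 * (1 / fact r)\<^sup>2) summable_on chaos_index"
    by (intro summable_on_cmult_left chaos_coef_square_summable F)
  then have "(\<lambda>S. (chaos_coef M v F S / fact r)\<^sup>2) summable_on chaos_index"
    by (simp add: power_divide)
  then show "chaos_kernels F r \<in> sym_kernels r" "represents r (chaos_kernels F r) (\<lambda>S. chaos_coef M v F S / fact r)"
    unfolding chaos_kernels_def by (auto intro: kernel_of_sym_kernels represents_kernel_of)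
qed

lemma chaos_sum_kernels:
  assumes F: "F \<in> L2 M"
  shows "chaos_sum M v n (chaos_kernels F) \<in> L2 M"
    and "S \<in> chaos_index \<Longrightarrow>
      chaos_coef M v (chaos_sum M v n (chaos_kernels F)) S = (if card S \<le> n then chaos_coef M v F S else 0)"
  using chaos_sum_coef[OF chaos_kernels(2)[OF F]] by simp_all

text \<open>Truncation at order \<open>n\<close> keeps the coefficients of the multi-indices of size at most \<open>n\<close> and deletes the
  others, so the truncated sums converge by domination.\<close>

theorem chaos_representation:
  assumes F: "F \<in> L2 M"
  shows "chaos_expansion M v (chaos_kernels F) F"
proof -
  have "(\<lambda>n. \<integral>w. (chaos_sum M v n (chaos_kernels F) w - F w)\<^sup>2 \<partial>M) \<longlonglongrightarrow> 0"
  proof (rule L2_tendsto_dominated[OF _ F])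
    fix S :: "(nat \<times> 'd) set" assume S: "S \<in> chaos_index"
    show "\<forall>\<^sub>F n in sequentially. chaos_coef M v (chaos_sum M v n (chaos_kernels F)) S = chaos_coef M v F S"
      using eventually_ge_at_top[of "card S"] by eventually_elim (simp add: chaos_sum_kernels F S)
  qed (simp_all add: chaos_sum_kernels F)
  then have "L2_tendsto M (\<lambda>n. chaos_sum M v n (chaos_kernels F)) F sequentially"
    by (subst L2_tendsto_iff[OF _ F]) (simp_all add: chaos_sum_kernels(1)[OF F])
  then show ?thesis unfolding chaos_expansion_def using chaos_kernels(1)[OF F] by blast
qed

text \<open>On coefficients the gradient is the shift \<open>a \<mapsto> (T \<mapsto> a(T \<union> {(k, j)}))\<close> along an injective map, hence a
  contraction. The limit thus exists for every approximating sequence, and the approximation by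
  truncated chaos expansions determines it.\<close>

theorem grad_comp_coef:
  assumes F: "F \<in> L2 M"
  shows "grad_comp M v k j F \<in> L2 M"
    and "T \<in> chaos_index \<Longrightarrow>
      chaos_coef M v (grad_comp M v k j F) T = (if k \<in> fst ` T then 0 else chaos_coef M v F (insert (k, j) T))"
proof -
  let ?c = "\<lambda>a T. if k \<in> fst ` T then 0 else a (insert (k, j) T)"
  let ?A = "{T \<in> chaos_index. k \<notin> fst ` T}"
  have inj: "inj_on (insert (k, j)) ?A"
    by (rule inj_onI) (simp add: chaos_index_insert_eq)
  have sub: "insert (k, j) ` ?A \<subseteq> chaos_index" by (auto simp: chaos_index_insert)
  have shift_summable: "(\<lambda>T. (?c a T)\<^sup>2) summable_on chaos_index"
    and shift_le: "infsum (\<lambda>T. (?c a T)\<^sup>2) chaos_index \<le> infsum (\<lambda>S. (a S)\<^sup>2) chaos_index"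
    if a: "(\<lambda>S. (a S)\<^sup>2) summable_on chaos_index" for a :: "(nat \<times> 'd) set \<Rightarrow> real"
  proof -
    have s: "(\<lambda>S. (a S)\<^sup>2) summable_on insert (k, j) ` ?A" by (rule summable_on_subset[OF a sub])
    have eq: "((\<lambda>S. (a S)\<^sup>2) \<circ> insert (k, j)) T = (?c a T)\<^sup>2" if "T \<in> ?A" for T using that by simp
    have "(\<lambda>T. (?c a T)\<^sup>2) summable_on chaos_index \<longleftrightarrow> ((\<lambda>S. (a S)\<^sup>2) \<circ> insert (k, j)) summable_on ?A"
      by (rule summable_on_cong_neutral) auto
    then show "(\<lambda>T. (?c a T)\<^sup>2) summable_on chaos_index"
      using s summable_on_reindex[OF inj, of "\<lambda>S. (a S)\<^sup>2"] by simp
    have "infsum (\<lambda>T. (?c a T)\<^sup>2) chaos_index = infsum ((\<lambda>S. (a S)\<^sup>2) \<circ> insert (k, j)) ?A"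
      by (rule infsum_cong_neutral) auto
    also have "\<dots> = infsum (\<lambda>S. (a S)\<^sup>2) (insert (k, j) ` ?A)" by (rule infsum_reindex[OF inj, symmetric])
    also have "\<dots> \<le> infsum (\<lambda>S. (a S)\<^sup>2) chaos_index" by (rule infsum_mono2[OF s a sub]) simp
    finally show "infsum (\<lambda>T. (?c a T)\<^sup>2) chaos_index \<le> infsum (\<lambda>S. (a S)\<^sup>2) chaos_index" .
  qed
  obtain H where H: "H \<in> L2 M" "\<And>T. T \<in> chaos_index \<Longrightarrow> chaos_coef M v H T = ?c (chaos_coef M v F) T"
    using riesz_fischer[OF shift_summable[OF chaos_coef_square_summable[OF F]]] by blast
  have H_lim: "L2_tendsto M (\<lambda>m. grad_chaos_sum M v k j (n m) (f m)) H sequentially"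
    if f: "\<forall>m r. f m r \<in> sym_kernels r" and lim: "L2_tendsto M (\<lambda>m. chaos_sum M v (n m) (f m)) F sequentially" for n f
  proof -
    have "\<forall>m. \<exists>a. \<forall>r. represents r (f m r) (a r)"
      by (intro allI sym_kernels_represents_all) (use f in blast)
    then have "\<exists>a. \<forall>m. \<forall>r. represents r (f m r) (a m r)" by (rule choice)
    then obtain a where a: "\<And>m r. represents r (f m r) (a m r)" by blast
    note C = chaos_sum_coef[OF a] and D = grad_chaos_sum_coef[OF a]
    have le: "(\<integral>w. (grad_chaos_sum M v k j (n m) (f m) w - H w)\<^sup>2 \<partial>M) \<le> (\<integral>w. (chaos_sum M v (n m) (f m) w - F w)\<^sup>2 \<partial>M)" for m
    proof -
      let ?d = "\<lambda>S. chaos_coef M v (chaos_sum M v (n m) (f m)) S - chaos_coef M v F S"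
      have P: "((\<lambda>S. (?d S)\<^sup>2) has_sum (\<integral>w. (chaos_sum M v (n m) (f m) w - F w)\<^sup>2 \<partial>M)) chaos_index"
        by (rule parseval_dist[OF C(1) F])
      have "(\<integral>w. (grad_chaos_sum M v k j (n m) (f m) w - H w)\<^sup>2 \<partial>M) =
          infsum (\<lambda>T. (chaos_coef M v (grad_chaos_sum M v k j (n m) (f m)) T - chaos_coef M v H T)\<^sup>2) chaos_index"
        by (rule infsumI[OF parseval_dist[OF D(1) H(1)], symmetric])
      also have "\<dots> = infsum (\<lambda>T. (?c ?d T)\<^sup>2) chaos_index"
        by (intro infsum_cong) (simp add: D(2) H(2))
      also have "\<dots> \<le> infsum (\<lambda>S. (?d S)\<^sup>2) chaos_index"
        by (rule shift_le[OF has_sum_imp_summable[OF P]])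
      also have "\<dots> = (\<integral>w. (chaos_sum M v (n m) (f m) w - F w)\<^sup>2 \<partial>M)" by (rule infsumI[OF P])
      finally show ?thesis .
    qed
    have to_0: "(\<lambda>m. \<integral>w. (chaos_sum M v (n m) (f m) w - F w)\<^sup>2 \<partial>M) \<longlonglongrightarrow> 0"
      using lim by (subst (asm) L2_tendsto_iff[OF _ F]) (simp_all add: C(1))
    have "(\<lambda>m. \<integral>w. (grad_chaos_sum M v k j (n m) (f m) w - H w)\<^sup>2 \<partial>M) \<longlonglongrightarrow> 0"
      by (rule tendsto_sandwich[OF _ _ tendsto_const to_0]) (simp_all add: le)
    then show ?thesis
      by (subst L2_tendsto_iff[OF _ H(1)]) (simp_all add: D(1))
  qed
  let ?Q = "\<lambda>H. H \<in> L2 M \<and> (\<forall>n f. (\<forall>m r. f m r \<in> sym_kernels r) \<and>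
        L2_tendsto M (\<lambda>m. chaos_sum M v (n m) (f m)) F sequentially \<longrightarrow>
        L2_tendsto M (\<lambda>m. grad_chaos_sum M v k j (n m) (f m)) H sequentially)"
  have "?Q H" using H(1) H_lim by blast
  then have Q: "?Q (grad_comp M v k j F)" unfolding grad_comp_def by (rule someI[of ?Q])
  then show L: "grad_comp M v k j F \<in> L2 M" by blast
  assume T: "T \<in> chaos_index"
  have approx: "\<forall>m r. chaos_kernels F r \<in> sym_kernels r" "L2_tendsto M (\<lambda>m. chaos_sum M v m (chaos_kernels F)) F sequentially"
    using chaos_representation[OF F] unfolding chaos_expansion_def by blast+
  note D = grad_chaos_sum_coef[OF chaos_kernels(2)[OF F]]
  have lim: "(\<lambda>m. chaos_coef M v (grad_chaos_sum M v k j m (chaos_kernels F)) T) \<longlonglongrightarrow> chaos_coef M v G T"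
    if G: "G \<in> L2 M" "L2_tendsto M (\<lambda>m. grad_chaos_sum M v k j m (chaos_kernels F)) G sequentially" for G
  proof (rule chaos_coef_tendsto[OF _ G(1) T])
    show ev: "\<forall>\<^sub>F m in sequentially. grad_chaos_sum M v k j m (chaos_kernels F) \<in> L2 M" by (simp add: D(1))
    show "(\<lambda>m. \<integral>w. (grad_chaos_sum M v k j m (chaos_kernels F) w - G w)\<^sup>2 \<partial>M) \<longlonglongrightarrow> 0"
      using G(2) unfolding L2_tendsto_iff[OF ev G(1)] .
  qed
  have "chaos_coef M v (grad_comp M v k j F) T = chaos_coef M v H T"
  proof (rule LIMSEQ_unique[OF lim[OF L] lim[OF H(1)]])
    show "L2_tendsto M (\<lambda>m. grad_chaos_sum M v k j m (chaos_kernels F)) (grad_comp M v k j F) sequentially"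
      using conjunct2[OF Q, THEN spec[where x="\<lambda>m. m"], THEN spec[where x="\<lambda>_. chaos_kernels F"]] approx by blast
    show "L2_tendsto M (\<lambda>m. grad_chaos_sum M v k j m (chaos_kernels F)) H sequentially"
      by (rule H_lim) (use approx in blast)+
  qed
  then show "chaos_coef M v (grad_comp M v k j F) T = ?c (chaos_coef M v F) T" using H(2)[OF T] by simp
qed

text \<open>The conditional expectation given the past keeps the monomials in past times and kills all others,
  because the last factor of the latter is centred given everything before it.\<close>

theorem cond_exp_coef:
  assumes H: "H \<in> L2 M"
  shows "real_cond_exp M (past M k) H \<in> L2 M"
    and "(\<integral>w. (real_cond_exp M (past M k) H w)\<^sup>2 \<partial>M) \<le> (\<integral>w. (H w)\<^sup>2 \<partial>M)"
    and "T \<in> chaos_index \<Longrightarrow> chaos_coef M v (real_cond_exp M (past M k) H) T =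
      (if fst ` T \<subseteq> {..<k} then chaos_coef M v H T else 0)"
proof -
  interpret P: sigma_finite_subalgebra M "past M k" by (rule past_finite_subalgebra)
  have past: "real_cond_exp M (past M k) H \<in> borel_measurable (past M k)" by (rule borel_measurable_cond_exp)
  show L: "real_cond_exp M (past M k) H \<in> L2 M" by (rule past_L2[OF past])
  have coef: "chaos_coef M v (real_cond_exp M (past M k) H) T =
      (if fst ` T \<subseteq> {..<k} then chaos_coef M v H T else 0)" if T: "T \<in> chaos_index" for T
  proof (cases "fst ` T \<subseteq> {..<k}")
    case True
    have e: "walk_monomial v T \<in> borel_measurable (past M k)" by (rule walk_monomial_past[OF True])
    have "(\<integral>w. walk_monomial v T w * real_cond_exp M (past M k) H w \<partial>M) = (\<integral>w. walk_monomial v T w * H w \<partial>M)"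
      by (intro P.real_cond_exp_intg e L2_integrable_mult walk_monomial_L2 T H L2_measurable)
    then show ?thesis using True by (simp add: chaos_coef_def mult.commute)
  next
    case False
    define m where "m = Max (fst ` T)"
    have fin: "finite (fst ` T)" "fst ` T \<noteq> {}" using False chaos_index_finite[OF T] by auto
    have m_in: "m \<in> fst ` T" and m_max: "\<And>i. i \<in> fst ` T \<Longrightarrow> i \<le> m"
      using fin by (auto simp: m_def)
    obtain i where "i \<in> fst ` T" "\<not> i < k" using False by auto
    then have "k \<le> m" using m_max[of i] by simp
    have "fst ` T \<subseteq> {..<Suc m}"
    proof
      fix i assume "i \<in> fst ` T"
      from m_max[OF this] show "i \<in> {..<Suc m}" by simp
    qed
    then obtain j T' where T': "T = insert (m, j) T'" "T' \<in> chaos_index" "fst ` T' \<subseteq> {..<m}" "m \<notin> fst ` T'"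
      by (rule chaos_index_cases[OF T]) (use m_in in auto)
    have "(\<lambda>w. real_cond_exp M (past M k) H w * walk_monomial v T' w) \<in> borel_measurable (past M m)"
      by (intro borel_measurable_times past_mono[OF past \<open>k \<le> m\<close>] walk_monomial_past T')
    from integral_past_mult_walk[OF this, of j] \<open>k \<le> m\<close> show ?thesis
      by (simp add: chaos_coef_def T'(1) walk_monomial_insert[OF T'(2,4)] mult_ac)
  qed
  then show "T \<in> chaos_index \<Longrightarrow> chaos_coef M v (real_cond_exp M (past M k) H) T =
      (if fst ` T \<subseteq> {..<k} then chaos_coef M v H T else 0)" .
  show "(\<integral>w. (real_cond_exp M (past M k) H w)\<^sup>2 \<partial>M) \<le> (\<integral>w. (H w)\<^sup>2 \<partial>M)"
    by (rule has_sum_mono[OF parseval[OF L] parseval[OF H]]) (simp add: coef)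
qed

lemma L2_abs_integral_le:
  assumes "F \<in> L2 M" shows "(\<integral>w. \<bar>F w\<bar> \<partial>M) \<le> (1 + (\<integral>w. (F w)\<^sup>2 \<partial>M)) / 2"
  using integral_abs_mult_le[OF L2_const[of 1] assms] by (simp add: prob_space)

text \<open>A jointly measurable version of the semigroup: for \<open>t > 0\<close> the chaos series with the weights
  \<open>e\<^sup>-\<^sup>n\<^sup>t\<close> converges absolutely outside a null set that does not depend on \<open>t\<close>.\<close>

lemma OU_version_exists:
  assumes F: "F \<in> L2 M"
  shows "\<exists>u. (\<lambda>(t, w). u t w) \<in> borel_measurable (borel \<Otimes>\<^sub>M M) \<and>
     (\<exists>f. chaos_expansion M v f F \<and>
        (\<forall>t\<ge>0. u t \<in> L2 M \<and>
           L2_tendsto M (\<lambda>N w. \<Sum>n\<le>N. exp (- (real n * t)) * mult_int M v n (f n) w) (u t) sequentially))"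
proof -
  define J where "J n = mult_int M v n (chaos_kernels F n)" for n
  have J: "J n \<in> L2 M" for n unfolding J_def by (rule mult_int_coef[OF chaos_kernels(2)[OF F]])
  have J_coef: "chaos_coef M v (J n) S = (if card S = n then chaos_coef M v F S else 0)" if "S \<in> chaos_index" for S n
    unfolding J_def using mult_int_coef(2)[OF chaos_kernels(2)[OF F] that] by simp
  have J_le: "(\<integral>w. (J n w)\<^sup>2 \<partial>M) \<le> (\<integral>w. (F w)\<^sup>2 \<partial>M)" for n
    by (rule has_sum_mono[OF parseval[OF J] parseval[OF F]]) (simp add: J_coef)
  define B where "B = (1 + (\<integral>w. (F w)\<^sup>2 \<partial>M)) / 2"
  have J_abs: "(\<integral>w. \<bar>J n w\<bar> \<partial>M) \<le> B" for n
    using L2_abs_integral_le[OF J[of n]] J_le[of n] by (simp add: B_def)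
  \<comment> \<open>At \<open>t = 0\<close> the series need not converge almost surely, but \<open>P\<^sub>0 F = F\<close>.\<close>
  define u where "u t w = (if t = 0 then F w else (\<Sum>n. exp (- (real n * t)) * J n w))" for t w
  have [measurable]: "J n \<in> borel_measurable M" for n by (rule L2_measurable[OF J])
  have Fm [measurable]: "F \<in> borel_measurable M" by (rule L2_measurable[OF F])
  have "(\<lambda>p. u (fst p) (snd p)) \<in> borel_measurable (borel \<Otimes>\<^sub>M M)"
    unfolding u_def by measurable
  then have meas: "(\<lambda>(t, w). u t w) \<in> borel_measurable (borel \<Otimes>\<^sub>M M)"
    by (simp add: case_prod_beta')
  \<comment> \<open>The terms decrease in \<open>t\<close>, so countably many times \<open>t \<rightarrow> 0\<close> give one null set for all \<open>t > 0\<close>.\<close>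
  have "AE w in M. \<forall>m. summable (\<lambda>n. \<bar>exp (- (real n * (1 / real (Suc m)))) * J n w\<bar>)"
    unfolding AE_all_countable
  proof
    fix m
    let ?t = "1 / real (Suc m)"
    have geo: "exp (- (real n * ?t)) = exp (- ?t) ^ n" for n by (simp add: exp_of_nat_mult[symmetric])
    show "AE w in M. summable (\<lambda>n. \<bar>exp (- (real n * ?t)) * J n w\<bar>)"
    proof (rule integral_suminf_AE_summable)
      show "integrable M (\<lambda>w. exp (- (real n * ?t)) * J n w)" for n
        by (intro integrable_mult_right L2_integrable J)
      have "summable (\<lambda>n. exp (- ?t) ^ n * B)"
        by (intro summable_mult2 summable_geometric) simp
      then show "summable (\<lambda>n. \<integral>w. \<bar>exp (- (real n * ?t)) * J n w\<bar> \<partial>M)"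
      proof (rule summable_comparison_test'[where N=0])
        fix n
        have "(\<integral>w. \<bar>exp (- (real n * ?t)) * J n w\<bar> \<partial>M) = exp (- ?t) ^ n * (\<integral>w. \<bar>J n w\<bar> \<partial>M)"
          unfolding geo abs_mult by simp
        also have "\<dots> \<le> exp (- ?t) ^ n * B" by (intro mult_left_mono J_abs) simp
        finally show "norm (\<integral>w. \<bar>exp (- (real n * ?t)) * J n w\<bar> \<partial>M) \<le> exp (- ?t) ^ n * B" by simp
      qed
    qed
  qed
  then have AE_sums: "AE w in M. \<forall>t>0. (\<lambda>n. exp (- (real n * t)) * J n w) sums u t w"
  proof eventually_elim
    case (elim w)
    show ?case
    proof (intro allI impI)
      fix t :: real assume t: "t > 0"
      then obtain m where m: "1 / real (Suc m) < t" using nat_approx_posE by blast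
      have "summable (\<lambda>n. exp (- (real n * t)) * J n w)"
      proof (rule summable_comparison_test'[OF elim[rule_format, of m], where N=0])
        fix n
        have "real n * (1 / real (Suc m)) \<le> real n * t" using m by (intro mult_left_mono) simp_all
        then show "norm (exp (- (real n * t)) * J n w) \<le> \<bar>exp (- (real n * (1 / real (Suc m)))) * J n w\<bar>"
          unfolding real_norm_def abs_mult by (intro mult_right_mono) simp_all
      qed
      then show "(\<lambda>n. exp (- (real n * t)) * J n w) sums u t w"
        using t by (simp add: u_def summable_sums)
    qed
  qed
  define s where "s t N w = (\<Sum>n\<le>N. exp (- (real n * t)) * J n w)" for t N w
  have s: "s t N \<in> L2 M" for t N unfolding s_def by (intro L2_sum L2_cmult J)
  have s_coef: "chaos_coef M v (s t N) S = (if card S \<le> N then exp (- (real (card S) * t)) * chaos_coef M v F S else 0)"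
    if S: "S \<in> chaos_index" for t N S
  proof -
    have "chaos_coef M v (s t N) S = (\<Sum>n\<le>N. chaos_coef M v (\<lambda>w. exp (- (real n * t)) * J n w) S)"
      unfolding s_def by (intro chaos_coef_sum L2_cmult J S)
    also have "\<dots> = (\<Sum>n\<le>N. if card S = n then exp (- (real n * t)) * chaos_coef M v F S else 0)"
      by (intro sum.cong refl) (simp add: chaos_coef_cmult J_coef S)
    also have "\<dots> = (if card S \<le> N then exp (- (real (card S) * t)) * chaos_coef M v F S else 0)"
      by (simp add: sum.delta')
    finally show ?thesis .
  qed
  have conv: "u t \<in> L2 M \<and> (\<lambda>N. \<integral>w. (s t N w - u t w)\<^sup>2 \<partial>M) \<longlonglongrightarrow> 0" if t: "t \<ge> 0" for t
  proof -
    let ?c = "\<lambda>S. exp (- (real (card S) * t)) * chaos_coef M v F S"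
    have "(?c S)\<^sup>2 \<le> (chaos_coef M v F S)\<^sup>2" for S
    proof -
      have "(exp (- (real (card S) * t)))\<^sup>2 \<le> 1" using t by (simp add: power_le_one)
      then show ?thesis unfolding power_mult_distrib by (intro mult_left_le_one_le) simp_all
    qed
    then have "(\<lambda>S. (?c S)\<^sup>2) summable_on chaos_index"
      by (intro summable_on_comparison_test[OF chaos_coef_square_summable[OF F]]) simp_all
    then obtain H where H: "H \<in> L2 M" "\<And>S. S \<in> chaos_index \<Longrightarrow> chaos_coef M v H S = ?c S"
      using riesz_fischer[of ?c] by blast
    have lim: "(\<lambda>N. \<integral>w. (s t N w - H w)\<^sup>2 \<partial>M) \<longlonglongrightarrow> 0"
    proof (rule L2_tendsto_dominated[OF _ H(1)])
      fix S :: "(nat \<times> 'd) set" assume S: "S \<in> chaos_index"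
      show "\<forall>\<^sub>F N in sequentially. chaos_coef M v (s t N) S = chaos_coef M v H S"
        using eventually_ge_at_top[of "card S"] by eventually_elim (simp add: s_coef H(2) S)
    qed (simp_all add: s s_coef H(2))
    show ?thesis
    proof (cases "t = 0")
      case True
      have u0: "u 0 = F" by (simp add: u_def fun_eq_iff)
      have HF: "AE w in M. H w = F w"
        by (rule AE_eq_if_chaos_coef_eq[OF H(1) F]) (simp add: H(2) True)
      have "(\<integral>w. (s t N w - H w)\<^sup>2 \<partial>M) = (\<integral>w. (s t N w - F w)\<^sup>2 \<partial>M)" for N
      proof (rule integral_cong_AE)
        show "AE w in M. (s t N w - H w)\<^sup>2 = (s t N w - F w)\<^sup>2" using HF by eventually_elim simp
      qed (use L2_integrable_square[OF L2_diff[OF s H(1)]] L2_integrable_square[OF L2_diff[OF s F]] in auto)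
      with lim F show ?thesis by (simp add: True u0)
    next
      case False
      with t have "t > 0" by simp
      have um: "u t \<in> borel_measurable M" unfolding u_def by measurable
      have pt: "AE w in M. (\<lambda>N. s t N w) \<longlonglongrightarrow> u t w"
        using AE_sums by eventually_elim (use \<open>t > 0\<close> in \<open>simp add: sums_def_le s_def\<close>)
      have Cauchy: "\<exists>N. \<forall>m\<ge>N. \<forall>n\<ge>N. (\<integral>w. (s t m w - s t n w)\<^sup>2 \<partial>M) < e" if e: "e > 0" for e
      proof -
        obtain N where N: "\<And>n. n \<ge> N \<Longrightarrow> norm ((\<integral>w. (s t n w - H w)\<^sup>2 \<partial>M) - 0) < e / 4"
          using LIMSEQ_D[OF lim, of "e / 4"] e by auto
        have "(\<integral>w. (s t m w - s t n w)\<^sup>2 \<partial>M) < e" if mn: "m \<ge> N" "n \<ge> N" for m n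
        proof -
          have "(\<integral>w. (s t m w - s t n w)\<^sup>2 \<partial>M) = (\<integral>w. ((s t m w - H w) + (H w - s t n w))\<^sup>2 \<partial>M)" by simp
          also have "\<dots> \<le> 2 * (\<integral>w. (s t m w - H w)\<^sup>2 \<partial>M) + 2 * (\<integral>w. (H w - s t n w)\<^sup>2 \<partial>M)"
            by (intro integral_square_add_le L2_diff s H(1))
          also have "(\<integral>w. (H w - s t n w)\<^sup>2 \<partial>M) = (\<integral>w. (s t n w - H w)\<^sup>2 \<partial>M)" by (simp add: power2_commute)
          finally show ?thesis using N[OF mn(1)] N[OF mn(2)] by simp
        qed
        then show ?thesis by blast
      qed
      show ?thesis using L2_Cauchy_AE_limit[OF s um pt Cauchy] by blast
    qed
  qed
  have "u t \<in> L2 M \<and> L2_tendsto M (\<lambda>N w. \<Sum>n\<le>N. exp (- (real n * t)) * mult_int M v n (chaos_kernels F n) w) (u t) sequentially"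
    if t: "t \<ge> 0" for t
  proof -
    have "L2_tendsto M (s t) (u t) sequentially"
      using L2_tendsto_iff[of "s t" M sequentially "u t"] conv[OF t] s by simp
    then show ?thesis using conv[OF t] by (simp add: s_def[abs_def] J_def)
  qed
  then show ?thesis using meas chaos_representation[OF F] by blast
qed

text \<open>Every chaos expansion of \<open>F\<close> has the coefficients of \<open>F\<close>, so the choice among expansions and among
  jointly measurable versions leaves the coefficients of \<open>P\<^sub>t F\<close> unaffected.\<close>

theorem OU_coef:
  assumes F: "F \<in> L2 M"
  shows "(\<lambda>(t, w). OU M v t F w) \<in> borel_measurable (borel \<Otimes>\<^sub>M M)"
    and "t \<ge> 0 \<Longrightarrow> OU M v t F \<in> L2 M"
    and "t \<ge> 0 \<Longrightarrow> S \<in> chaos_index \<Longrightarrow>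
      chaos_coef M v (OU M v t F) S = exp (- (real (card S) * t)) * chaos_coef M v F S"
proof -
  let ?Q = "\<lambda>u. (\<lambda>(t, w). u t w) \<in> borel_measurable (borel \<Otimes>\<^sub>M M) \<and>
     (\<exists>f. chaos_expansion M v f F \<and>
        (\<forall>t\<ge>0. u t \<in> L2 M \<and>
           L2_tendsto M (\<lambda>N w. \<Sum>n\<le>N. exp (- (real n * t)) * mult_int M v n (f n) w) (u t) sequentially))"
  define u where "u = (SOME u. ?Q u)"
  have Q: "?Q u" unfolding u_def by (rule someI_ex[OF OU_version_exists[OF F]])
  have OU: "OU M v t F = u t" for t by (simp add: OU_def u_def)
  show "(\<lambda>(t, w). OU M v t F w) \<in> borel_measurable (borel \<Otimes>\<^sub>M M)" using Q by (simp add: OU)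
  obtain f where f: "chaos_expansion M v f F" and u: "\<And>t. t \<ge> 0 \<Longrightarrow> u t \<in> L2 M"
    "\<And>t. t \<ge> 0 \<Longrightarrow> L2_tendsto M (\<lambda>N w. \<Sum>n\<le>N. exp (- (real n * t)) * mult_int M v n (f n) w) (u t) sequentially"
    using Q by blast
  then show "t \<ge> 0 \<Longrightarrow> OU M v t F \<in> L2 M" by (simp add: OU)
  have fsym: "f r \<in> sym_kernels r" for r using f unfolding chaos_expansion_def by blast
  obtain a where a: "\<And>r. represents r (f r) (a r)" using sym_kernels_represents_all[OF fsym] by blast
  assume t: "t \<ge> 0" and S: "S \<in> chaos_index"
  have ev: "\<forall>\<^sub>F n in sequentially. chaos_sum M v n f \<in> L2 M" by (simp add: chaos_sum_coef(1)[OF a])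
  have "(\<lambda>n. chaos_coef M v (chaos_sum M v n f) S) \<longlonglongrightarrow> chaos_coef M v F S"
    by (rule chaos_coef_tendsto[OF ev F S])
      (use f in \<open>simp add: chaos_expansion_def L2_tendsto_iff[OF ev F]\<close>)
  moreover have "\<forall>\<^sub>F n in sequentially. chaos_coef M v (chaos_sum M v n f) S = fact (card S) * a (card S) S"
    using eventually_ge_at_top[of "card S"] by eventually_elim (simp add: chaos_sum_coef(2)[OF a S])
  ultimately have FS: "chaos_coef M v F S = fact (card S) * a (card S) S"
    by (metis LIMSEQ_unique tendsto_eventually)
  define s where "s N w = (\<Sum>n\<le>N. exp (- (real n * t)) * mult_int M v n (f n) w)" for N w
  have s: "s N \<in> L2 M" for N unfolding s_def by (intro L2_sum L2_cmult mult_int_coef(1)[OF a])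
  then have ev: "\<forall>\<^sub>F N in sequentially. s N \<in> L2 M" by simp
  have s_coef: "chaos_coef M v (s N) S = (if card S \<le> N then exp (- (real (card S) * t)) * chaos_coef M v F S else 0)" for N
  proof -
    have "chaos_coef M v (s N) S = (\<Sum>n\<le>N. chaos_coef M v (\<lambda>w. exp (- (real n * t)) * mult_int M v n (f n) w) S)"
      unfolding s_def by (intro chaos_coef_sum L2_cmult mult_int_coef(1)[OF a] S)
    also have "\<dots> = (\<Sum>n\<le>N. if card S = n then exp (- (real n * t)) * chaos_coef M v F S else 0)"
      by (intro sum.cong refl) (auto simp add: chaos_coef_cmult mult_int_coef(2)[OF a S] FS)
    also have "\<dots> = (if card S \<le> N then exp (- (real (card S) * t)) * chaos_coef M v F S else 0)"
      by (simp add: sum.delta')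
    finally show ?thesis .
  qed
  have "L2_tendsto M s (u t) sequentially" unfolding s_def[abs_def] by (rule u(2)[OF t])
  then have "(\<lambda>N. chaos_coef M v (s N) S) \<longlonglongrightarrow> chaos_coef M v (u t) S"
    by (intro chaos_coef_tendsto[OF ev u(1)[OF t] S]) (simp add: L2_tendsto_iff[OF ev u(1)[OF t]])
  moreover have "\<forall>\<^sub>F N in sequentially. chaos_coef M v (s N) S = exp (- (real (card S) * t)) * chaos_coef M v F S"
    using eventually_ge_at_top[of "card S"] by eventually_elim (simp add: s_coef)
  ultimately show "chaos_coef M v (OU M v t F) S = exp (- (real (card S) * t)) * chaos_coef M v F S"
    unfolding OU by (metis LIMSEQ_unique tendsto_eventually)
qed

end

section \<open>Summation over multi-indices\<close>

text \<open>Every nonempty multi-index arises exactly once from its last pair and the pairs before it.\<close>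

lemma sums_last_pair:
  fixes p :: "(nat \<times> 'd::finite) set \<Rightarrow> real"
  assumes p: "(p has_sum c) (chaos_index - {{}})"
    and b: "\<And>k j. ((\<lambda>T. if fst ` T \<subseteq> {..<k} then p (insert (k, j) T) else 0) has_sum b k j) chaos_index"
  shows "(\<lambda>k. \<Sum>j\<in>UNIV. b k j) sums c"
proof -
  let ?B = "\<lambda>x :: nat \<times> 'd. {T :: (nat \<times> 'd) set. T \<in> chaos_index \<and> fst ` T \<subseteq> {..<fst x}}"
  have notin: "k \<notin> fst ` T" if "fst ` T \<subseteq> {..<k}" for k and T :: "(nat \<times> 'd) set" using that by auto
  have inj: "inj_on (\<lambda>(x, T). insert x T) (Sigma UNIV ?B)"
  proof (rule inj_onI)
    fix x y assume x: "x \<in> Sigma UNIV ?B" and y: "y \<in> Sigma UNIV ?B"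
      and eq: "(case x of (x, T) \<Rightarrow> insert x T) = (case y of (x, T) \<Rightarrow> insert x T)"
    obtain k j T k' j' T' where xy: "x = ((k, j), T)" "y = ((k', j'), T')" by (metis surj_pair)
    have T: "fst ` T \<subseteq> {..<k}" "fst ` T' \<subseteq> {..<k'}" using x y xy by auto
    from eq have eq: "insert (k, j) T = insert (k', j') T'" by (simp add: xy)
    then have "fst ` insert (k, j) T = fst ` insert (k', j') T'" by simp
    then have fst_eq: "insert k (fst ` T) = insert k' (fst ` T')" by simp
    have "k = k'"
    proof (rule ccontr)
      assume ne: "k \<noteq> k'"
      from fst_eq have "k \<in> insert k' (fst ` T')" "k' \<in> insert k (fst ` T)" by blast+
      with ne have "k \<in> fst ` T'" "k' \<in> fst ` T" by simp_all
      with T have "k < k'" "k' < k" by blast+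
      then show False by simp
    qed
    then show "x = y" using chaos_index_insert_eq[OF notin[OF T(1)], of T' j j'] notin[OF T(2)] eq xy by simp
  qed
  have "(\<lambda>(x, T). insert x T) ` Sigma UNIV ?B = chaos_index - {{}}"
  proof (intro equalityI subsetI)
    fix S assume "S \<in> (\<lambda>(x, T). insert x T) ` Sigma UNIV ?B"
    then obtain k j T where "S = insert (k, j) T" "T \<in> chaos_index" "fst ` T \<subseteq> {..<k}" by force
    then show "S \<in> chaos_index - {{}}" using chaos_index_insert[OF notin] by simp
  next
    fix S :: "(nat \<times> 'd) set" assume S: "S \<in> chaos_index - {{}}"
    define k where "k = Max (fst ` S)"
    have fin: "finite (fst ` S)" "fst ` S \<noteq> {}" using S chaos_index_finite by auto
    have "k \<in> fst ` S" unfolding k_def by (rule Max_in[OF fin])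
    moreover have sub: "fst ` S \<subseteq> {..<Suc k}"
    proof
      fix i assume "i \<in> fst ` S"
      from Max_ge[OF fin(1) this] show "i \<in> {..<Suc k}" by (simp add: k_def)
    qed
    ultimately obtain j T where T: "S = insert (k, j) T" "T \<in> chaos_index" "fst ` T \<subseteq> {..<k}"
      using S by (elim DiffE chaos_index_cases[OF _ sub]) auto
    then show "S \<in> (\<lambda>(x, T). insert x T) ` Sigma UNIV ?B"
      by (intro image_eqI[of _ _ "((k, j), T)"]) auto
  qed
  with inj have bij: "bij_betw (\<lambda>(x, T). insert x T) (Sigma UNIV ?B) (chaos_index - {{}})"
    by (simp add: bij_betw_def)
  have "((\<lambda>x. p (case x of (x, T) \<Rightarrow> insert x T)) has_sum c) (Sigma UNIV ?B)"
    using p by (subst has_sum_reindex_bij_betw[OF bij])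
  then have "((\<lambda>x. case x of (k, j) \<Rightarrow> b k j) has_sum c) UNIV"
  proof (rule has_sum_SigmaD)
    fix x :: "nat \<times> 'd"
    obtain k j where x: "x = (k, j)" by (cases x)
    have "((\<lambda>T. p (insert (k, j) T)) has_sum b k j) {T \<in> chaos_index. fst ` T \<subseteq> {..<k}}
       \<longleftrightarrow> ((\<lambda>T. if fst ` T \<subseteq> {..<k} then p (insert (k, j) T) else 0) has_sum b k j) chaos_index"
      by (rule has_sum_cong_neutral) auto
    then show "((\<lambda>T. p (case (x, T) of (x, T) \<Rightarrow> insert x T)) has_sum (case x of (k, j) \<Rightarrow> b k j)) (?B x)"
      using b[of k j] by (simp add: x)
  qed
  then have "((\<lambda>(k, j). b k j) has_sum c) (Sigma UNIV (\<lambda>_. UNIV))" by simp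
  then have "((\<lambda>k. \<Sum>j\<in>UNIV. b k j) has_sum c) UNIV"
    by (rule has_sum_SigmaD) (auto intro: has_sum_finiteI)
  then show ?thesis by (rule has_sum_imp_sums)
qed

text \<open>Removing any one of its pairs from a multi-index \<open>S\<close> gives \<open>|S|\<close> representations, which the
  weights \<open>1 / |S|\<close> compensate.\<close>

lemma sums_any_pair:
  fixes p :: "(nat \<times> 'd::finite) set \<Rightarrow> real"
  assumes p: "(p has_sum c) (chaos_index - {{}})"
    and b: "\<And>k j. ((\<lambda>T. if k \<in> fst ` T then 0 else p (insert (k, j) T) / real (Suc (card T))) has_sum b k j) chaos_index"
  shows "(\<lambda>k. \<Sum>j\<in>UNIV. b k j) sums c"
proof -
  let ?I = "chaos_index - {{}} :: (nat \<times> 'd) set set"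
  let ?B = "\<lambda>x :: nat \<times> 'd. {T :: (nat \<times> 'd) set. T \<in> chaos_index \<and> fst x \<notin> fst ` T}"
  have const: "((\<lambda>_. q S / real (card S)) has_sum q S) S" if "S \<in> ?I" for q :: "(nat \<times> 'd) set \<Rightarrow> real" and S
    using that chaos_index_finite[of S] by (intro has_sum_finiteI) auto
  have "(\<lambda>S. \<bar>p S\<bar>) summable_on ?I"
    using has_sum_imp_summable[OF p] summable_on_iff_abs_summable_on_real[of p ?I] by simp
  then have "(\<lambda>(S, x). \<bar>p S\<bar> / real (card S)) summable_on Sigma ?I (\<lambda>S. S)"
    by (intro summable_on_SigmaI[where g="\<lambda>S. \<bar>p S\<bar>"]) (use const[of _ "\<lambda>S. \<bar>p S\<bar>"] in auto)
  then have "(\<lambda>(S, x). p S / real (card S)) summable_on Sigma ?I (\<lambda>S. S)"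
    by (subst summable_on_iff_abs_summable_on_real) (simp add: case_prod_beta')
  then have total: "((\<lambda>(S, x). p S / real (card S)) has_sum c) (Sigma ?I (\<lambda>S. S))"
    by (intro has_sum_SigmaI[OF _ p]) (use const[of _ p] in auto)
  have "((\<lambda>(x, T). p (insert x T) / real (Suc (card T))) has_sum c) (Sigma UNIV ?B) \<longleftrightarrow>
      ((\<lambda>(S, x). p S / real (card S)) has_sum c) (Sigma ?I (\<lambda>S. S))"
  proof (rule has_sum_reindex_bij_witness[where i="\<lambda>(S, x). (x, S - {x})" and j="\<lambda>(x, T). (insert x T, x)"])
    fix a assume "a \<in> Sigma UNIV ?B"
    then obtain k j T where a: "a = ((k, j), T)" "T \<in> chaos_index" "k \<notin> fst ` T" by auto
    have notin: "(k, j) \<notin> T"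
    proof
      assume "(k, j) \<in> T"
      then have "fst (k, j) \<in> fst ` T" by (rule imageI)
      with a(3) show False by simp
    qed
    then show "(case case a of (x, T) \<Rightarrow> (insert x T, x) of (S, x) \<Rightarrow> (x, S - {x})) = a" by (simp add: a(1))
    show "(case a of (x, T) \<Rightarrow> (insert x T, x)) \<in> Sigma ?I (\<lambda>S. S)"
      using a chaos_index_insert[OF a(3)] by simp
    show "(case case a of (x, T) \<Rightarrow> (insert x T, x) of (S, x) \<Rightarrow> p S / real (card S)) =
        (case a of (x, T) \<Rightarrow> p (insert x T) / real (Suc (card T)))"
      using notin chaos_index_finite[OF a(2)] by (simp add: a(1))
  next
    fix y assume "y \<in> Sigma ?I (\<lambda>S. S)"
    then obtain S k j where y: "y = (S, (k, j))" "S \<in> chaos_index" "(k, j) \<in> S" by auto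
    show "(case case y of (S, x) \<Rightarrow> (x, S - {x}) of (x, T) \<Rightarrow> (insert x T, x)) = y"
      using chaos_index_remove(3)[OF y(2,3)] by (simp add: y(1))
    show "(case y of (S, x) \<Rightarrow> (x, S - {x})) \<in> Sigma UNIV ?B"
      using chaos_index_remove(1,2)[OF y(2,3)] by (simp add: y(1))
  qed simp
  with total have "((\<lambda>(x, T). p (insert x T) / real (Suc (card T))) has_sum c) (Sigma UNIV ?B)" by simp
  then have "((\<lambda>x. case x of (k, j) \<Rightarrow> b k j) has_sum c) UNIV"
  proof (rule has_sum_SigmaD)
    fix x :: "nat \<times> 'd"
    obtain k j where x: "x = (k, j)" by (cases x)
    have "((\<lambda>T. p (insert (k, j) T) / real (Suc (card T))) has_sum b k j) {T \<in> chaos_index. k \<notin> fst ` T}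
       \<longleftrightarrow> ((\<lambda>T. if k \<in> fst ` T then 0 else p (insert (k, j) T) / real (Suc (card T))) has_sum b k j) chaos_index"
      by (rule has_sum_cong_neutral) auto
    then show "((\<lambda>T. case (x, T) of (x, T) \<Rightarrow> p (insert x T) / real (Suc (card T))) has_sum (case x of (k, j) \<Rightarrow> b k j)) (?B x)"
      using b[of k j] by (simp add: x)
  qed
  then have "((\<lambda>(k, j). b k j) has_sum c) (Sigma UNIV (\<lambda>_. UNIV))" by simp
  then have "((\<lambda>k. \<Sum>j\<in>UNIV. b k j) has_sum c) UNIV"
    by (rule has_sum_SigmaD) (auto intro: has_sum_finiteI)
  then show ?thesis by (rule has_sum_imp_sums)
qed

lemma infinite_chaos_index: "infinite (chaos_index :: (nat \<times> 'd::finite) set set)"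
proof
  assume "finite (chaos_index :: (nat \<times> 'd) set set)"
  moreover have "range (\<lambda>n. {(n, undefined)}) \<subseteq> (chaos_index :: (nat \<times> 'd) set set)"
    by (auto simp: chaos_index_def)
  ultimately have "finite (range (\<lambda>n :: nat. {(n, undefined :: 'd)}))" by (rule finite_subset[rotated])
  moreover have "inj (\<lambda>n :: nat. {(n, undefined :: 'd)})" by (rule injI) simp
  ultimately show False using finite_imageD by fastforce
qed

lemma exp_half_line:
  assumes "l > 0"
  shows "has_bochner_integral lborel (\<lambda>t. indicator {0..} t * exp (- (l * t))) (1 / l :: real)"
proof -
  interpret E: prob_space "density lborel (exponential_density l)"
    by (rule prob_space_exponential_density[OF assms])
  have "(\<integral>\<^sup>+t. ennreal (exponential_density l t) \<partial>lborel) = 1"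
    using E.emeasure_space_1 by (simp add: emeasure_density)
  then have "has_bochner_integral lborel (exponential_density l) 1"
    by (intro has_bochner_integral_nn_integral) (auto simp: exponential_density_nonneg[OF assms])
  then have "has_bochner_integral lborel (\<lambda>t. 1 / l * exponential_density l t) (1 / l * 1)"
    by (rule has_bochner_integral_mult_right)
  moreover have "1 / l * exponential_density l t = indicator {0..} t * exp (- (l * t))" for t
    using assms by (auto simp: exponential_density_def indicator_def mult.commute)
  ultimately show ?thesis by simp
qed

section \<open>The time integral of the semigroup\<close>

context obtuse_random_walk begin

lemma OU_contraction:
  assumes B: "B \<in> L2 M" and t: "t \<ge> 0"
  shows "(\<integral>w. (OU M v t B w)\<^sup>2 \<partial>M) \<le> (\<integral>w. (B w)\<^sup>2 \<partial>M)"
proof (rule has_sum_mono[OF parseval[OF OU_coef(2)[OF B t]] parseval[OF B]])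
  fix S :: "(nat \<times> 'd) set" assume S: "S \<in> chaos_index"
  have "(exp (- (real (card S) * t)))\<^sup>2 \<le> 1" using t by (simp add: power_le_one)
  then show "(chaos_coef M v (OU M v t B) S)\<^sup>2 \<le> (chaos_coef M v B S)\<^sup>2"
    unfolding OU_coef(3)[OF B t S] power_mult_distrib by (intro mult_left_le_one_le) simp_all
qed

lemma OU_integrand_measurable:
  assumes A: "A \<in> L2 M" and B: "B \<in> L2 M"
  shows "(\<lambda>(t, w). indicator {0..} t * (exp (- t) * (A w * OU M v t B w))) \<in> borel_measurable (lborel \<Otimes>\<^sub>M M)"
proof -
  have [measurable]: "A \<in> borel_measurable M" by (rule L2_measurable[OF A])
  have sets_eq: "sets (lborel \<Otimes>\<^sub>M M) = sets (borel \<Otimes>\<^sub>M M)" by (rule sets_pair_measure_cong) simp_all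
  have [measurable]: "(\<lambda>p. OU M v (fst p) B (snd p)) \<in> borel_measurable (lborel \<Otimes>\<^sub>M M)"
    using OU_coef(1)[OF B] unfolding measurable_cong_sets[OF sets_eq refl] case_prod_beta' .
  show ?thesis unfolding case_prod_beta' by measurable
qed

text \<open>For fixed \<open>t\<close> Parseval's identity gives \<open>E[A P\<^sub>t B] = \<Sum>\<^sub>T e\<^sup>-\<^sup>t\<^sup>|\<^sup>T\<^sup>| A\<^sub>T B\<^sub>T\<close>, and integration against \<open>e\<^sup>-\<^sup>t dt\<close>
  yields the weights \<open>1 / (|T| + 1)\<close>. Fubini's theorem applies since \<open>E \<bar>A P\<^sub>t B\<bar>\<close> is bounded in \<open>t\<close>.\<close>

lemma OU_time_integral:
  assumes A: "A \<in> L2 M" and B: "B \<in> L2 M"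
  defines "h \<equiv> \<lambda>w. LINT t:{0..}|lborel. exp (- t) * (A w * OU M v t B w)"
  shows "AE w in M. set_integrable lborel {0..} (\<lambda>t. exp (- t) * (A w * OU M v t B w))"
    and "integrable M h"
    and "(\<integral>w. \<bar>h w\<bar> \<partial>M) \<le> ((\<integral>w. (A w)\<^sup>2 \<partial>M) + (\<integral>w. (B w)\<^sup>2 \<partial>M)) / 2"
    and "((\<lambda>T. chaos_coef M v A T * chaos_coef M v B T / real (Suc (card T))) has_sum (\<integral>w. h w \<partial>M)) chaos_index"
proof -
  define K where "K t w = indicator {0..} t * (exp (- t) * (A w * OU M v t B w))" for t :: real and w
  define C where "C = ((\<integral>w. (A w)\<^sup>2 \<partial>M) + (\<integral>w. (B w)\<^sup>2 \<partial>M)) / 2"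
  interpret Q: pair_sigma_finite lborel M ..
  have K_meas: "case_prod K \<in> borel_measurable (lborel \<Otimes>\<^sub>M M)"
    unfolding K_def by (rule OU_integrand_measurable[OF A B])
  have AU: "(\<integral>w. \<bar>A w * OU M v t B w\<bar> \<partial>M) \<le> C" if t: "t \<ge> 0" for t
    using integral_abs_mult_le[OF A OU_coef(2)[OF B t]] OU_contraction[OF B t] by (simp add: C_def)
  have K_int: "integrable M (K t)" for t
  proof (cases "t \<ge> 0")
    case True
    then show ?thesis
      unfolding K_def[abs_def] by (intro integrable_mult_right L2_integrable_mult[OF A OU_coef(2)[OF B True]])
  next
    case False
    then have "K t = (\<lambda>w. 0)" by (simp add: K_def fun_eq_iff)
    then show ?thesis by simp
  qed
  have K_abs: "(\<integral>w. norm (K t w) \<partial>M) \<le> indicator {0..} t * exp (- (1 * t)) * C" for t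
  proof (cases "t \<ge> 0")
    case True
    have "(\<integral>w. norm (K t w) \<partial>M) = exp (- t) * (\<integral>w. \<bar>A w * OU M v t B w\<bar> \<partial>M)"
      using True by (simp add: K_def abs_mult)
    also have "\<dots> \<le> exp (- t) * C" by (intro mult_left_mono AU True) simp
    finally show ?thesis using True by simp
  qed (simp add: K_def)
  have bound: "has_bochner_integral lborel (\<lambda>t. indicator {0..} t * exp (- (1 * t)) * C) (1 / 1 * C)"
    by (intro has_bochner_integral_mult_left exp_half_line) simp
  have norm_meas: "(\<lambda>t. \<integral>w. norm (K t w) \<partial>M) \<in> borel_measurable lborel"
    using K_meas by measurable
  have norm_int: "integrable lborel (\<lambda>t. \<integral>w. norm (K t w) \<partial>M)"
  proof (rule Bochner_Integration.integrable_bound[OF _ norm_meas])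
    show "integrable lborel (\<lambda>t. indicator {0..} t * exp (- (1 * t)) * C)"
      using bound by (simp add: has_bochner_integral_iff)
    show "AE t in lborel. norm (\<integral>w. norm (K t w) \<partial>M) \<le> norm (indicator {0..} t * exp (- (1 * t)) * C)"
    proof (rule AE_I2)
      fix t
      have "norm (\<integral>w. norm (K t w) \<partial>M) = (\<integral>w. norm (K t w) \<partial>M)" by simp
      also have "\<dots> \<le> norm (indicator {0..} t * exp (- (1 * t)) * C)"
        using K_abs[of t] unfolding real_norm_def by linarith
      finally show "norm (\<integral>w. norm (K t w) \<partial>M) \<le> norm (indicator {0..} t * exp (- (1 * t)) * C)" .
    qed
  qed
  have K: "integrable (lborel \<Otimes>\<^sub>M M) (case_prod K)"
    by (rule Q.Fubini_integrable[OF K_meas]) (simp_all add: norm_int[unfolded real_norm_def] K_int)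
  have nK: "integrable (lborel \<Otimes>\<^sub>M M) (case_prod (\<lambda>t w. norm (K t w)))"
    using integrable_norm[OF K] by (simp add: case_prod_beta')
  have h: "h w = (\<integral>t. K t w \<partial>lborel)" for w
    by (simp add: h_def K_def set_lebesgue_integral_def)
  show "AE w in M. set_integrable lborel {0..} (\<lambda>t. exp (- t) * (A w * OU M v t B w))"
    using Q.AE_integrable_snd[OF K] by (simp add: set_integrable_def K_def)
  show h_int: "integrable M h" unfolding h using Q.integrable_snd[OF K] .
  have "(\<integral>w. \<bar>h w\<bar> \<partial>M) \<le> (\<integral>w. (\<integral>t. norm (K t w) \<partial>lborel) \<partial>M)"
    unfolding h
    by (rule integral_mono[OF integrable_abs[OF Q.integrable_snd[OF K]] Q.integrable_snd[OF nK]])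
      (use integral_norm_bound in \<open>simp add: real_norm_def[symmetric] del: real_norm_def\<close>)
  also have "\<dots> = (\<integral>t. (\<integral>w. norm (K t w) \<partial>M) \<partial>lborel)" by (rule Q.Fubini_integral[OF nK])
  also have "\<dots> \<le> (\<integral>t. indicator {0..} t * exp (- (1 * t)) * C \<partial>lborel)"
    by (rule integral_mono[OF norm_int _ K_abs]) (use bound in \<open>simp add: has_bochner_integral_iff\<close>)
  also have "\<dots> = C" using has_bochner_integral_integral_eq[OF bound] by simp
  finally show "(\<integral>w. \<bar>h w\<bar> \<partial>M) \<le> ((\<integral>w. (A w)\<^sup>2 \<partial>M) + (\<integral>w. (B w)\<^sup>2 \<partial>M)) / 2" by (simp add: C_def)

  \<comment> \<open>An enumeration of the multi-indices turns the sum over them into a series that can be integrated termwise.\<close>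
  define e where "e = from_nat_into (chaos_index :: (nat \<times> 'd) set set)"
  have e: "bij_betw e UNIV chaos_index"
    unfolding e_def by (rule bij_betw_from_nat_into[OF countable_chaos_index infinite_chaos_index])
  have e_in: "e n \<in> chaos_index" for n using bij_betwE[OF e] by blast
  define c where "c n = chaos_coef M v A (e n) * chaos_coef M v B (e n)" for n
  have "(\<lambda>T. norm (chaos_coef M v A T * chaos_coef M v B T)) summable_on chaos_index"
    by (rule iffD1[OF summable_on_iff_abs_summable_on_real has_sum_imp_summable[OF parseval_mult[OF A B]]])
  then have "(\<lambda>n. \<bar>c n\<bar>) summable_on UNIV"
    using summable_on_reindex_bij_betw[OF e, of "\<lambda>T. norm (chaos_coef M v A T * chaos_coef M v B T)"]
    by (simp add: c_def)
  then have c_summable: "summable (\<lambda>n. \<bar>c n\<bar>)" by (rule summable_on_imp_summable)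
  let ?l = "\<lambda>n. real (Suc (card (e n)))"
  define f where "f n t = indicator {0..} t * exp (- (?l n * t)) * c n" for n and t :: real
  have f: "has_bochner_integral lborel (f n) (1 / ?l n * c n)" for n
    unfolding f_def by (intro has_bochner_integral_mult_left exp_half_line) simp
  have f_abs: "has_bochner_integral lborel (\<lambda>t. norm (f n t)) (1 / ?l n * \<bar>c n\<bar>)" for n
    using has_bochner_integral_mult_left[OF exp_half_line[of "?l n"], of "\<bar>c n\<bar>"]
    by (simp add: f_def abs_mult)
  have weight: "\<bar>1 / ?l n * c n\<bar> \<le> \<bar>c n\<bar>" for n
    unfolding abs_mult by (rule mult_left_le_one_le) simp_all
  have K_sums: "(\<lambda>n. f n t) sums (\<integral>w. K t w \<partial>M)" for t
  proof (cases "t \<ge> 0")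
    case True
    have "((\<lambda>T. chaos_coef M v A T * chaos_coef M v (OU M v t B) T) has_sum (\<integral>w. A w * OU M v t B w \<partial>M)) chaos_index"
      by (rule parseval_mult[OF A OU_coef(2)[OF B True]])
    then have "((\<lambda>n. chaos_coef M v A (e n) * chaos_coef M v (OU M v t B) (e n)) has_sum (\<integral>w. A w * OU M v t B w \<partial>M)) UNIV"
      by (subst has_sum_reindex_bij_betw[OF e])
    then have "(\<lambda>n. exp (- t) * (chaos_coef M v A (e n) * chaos_coef M v (OU M v t B) (e n))) sums (exp (- t) * (\<integral>w. A w * OU M v t B w \<partial>M))"
      by (intro sums_mult has_sum_imp_sums)
    moreover have "exp (- t) * (chaos_coef M v A (e n) * chaos_coef M v (OU M v t B) (e n)) = f n t" for n
    proof -
      have "exp (- (?l n * t)) = exp (- t) * exp (- (real (card (e n)) * t))"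
        by (simp add: exp_add[symmetric] algebra_simps)
      then show ?thesis using True by (simp add: f_def c_def OU_coef(3)[OF B True e_in])
    qed
    moreover have "(\<integral>w. K t w \<partial>M) = exp (- t) * (\<integral>w. A w * OU M v t B w \<partial>M)"
      using True by (simp add: K_def)
    ultimately show ?thesis by simp
  qed (simp add: f_def K_def)
  have "(\<lambda>n. integral\<^sup>L lborel (f n)) sums (\<integral>t. (\<Sum>n. f n t) \<partial>lborel)"
  proof (rule sums_integral)
    show "integrable lborel (f n)" for n using f by (simp add: has_bochner_integral_iff)
    show "AE t in lborel. summable (\<lambda>n. norm (f n t))"
    proof (rule AE_I2)
      fix t :: real
      show "summable (\<lambda>n. norm (f n t))"
      proof (rule summable_comparison_test'[OF c_summable, where N=0])
        fix n
        have "\<bar>indicator {0..} t * exp (- (?l n * t))\<bar> \<le> 1"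
          by (cases "t \<ge> 0") simp_all
        then have "\<bar>indicator {0..} t * exp (- (?l n * t))\<bar> * \<bar>c n\<bar> \<le> \<bar>c n\<bar>"
          by (intro mult_left_le_one_le) simp_all
        moreover have "norm (norm (f n t)) = \<bar>indicator {0..} t * exp (- (?l n * t))\<bar> * \<bar>c n\<bar>"
          unfolding f_def by (simp only: norm_mult real_norm_def abs_mult abs_abs)
        ultimately show "norm (norm (f n t)) \<le> \<bar>c n\<bar>" by simp
      qed
    qed
    show "summable (\<lambda>n. \<integral>t. norm (f n t) \<partial>lborel)"
      unfolding has_bochner_integral_integral_eq[OF f_abs]
      by (rule summable_comparison_test'[OF c_summable, where N=0]) (use weight in \<open>simp add: abs_mult\<close>)
  qed
  moreover have "(\<integral>t. (\<Sum>n. f n t) \<partial>lborel) = (\<integral>w. h w \<partial>M)"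
    unfolding h using Q.Fubini_integral[OF K] by (simp add: sums_unique[OF K_sums, symmetric])
  ultimately have "(\<lambda>n. 1 / ?l n * c n) sums (\<integral>w. h w \<partial>M)"
    unfolding has_bochner_integral_integral_eq[OF f] by simp
  moreover have "summable (\<lambda>n. norm (1 / ?l n * c n))"
    by (rule summable_comparison_test'[OF c_summable, where N=0]) (use weight in simp)
  ultimately have "((\<lambda>n. 1 / ?l n * c n) has_sum (\<integral>w. h w \<partial>M)) UNIV"
    by (intro norm_summable_imp_has_sum)
  then have "((\<lambda>n. (\<lambda>T. chaos_coef M v A T * chaos_coef M v B T / real (Suc (card T))) (e n)) has_sum (\<integral>w. h w \<partial>M)) UNIV"
    by (simp add: c_def)
  then show "((\<lambda>T. chaos_coef M v A T * chaos_coef M v B T / real (Suc (card T))) has_sum (\<integral>w. h w \<partial>M)) chaos_index"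
    by (subst (asm) has_sum_reindex_bij_betw[OF e])
qed

section \<open>The covariance identities\<close>

text \<open>The monomial of the empty multi-index is \<open>1\<close>, so removing its term subtracts \<open>E[F] E[G]\<close>.\<close>

lemma cov_has_sum:
  assumes F: "F \<in> L2 M" and G: "G \<in> L2 M"
  shows "((\<lambda>S. chaos_coef M v F S * chaos_coef M v G S) has_sum cov M F G) (chaos_index - {{}})"
proof -
  let ?p = "\<lambda>S. chaos_coef M v F S * chaos_coef M v G S"
  have "(?p has_sum (\<integral>w. F w * G w \<partial>M)) chaos_index" by (rule parseval_mult[OF F G])
  moreover have "((\<lambda>S. if S \<in> {{}} then ?p S else 0) has_sum ?p {}) chaos_index"
    by (rule has_sum_finite_neutralI[where B="{{}}"]) auto
  ultimately have "((\<lambda>S. ?p S + - (if S \<in> {{}} then ?p S else 0)) has_sum ((\<integral>w. F w * G w \<partial>M) + - ?p {})) chaos_index"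
    by (intro has_sum_add has_sum_uminusI)
  moreover have "(\<integral>w. F w * G w \<partial>M) + - ?p {} = cov M F G"
    by (simp add: cov_def chaos_coef_def)
  moreover have "((\<lambda>S. ?p S + - (if S \<in> {{}} then ?p S else 0)) has_sum c) chaos_index \<longleftrightarrow> (?p has_sum c) (chaos_index - {{}})" for c
    by (rule has_sum_cong_neutral) auto
  ultimately show ?thesis by simp
qed

lemma Dom_grad_summable:
  assumes "F \<in> Dom_grad M v"
  shows "F \<in> L2 M" "summable (\<lambda>k. \<Sum>j\<in>UNIV. \<integral>w. (grad_comp M v k j F w)\<^sup>2 \<partial>M)"
proof -
  show F: "F \<in> L2 M" using assms by (simp add: Dom_grad_def)
  have L2: "grad_comp M v k j F \<in> L2 M" for k j by (rule grad_comp_coef(1)[OF F])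
  have sq: "(norm (grad M v k F w))\<^sup>2 = (\<Sum>j\<in>UNIV. (grad_comp M v k j F w)\<^sup>2)" for k w
    by (simp only: power2_norm_eq_inner) (simp add: inner_vec_def grad_def power2_eq_square)
  have int: "integrable M (\<lambda>w. \<Sum>j\<in>UNIV. (grad_comp M v k j F w)\<^sup>2)" for k
    by (intro Bochner_Integration.integrable_sum L2_integrable_square L2)
  have [measurable]: "(\<lambda>w. \<Sum>j\<in>UNIV. (grad_comp M v k j F w)\<^sup>2) \<in> borel_measurable M" for k
    using int by auto
  have "(\<integral>\<^sup>+w. (\<Sum>k. ennreal ((norm (grad M v k F w))\<^sup>2)) \<partial>M) =
      (\<Sum>k. \<integral>\<^sup>+w. ennreal (\<Sum>j\<in>UNIV. (grad_comp M v k j F w)\<^sup>2) \<partial>M)"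
    unfolding sq by (rule nn_integral_suminf) measurable
  also have "\<dots> = (\<Sum>k. ennreal (\<integral>w. (\<Sum>j\<in>UNIV. (grad_comp M v k j F w)\<^sup>2) \<partial>M))"
    by (intro suminf_cong nn_integral_eq_integral int AE_I2 sum_nonneg) simp
  also have "\<dots> = (\<Sum>k. ennreal (\<Sum>j\<in>UNIV. \<integral>w. (grad_comp M v k j F w)\<^sup>2 \<partial>M))"
    by (simp add: L2_integrable_square[OF L2])
  finally have "(\<Sum>k. ennreal (\<Sum>j\<in>UNIV. \<integral>w. (grad_comp M v k j F w)\<^sup>2 \<partial>M)) \<noteq> top"
    using assms by (auto simp: Dom_grad_def infinity_ennreal_def)
  then show "summable (\<lambda>k. \<Sum>j\<in>UNIV. \<integral>w. (grad_comp M v k j F w)\<^sup>2 \<partial>M)"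
    by (intro summable_suminf_not_top) (simp_all add: sum_nonneg)
qed

lemma Dom_grad_bound_summable:
  assumes F: "F \<in> Dom_grad M v" and G: "G \<in> Dom_grad M v"
  shows "summable (\<lambda>k. \<Sum>j\<in>UNIV. ((\<integral>w. (grad_comp M v k j F w)\<^sup>2 \<partial>M) + (\<integral>w. (grad_comp M v k j G w)\<^sup>2 \<partial>M)) / 2)"
  unfolding sum_divide_distrib[symmetric] sum.distrib
  by (rule summable_divide[OF summable_add[OF Dom_grad_summable(2)[OF F] Dom_grad_summable(2)[OF G]]])

end

lemma integral_suminf_sums:
  fixes g :: "nat \<Rightarrow> 'a \<Rightarrow> real"
  assumes g: "\<And>k. integrable M (g k)" and le: "\<And>k. (\<integral>w. \<bar>g k w\<bar> \<partial>M) \<le> b k" and b: "summable b"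
    and c: "(\<lambda>k. \<integral>w. g k w \<partial>M) sums c"
  shows "(AE w in M. summable (\<lambda>k. g k w)) \<and> integrable M (\<lambda>w. \<Sum>k. g k w) \<and> c = (\<integral>w. (\<Sum>k. g k w) \<partial>M)"
proof -
  have s: "summable (\<lambda>k. \<integral>w. \<bar>g k w\<bar> \<partial>M)"
    by (rule summable_comparison_test'[OF b, where N=0]) (use le in simp)
  have AE: "AE w in M. summable (\<lambda>k. \<bar>g k w\<bar>)" by (rule integral_suminf_AE_summable[OF g s])
  then have AE_g: "AE w in M. summable (\<lambda>k. g k w)"
    by eventually_elim (rule summable_rabs_cancel)
  have AE_norm: "AE w in M. summable (\<lambda>k. norm (g k w))" using AE by simp
  have s_norm: "summable (\<lambda>k. \<integral>w. norm (g k w) \<partial>M)" using s by simp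
  show ?thesis
    using AE_g integrable_suminf[OF g AE_norm s_norm] sums_integral[OF g AE_norm s_norm] c sums_unique2 by blast
qed

lemma integrable_sum_abs_le:
  fixes g :: "'j \<Rightarrow> 'a \<Rightarrow> real"
  assumes g: "\<And>j. j \<in> J \<Longrightarrow> integrable M (g j)" and le: "\<And>j. j \<in> J \<Longrightarrow> (\<integral>w. \<bar>g j w\<bar> \<partial>M) \<le> b j"
  shows "(\<integral>w. \<bar>\<Sum>j\<in>J. g j w\<bar> \<partial>M) \<le> (\<Sum>j\<in>J. b j)"
proof -
  have "(\<integral>w. \<bar>\<Sum>j\<in>J. g j w\<bar> \<partial>M) \<le> (\<integral>w. (\<Sum>j\<in>J. \<bar>g j w\<bar>) \<partial>M)"
    using g by (intro integral_mono integrable_abs Bochner_Integration.integrable_sum sum_abs) auto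
  also have "\<dots> = (\<Sum>j\<in>J. \<integral>w. \<bar>g j w\<bar> \<partial>M)"
    using g by (intro Bochner_Integration.integral_sum integrable_abs) auto
  also have "\<dots> \<le> (\<Sum>j\<in>J. b j)" by (intro sum_mono le)
  finally show ?thesis .
qed

context obtuse_random_walk begin

theorem clark_ocone_covariance:
  assumes F: "F \<in> Dom_grad M v" and G: "G \<in> Dom_grad M v"
  defines "g \<equiv> \<lambda>k w. vec_cond_exp M (past M k) (grad M v k F) w \<bullet> grad M v k G w"
  shows "(AE w in M. summable (\<lambda>k. g k w)) \<and> integrable M (\<lambda>w. \<Sum>k. g k w) \<and> cov M F G = (\<integral>w. (\<Sum>k. g k w) \<partial>M)"
proof -
  note FL = Dom_grad_summable[OF F] and GL = Dom_grad_summable[OF G]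
  let ?E = "\<lambda>k j. real_cond_exp M (past M k) (grad_comp M v k j F)"
  note DF = grad_comp_coef[OF FL(1)] and DG = grad_comp_coef[OF GL(1)]
  note E = cond_exp_coef[OF DF(1)]
  have g: "g k = (\<lambda>w. \<Sum>j\<in>UNIV. ?E k j w * grad_comp M v k j G w)" for k
    by (simp add: g_def fun_eq_iff inner_vec_def vec_cond_exp_def grad_def)
  have int: "integrable M (\<lambda>w. ?E k j w * grad_comp M v k j G w)" for k j
    by (rule L2_integrable_mult[OF E(1) DG(1)])
  show ?thesis
  proof (rule integral_suminf_sums)
    show "integrable M (g k)" for k unfolding g by (intro Bochner_Integration.integrable_sum int)
    show "(\<integral>w. \<bar>g k w\<bar> \<partial>M) \<le> (\<Sum>j\<in>UNIV. ((\<integral>w. (grad_comp M v k j F w)\<^sup>2 \<partial>M) + (\<integral>w. (grad_comp M v k j G w)\<^sup>2 \<partial>M)) / 2)" for k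
      unfolding g
    proof (rule integrable_sum_abs_le[OF int])
      fix j
      have "(\<integral>w. \<bar>?E k j w * grad_comp M v k j G w\<bar> \<partial>M) \<le> ((\<integral>w. (?E k j w)\<^sup>2 \<partial>M) + (\<integral>w. (grad_comp M v k j G w)\<^sup>2 \<partial>M)) / 2"
        by (rule integral_abs_mult_le[OF E(1) DG(1)])
      also have "\<dots> \<le> ((\<integral>w. (grad_comp M v k j F w)\<^sup>2 \<partial>M) + (\<integral>w. (grad_comp M v k j G w)\<^sup>2 \<partial>M)) / 2"
        by (intro divide_right_mono add_right_mono E(2)) simp
      finally show "(\<integral>w. \<bar>?E k j w * grad_comp M v k j G w\<bar> \<partial>M) \<le> ((\<integral>w. (grad_comp M v k j F w)\<^sup>2 \<partial>M) + (\<integral>w. (grad_comp M v k j G w)\<^sup>2 \<partial>M)) / 2" .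
    qed
    show "summable (\<lambda>k. \<Sum>j\<in>UNIV. ((\<integral>w. (grad_comp M v k j F w)\<^sup>2 \<partial>M) + (\<integral>w. (grad_comp M v k j G w)\<^sup>2 \<partial>M)) / 2)"
      by (rule Dom_grad_bound_summable[OF F G])
    have "(\<lambda>k. \<Sum>j\<in>UNIV. \<integral>w. ?E k j w * grad_comp M v k j G w \<partial>M) sums cov M F G"
    proof (rule sums_last_pair[OF cov_has_sum[OF FL(1) GL(1)]])
      fix k j
      have "((\<lambda>T. chaos_coef M v (?E k j) T * chaos_coef M v (grad_comp M v k j G) T) has_sum (\<integral>w. ?E k j w * grad_comp M v k j G w \<partial>M)) chaos_index"
        by (rule parseval_mult[OF E(1) DG(1)])
      moreover have "chaos_coef M v (?E k j) T * chaos_coef M v (grad_comp M v k j G) T =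
          (if fst ` T \<subseteq> {..<k} then chaos_coef M v F (insert (k, j) T) * chaos_coef M v G (insert (k, j) T) else 0)"
        if T: "T \<in> chaos_index" for T
      proof -
        have "k \<notin> fst ` T" if "fst ` T \<subseteq> {..<k}" using that by auto
        then show ?thesis using E(3)[OF T] DF(2)[OF T] DG(2)[OF T] by simp
      qed
      ultimately show "((\<lambda>T. if fst ` T \<subseteq> {..<k} then chaos_coef M v F (insert (k, j) T) * chaos_coef M v G (insert (k, j) T) else 0)
          has_sum (\<integral>w. ?E k j w * grad_comp M v k j G w \<partial>M)) chaos_index"
        by (simp cong: has_sum_cong)
    qed
    moreover have "(\<integral>w. g k w \<partial>M) = (\<Sum>j\<in>UNIV. \<integral>w. ?E k j w * grad_comp M v k j G w \<partial>M)" for k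
      unfolding g by (rule Bochner_Integration.integral_sum[OF int])
    ultimately show "(\<lambda>k. \<integral>w. g k w \<partial>M) sums cov M F G" by simp
  qed
qed

theorem OU_covariance:
  assumes F: "F \<in> Dom_grad M v" and G: "G \<in> Dom_grad M v"
  defines "q \<equiv> \<lambda>k w t. exp (- t) * (grad M v k F w \<bullet> OU_vec M v t (grad M v k G) w)"
  defines "g \<equiv> \<lambda>k w. LINT t:{0..}|lborel. q k w t"
  shows "(AE w in M. \<forall>k. set_integrable lborel {0..} (q k w)) \<and>
    (AE w in M. summable (\<lambda>k. g k w)) \<and> integrable M (\<lambda>w. \<Sum>k. g k w) \<and> cov M F G = (\<integral>w. (\<Sum>k. g k w) \<partial>M)"
proof -
  note FL = Dom_grad_summable[OF F] and GL = Dom_grad_summable[OF G]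
  note DF = grad_comp_coef[OF FL(1)] and DG = grad_comp_coef[OF GL(1)]
  let ?q = "\<lambda>k j w t. exp (- t) * (grad_comp M v k j F w * OU M v t (grad_comp M v k j G) w)"
  let ?h = "\<lambda>k j w. LINT t:{0..}|lborel. ?q k j w t"
  note I = OU_time_integral[OF DF(1) DG(1)]
  have q: "q k w = (\<lambda>t. \<Sum>j\<in>UNIV. ?q k j w t)" for k w
    by (simp add: q_def fun_eq_iff inner_vec_def OU_vec_def grad_def sum_distrib_left)
  have AE_q: "AE w in M. \<forall>k j. set_integrable lborel {0..} (?q k j w)"
    unfolding AE_all_countable by (intro allI I(1))
  have q_int: "set_integrable lborel {0..} (q k w) \<and> g k w = (\<Sum>j\<in>UNIV. ?h k j w)"
    if "\<forall>k j. set_integrable lborel {0..} (?q k j w)" for k w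
  proof
    have int: "integrable lborel (\<lambda>t. indicator {0..} t *\<^sub>R ?q k j w t)" for j
      using that unfolding set_integrable_def by blast
    have eq: "indicator {0..} t *\<^sub>R q k w t = (\<Sum>j\<in>UNIV. indicator {0..} t *\<^sub>R ?q k j w t)" for t :: real
      unfolding q by (rule scaleR_sum_right)
    show "set_integrable lborel {0..} (q k w)"
      unfolding set_integrable_def eq by (intro Bochner_Integration.integrable_sum int)
    show "g k w = (\<Sum>j\<in>UNIV. ?h k j w)"
      unfolding g_def set_lebesgue_integral_def eq by (rule Bochner_Integration.integral_sum[OF int])
  qed
  have "AE w in M. \<forall>k. set_integrable lborel {0..} (q k w)"
    using AE_q by eventually_elim (use q_int in blast)
  moreover have AE_g: "AE w in M. \<forall>k. g k w = (\<Sum>j\<in>UNIV. ?h k j w)"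
    using AE_q by eventually_elim (use q_int in blast)
  moreover have S: "(AE w in M. summable (\<lambda>k. \<Sum>j\<in>UNIV. ?h k j w)) \<and> integrable M (\<lambda>w. \<Sum>k. \<Sum>j\<in>UNIV. ?h k j w) \<and>
      cov M F G = (\<integral>w. (\<Sum>k. \<Sum>j\<in>UNIV. ?h k j w) \<partial>M)"
  proof (rule integral_suminf_sums)
    show "integrable M (\<lambda>w. \<Sum>j\<in>UNIV. ?h k j w)" for k by (intro Bochner_Integration.integrable_sum I(2))
    show "(\<integral>w. \<bar>\<Sum>j\<in>UNIV. ?h k j w\<bar> \<partial>M) \<le> (\<Sum>j\<in>UNIV. ((\<integral>w. (grad_comp M v k j F w)\<^sup>2 \<partial>M) + (\<integral>w. (grad_comp M v k j G w)\<^sup>2 \<partial>M)) / 2)" for k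
      by (rule integrable_sum_abs_le[OF I(2) I(3)])
    show "summable (\<lambda>k. \<Sum>j\<in>UNIV. ((\<integral>w. (grad_comp M v k j F w)\<^sup>2 \<partial>M) + (\<integral>w. (grad_comp M v k j G w)\<^sup>2 \<partial>M)) / 2)"
      by (rule Dom_grad_bound_summable[OF F G])
    have "(\<lambda>k. \<Sum>j\<in>UNIV. \<integral>w. ?h k j w \<partial>M) sums cov M F G"
    proof (rule sums_any_pair[OF cov_has_sum[OF FL(1) GL(1)]])
      fix k j
      have "((\<lambda>T. chaos_coef M v (grad_comp M v k j F) T * chaos_coef M v (grad_comp M v k j G) T / real (Suc (card T)))
          has_sum (\<integral>w. ?h k j w \<partial>M)) chaos_index"
        by (rule I(4))
      moreover have "chaos_coef M v (grad_comp M v k j F) T * chaos_coef M v (grad_comp M v k j G) T / real (Suc (card T)) =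
          (if k \<in> fst ` T then 0 else chaos_coef M v F (insert (k, j) T) * chaos_coef M v G (insert (k, j) T) / real (Suc (card T)))"
        if T: "T \<in> chaos_index" for T
        using DF(2)[OF T] DG(2)[OF T] by simp
      ultimately show "((\<lambda>T. if k \<in> fst ` T then 0 else chaos_coef M v F (insert (k, j) T) * chaos_coef M v G (insert (k, j) T) / real (Suc (card T)))
          has_sum (\<integral>w. ?h k j w \<partial>M)) chaos_index"
        by (simp only: cong: has_sum_cong)
    qed
    moreover have "(\<integral>w. (\<Sum>j\<in>UNIV. ?h k j w) \<partial>M) = (\<Sum>j\<in>UNIV. \<integral>w. ?h k j w \<partial>M)" for k
      by (rule Bochner_Integration.integral_sum[OF I(2)])
    ultimately show "(\<lambda>k. \<integral>w. (\<Sum>j\<in>UNIV. ?h k j w) \<partial>M) sums cov M F G" by simp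
  qed
  moreover have "AE w in M. summable (\<lambda>k. g k w)"
    using AE_g S[THEN conjunct1] by eventually_elim simp
  \<comment> \<open>The time integral splits into components only almost surely, so its measurability is a separate matter.\<close>
  moreover have g_meas: "g k \<in> borel_measurable M" for k
  proof -
    have meas: "(\<lambda>(t, w). indicator {0..} t * ?q k j w t) \<in> borel_measurable (lborel \<Otimes>\<^sub>M M)" for j
      by (rule OU_integrand_measurable[OF DF(1) DG(1)])
    have [measurable]: "(\<lambda>p. indicator {0..} (snd p) * ?q k j (fst p) (snd p)) \<in> borel_measurable (M \<Otimes>\<^sub>M lborel)" for j
      using measurable_pair_swap[OF meas[of j]] by (simp only: case_prod_beta' fst_conv snd_conv)
    have "g k = (\<lambda>w. \<integral>t. (\<Sum>j\<in>UNIV. indicator {0..} t * ?q k j w t) \<partial>lborel)"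
      by (simp add: g_def fun_eq_iff set_lebesgue_integral_def q sum_distrib_left)
    also have "\<dots> \<in> borel_measurable M" by measurable
    finally show ?thesis .
  qed
  have [measurable]: "(\<lambda>w. \<Sum>k. g k w) \<in> borel_measurable M"
    using g_meas by (intro borel_measurable_suminf)
  have [measurable]: "(\<lambda>w. \<Sum>k. \<Sum>j\<in>UNIV. ?h k j w) \<in> borel_measurable M"
    using S by auto
  have AE_sum: "AE w in M. (\<Sum>k. g k w) = (\<Sum>k. \<Sum>j\<in>UNIV. ?h k j w)"
    using AE_g by eventually_elim simp
  have "integrable M (\<lambda>w. \<Sum>k. g k w) \<longleftrightarrow> integrable M (\<lambda>w. \<Sum>k. \<Sum>j\<in>UNIV. ?h k j w)"
    by (rule integrable_cong_AE[OF _ _ AE_sum]) measurable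
  moreover have "(\<integral>w. (\<Sum>k. g k w) \<partial>M) = (\<integral>w. (\<Sum>k. \<Sum>j\<in>UNIV. ?h k j w) \<partial>M)"
    by (rule integral_cong_AE[OF _ _ AE_sum]) measurable
  ultimately show ?thesis by simp
qed

end

theorem proposition9p1:
  fixes M :: "(nat \<Rightarrow> nat) measure"
    and v :: "nat \<Rightarrow> nat \<Rightarrow> (nat \<Rightarrow> nat) \<Rightarrow> real ^ ('d::finite)"
    and F G :: "(nat \<Rightarrow> nat) \<Rightarrow> real"
  assumes "obtuse_random_walk M v"
    and "F \<in> Dom_grad M v" and "G \<in> Dom_grad M v"
  shows
    "((AE w in M. summable (\<lambda>k. vec_cond_exp M (past M k) (grad M v k F) w \<bullet> grad M v k G w)) \<and>
      integrable M (\<lambda>w. \<Sum>k. vec_cond_exp M (past M k) (grad M v k F) w \<bullet> grad M v k G w) \<and>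
      cov M F G =
        (\<integral>w. (\<Sum>k. vec_cond_exp M (past M k) (grad M v k F) w \<bullet> grad M v k G w) \<partial>M)) \<and>
     ((AE w in M. \<forall>k. set_integrable lborel {0..}
          (\<lambda>t. exp (- t) * (grad M v k F w \<bullet> OU_vec M v t (grad M v k G) w))) \<and>
      (AE w in M. summable (\<lambda>k. LINT t:{0..}|lborel.
          exp (- t) * (grad M v k F w \<bullet> OU_vec M v t (grad M v k G) w))) \<and>
      integrable M (\<lambda>w. \<Sum>k. LINT t:{0..}|lborel.
          exp (- t) * (grad M v k F w \<bullet> OU_vec M v t (grad M v k G) w)) \<and>
      cov M F G =
        (\<integral>w. (\<Sum>k. LINT t:{0..}|lborel.
            exp (- t) * (grad M v k F w \<bullet> OU_vec M v t (grad M v k G) w)) \<partial>M))"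
proof -
  interpret obtuse_random_walk M v by (rule assms(1))
  show ?thesis
    by (rule conjI[OF clark_ocone_covariance[OF assms(2,3)] OU_covariance[OF assms(2,3)]])
qed

end
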